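(* (Fundamental Theorem for Hopf algebroids.) Let $\mathcal{A}=(\mathcal{A}_L,\mathcal{A}_R,S)$ be a Hopf algebroid over a commutative ring $k$, with $\mathcal{A}_L=(A,L,s_L,t_L,\gamma_L,\pi_L)$, and let ${}^{\mathcal{W}}\mathcal{M}$ be the category of left-left Hopf modules over $\mathcal{A}_L$. Assume that, for every $(M,\tau)\in{}^{\mathcal{W}}\mathcal{M}$, the kernel of the map $$M\to A_L\otimes{}_LM,\qquad m\mapsto \tau(m)-(1_A\otimes m)$$ is preserved by the functor ${}^LA\otimes-:\mathcal{M}_L\to\mathcal{M}_L$ (this holds, e.g., if ${}^LA$ is a flat module). Then the functors $$G:{}^{\mathcal{W}}\mathcal{M}\to\mathcal{M}_L,\qquad (M,\tau)\mapsto \mathrm{Coinv}(M)_L=\{m\in M\mid\tau(m)=1_A\otimes m\}$$ and $$F:\mathcal{M}_L\to{}^{\mathcal{W}}\mathcal{M},\qquad N_L\mapsto({}^LA\otimes N_L,\ \gamma_L\otimes N_L)$$ are inverse equivalences.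
   Context: Algebras are associative unital algebras over a commutative ring $k$; $\mathcal{M}_L$ is the category of right $L$-modules. **Left bialgebroid.** A left bialgebroid $(A,L,s,t,\gamma,\pi)$ consists of $k$-algebras $A$ (total) and $L$ (base), algebra homomorphisms $s:L\to A$ and $t:L^{op}\to A$ with commuting ranges, and an $L$-coring structure (coassociative coproduct $\gamma:A\to A\otimes_L A$ and counit $\pi:A\to L$, both $L$-$L$ bimodule maps) on the $L$-$L$ bimodule $A$ with actions $l\cdot a\cdot l'=s(l)t(l')a$. Writing $\gamma(a)=a_{(1)}\otimes a_{(2)}$, it is required that $a_{(1)}t(l)\otimes a_{(2)}=a_{(1)}\otimes a_{(2)}s(l)$, $\gamma(1)=1\otimes 1$, $\gamma(aa')=\gamma(a)\gamma(a')$, $\pi(1)=1$, $\pi(a\,s(\pi(a')))=\pi(aa')=\pi(a\,t(\pi(a')))$. **Right bialgebroid.** $(A,R,s,t,\gamma,\pi)$ is a right bialgebroid if $(A^{op},R,t,s,\gamma,\pi)$ is a left bialgebroid. Explicitly: $s:R\to A$, $t:R^{op}\to A$ are algebra maps with commuting ranges; $(A,\gamma,\pi)$ is an $R$-coring for the bimodule $r\cdot a\cdot r'=a\,s(r')t(r)$; and, with $\gamma(a)=a^{(1)}\otimes a^{(2)}$: $s(r)a^{(1)}\otimes a^{(2)}=a^{(1)}\otimes t(r)a^{(2)}$, $\gamma(1)=1\otimes1$, $\gamma(aa')=\gamma(a)\gamma(a')$, $\pi(1)=1$, $\pi(s(\pi(a))a')=\pi(aa')=\pi(t(\pi(a))a')$.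 **Module notation.** For $B\in\{L,R\}$ with $s=s_B,t=t_B$: ${}_BA$ is $A$ with left action $b\cdot a=s(b)a$; $A_B$ has right action $a\cdot b=t(b)a$; $A^B$ has right action $a\cdot b=a\,s(b)$; ${}^BA$ has left action $b\cdot a=a\,t(b)$. In a tensor product the displayed module structures are the ones balanced over $B$ (or $B^{op}$), e.g. $A_L\otimes{}_LA$ has $t_L(l)a\otimes b=a\otimes s_L(l)b$, $A^R\otimes{}^RA$ has $as_R(r)\otimes b=a\otimes bt_R(r)$, and for a right $L$-module $N$, ${}^LA\otimes N_L$ has $a\,t_L(l)\otimes n=a\otimes n\cdot l$. **Hopf algebroid.** $\mathcal{A}=(\mathcal{A}_L,\mathcal{A}_R,S)$ consists of a left bialgebroid $\mathcal{A}_L=(A,L,s_L,t_L,\gamma_L,\pi_L)$ and a right bialgebroid $\mathcal{A}_R=(A,R,s_R,t_R,\gamma_R,\pi_R)$ on the same total algebra $A$ and a $k$-linear map $S:A\to A$ (antipode, not assumed bijective) such that (i) $s_L\pi_Lt_R=t_R$, $t_L\pi_Ls_R=s_R$, $s_R\pi_Rt_L=t_L$, $t_R\pi_Rs_L=s_L$; (ii) $(\gamma_L\otimes{}^RA)\gamma_R=(A_L\otimes\gamma_R)\gamma_L$ as maps $A\to A_L\otimes{}_LA^R\otimes{}^RA$, and $(\gamma_R\otimes{}_LA)\gamma_L=(A^R\otimes\gamma_L)\gamma_R$ as maps $A\to A^R\otimes{}^RA_L\otimes{}_LA$; (iii) $S(t_L(l')\,a\,t_L(l))=s_L(l)S(a)s_L(l')$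 and $S(t_R(r')\,a\,t_R(r))=s_R(r)S(a)s_R(r')$; (iv) $S(a_{(1)})a_{(2)}=s_R\pi_R(a)$ and $a^{(1)}S(a^{(2)})=s_L\pi_L(a)$, where $\gamma_L(a)=a_{(1)}\otimes a_{(2)}$ and $\gamma_R(a)=a^{(1)}\otimes a^{(2)}$. **Hopf modules.** A left-left Hopf module over $\mathcal{A}_L$ is a pair $(M,\tau)$ where $M$ is a left $A$-module, regarded as a left $L$-module ${}_LM$ via $l\cdot m=s_L(l)m$, and $\tau:M\to A_L\otimes{}_LM$, $\tau(m)=m_{\langle-1\rangle}\otimes m_{\langle0\rangle}$, is a left coaction on ${}_LM$ of the $L$-coring $({}_LA_L,\gamma_L,\pi_L)$ (left $L$-linear, coassociative, counital) such that $\tau(a\cdot m)=a_{(1)}m_{\langle-1\rangle}\otimes a_{(2)}\cdot m_{\langle0\rangle}$. Morphisms are the maps which are left $A$-linear and left colinear. (Equivalently, these are left comodules over the $A$-coring $\mathcal{W}=(A_L\otimes{}_LA,\gamma_L\otimes{}_LA,\pi_L\otimes{}_LA)$ with bimodule structure $a\cdot(b\otimes c)\cdot d=a_{(1)}b\otimes a_{(2)}cd$.) Any left $A$-module $M$ is a right $L$-module $M_L$ via $m\cdot l=t_L(l)m$; $\mathrm{Coinv}(M)$ is a right $L$-submodule. The map $m\mapsto\tau(m)-1_A\otimes m$ is right $L$-linear when $A_L\otimes{}_LM$ carries the right $L$-action by $t_L$ on the factor $M$. That the kernel is preserved by ${}^LA\otimes-$ means that the canonical map from ${}^LA\otimes\mathrm{Coinv}(M)_L$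 is an isomorphism onto the kernel of the map obtained by applying ${}^LA\otimes-$. The left $A$-module structure on ${}^LA\otimes N_L$ is by left multiplication in the first factor and its coaction is $a\otimes n\mapsto a_{(1)}\otimes(a_{(2)}\otimes n)$. *)

theory Defs
  imports "HOL-Algebra.Module" "HOL-Algebra.Free_Abelian_Groups"
begin

section \<open>Algebras and modules over noncommutative rings\<close>

definition opp :: "('a, 'e) monoid_scheme \<Rightarrow> ('a, 'e) monoid_scheme" where
  "opp A = A\<lparr>monoid.mult := \<lambda>x y. y \<otimes>\<^bsub>A\<^esub> x\<rparr>"

text \<open>The library locale for algebras over a ring requires commutativity; here it is not assumed.\<close>

locale assoc_algebra = module K A + ring A
  for K :: "'k ring" (structure) and A :: "('k, 'a) module" (structure) +
  assumes smult_mult_left: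
      "\<lbrakk>c \<in> carrier K; x \<in> carrier A; y \<in> carrier A\<rbrakk>
        \<Longrightarrow> (c \<odot>\<^bsub>A\<^esub> x) \<otimes>\<^bsub>A\<^esub> y = c \<odot>\<^bsub>A\<^esub> (x \<otimes>\<^bsub>A\<^esub> y)"
    and smult_mult_right:
      "\<lbrakk>c \<in> carrier K; x \<in> carrier A; y \<in> carrier A\<rbrakk>
        \<Longrightarrow> x \<otimes>\<^bsub>A\<^esub> (c \<odot>\<^bsub>A\<^esub> y) = c \<odot>\<^bsub>A\<^esub> (x \<otimes>\<^bsub>A\<^esub> y)"

definition algebra_hom ::
  "'k ring \<Rightarrow> ('k, 'a) module \<Rightarrow> ('k, 'b) module \<Rightarrow> ('a \<Rightarrow> 'b) set" where
  "algebra_hom K A B = {f \<in> ring_hom A B.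
     \<forall>c \<in> carrier K. \<forall>x \<in> carrier A. f (c \<odot>\<^bsub>A\<^esub> x) = c \<odot>\<^bsub>B\<^esub> f x}"

definition additive_on :: "('a, 'e) ring_scheme \<Rightarrow> ('b, 'f) ring_scheme \<Rightarrow> ('a \<Rightarrow> 'b) \<Rightarrow> bool" where
  "additive_on M N f \<longleftrightarrow> f \<in> carrier M \<rightarrow> carrier N \<and>
     (\<forall>x \<in> carrier M. \<forall>y \<in> carrier M. f (x \<oplus>\<^bsub>M\<^esub> y) = f x \<oplus>\<^bsub>N\<^esub> f y)"

text \<open>Modules are records of type \<^typ>\<open>('a, 'm) module\<close>, whose fields \<^const>\<open>monoid.mult\<close> and
  \<^const>\<open>monoid.one\<close> carry no meaning.\<close>

locale left_module = ring A + M: abelian_group M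
  for A :: "('a, 'e) ring_scheme" (structure) and M :: "('a, 'm) module" (structure) +
  assumes act_closed:
      "\<lbrakk>a \<in> carrier A; x \<in> carrier M\<rbrakk> \<Longrightarrow> a \<odot>\<^bsub>M\<^esub> x \<in> carrier M"
    and act_add_left:
      "\<lbrakk>a \<in> carrier A; b \<in> carrier A; x \<in> carrier M\<rbrakk>
        \<Longrightarrow> (a \<oplus>\<^bsub>A\<^esub> b) \<odot>\<^bsub>M\<^esub> x = a \<odot>\<^bsub>M\<^esub> x \<oplus>\<^bsub>M\<^esub> b \<odot>\<^bsub>M\<^esub> x"
    and act_add_right:
      "\<lbrakk>a \<in> carrier A; x \<in> carrier M; y \<in> carrier M\<rbrakk>
        \<Longrightarrow> a \<odot>\<^bsub>M\<^esub> (x \<oplus>\<^bsub>M\<^esub> y) = a \<odot>\<^bsub>M\<^esub> x \<oplus>\<^bsub>M\<^esub> a \<odot>\<^bsub>M\<^esub> y"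
    and act_mult:
      "\<lbrakk>a \<in> carrier A; b \<in> carrier A; x \<in> carrier M\<rbrakk>
        \<Longrightarrow> (a \<otimes>\<^bsub>A\<^esub> b) \<odot>\<^bsub>M\<^esub> x = a \<odot>\<^bsub>M\<^esub> (b \<odot>\<^bsub>M\<^esub> x)"
    and act_one: "x \<in> carrier M \<Longrightarrow> \<one>\<^bsub>A\<^esub> \<odot>\<^bsub>M\<^esub> x = x"

text \<open>In a right module \<open>N\<close> the element \<open>x \<cdot> l\<close> is written \<open>l \<odot>\<^bsub>N\<^esub> x\<close>.\<close>

definition right_module :: "('k, 'b) module \<Rightarrow> ('b, 'm) module \<Rightarrow> bool" where
  "right_module L N \<longleftrightarrow> left_module (opp L) N"

definition linear_maps ::
  "('a, 'e) ring_scheme \<Rightarrow> ('a, 'm) module \<Rightarrow> ('a, 'n) module \<Rightarrow> ('m \<Rightarrow> 'n) set" where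
  "linear_maps A M N = {f \<in> carrier M \<rightarrow>\<^sub>E carrier N. additive_on M N f \<and>
     (\<forall>a \<in> carrier A. \<forall>x \<in> carrier M. f (a \<odot>\<^bsub>M\<^esub> x) = a \<odot>\<^bsub>N\<^esub> f x)}"

definition with_action :: "('m, 'e) ring_scheme \<Rightarrow> ('b \<Rightarrow> 'm \<Rightarrow> 'm) \<Rightarrow> ('b, 'm) module" where
  "with_action M act = \<lparr>carrier = carrier M, monoid.mult = undefined, monoid.one = undefined,
     ring.zero = \<zero>\<^bsub>M\<^esub>, add = add M, smult = act\<rparr>"

text \<open>With \<open>s\<close>, \<open>t\<close> the source and target maps of a bialgebroid over \<open>B\<close>, the four module
  structures \<open>\<^sub>BA\<close>, \<open>A\<^sub>B\<close>, \<open>A\<^sup>B\<close>, \<open>\<^sup>BA\<close> are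
  \<open>lmul A s\<close>, \<open>lmul A t\<close>, \<open>rmul A s\<close>, \<open>rmul A t\<close>, respectively.\<close>

definition lmul :: "('a, 'e) ring_scheme \<Rightarrow> ('b \<Rightarrow> 'a) \<Rightarrow> ('b, 'a) module" where
  "lmul A f = with_action A (\<lambda>b a. f b \<otimes>\<^bsub>A\<^esub> a)"

definition rmul :: "('a, 'e) ring_scheme \<Rightarrow> ('b \<Rightarrow> 'a) \<Rightarrow> ('b, 'a) module" where
  "rmul A f = with_action A (\<lambda>b a. a \<otimes>\<^bsub>A\<^esub> f b)"

definition restrict_scalars :: "('a, 'm) module \<Rightarrow> ('b \<Rightarrow> 'a) \<Rightarrow> ('b, 'm) module" where
  "restrict_scalars M f = with_action M (\<lambda>b m. f b \<odot>\<^bsub>M\<^esub> m)"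


section \<open>Tensor products\<close>

text \<open>The abelian group with generators \<open>X\<close> and relators \<open>Rl\<close>. A map \<open>f\<close> from \<open>X\<close> to an abelian
  group \<open>G\<close> that respects the relators induces the homomorphism \<open>pres_lift G f\<close>; if \<open>f\<close> does not
  respect them, the value of \<open>pres_lift\<close> is unspecified.\<close>

definition pres_quotient :: "'x set \<Rightarrow> ('x \<Rightarrow>\<^sub>0 int) set \<Rightarrow> ('x \<Rightarrow>\<^sub>0 int) set monoid" where
  "pres_quotient X Rl = free_Abelian_group X Mod generate (free_Abelian_group X) Rl"

definition pres_group :: "'x set \<Rightarrow> ('x \<Rightarrow>\<^sub>0 int) set \<Rightarrow> ('x \<Rightarrow>\<^sub>0 int) set ring" where
  "pres_group X Rl =
    \<lparr>carrier = carrier (pres_quotient X Rl), monoid.mult = undefined, monoid.one = undefined,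
     ring.zero = \<one>\<^bsub>pres_quotient X Rl\<^esub>, add = monoid.mult (pres_quotient X Rl)\<rparr>"

definition pres_gen :: "'x set \<Rightarrow> ('x \<Rightarrow>\<^sub>0 int) set \<Rightarrow> 'x \<Rightarrow> ('x \<Rightarrow>\<^sub>0 int) set" where
  "pres_gen X Rl x =
    generate (free_Abelian_group X) Rl #>\<^bsub>free_Abelian_group X\<^esub> frag_of x"

definition pres_lift :: "('g, 'e) ring_scheme \<Rightarrow> ('x \<Rightarrow> 'g) \<Rightarrow> ('x \<Rightarrow>\<^sub>0 int) set \<Rightarrow> 'g" where
  "pres_lift G f z = the_elem
    ((\<lambda>c. \<Oplus>\<^bsub>G\<^esub>x \<in> Poly_Mapping.keys c. [Poly_Mapping.lookup c x] \<cdot>\<^bsub>G\<^esub> f x) ` z)"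

text \<open>\<open>tensor B P Q\<close> is the tensor product over \<open>B\<close>, balanced by \<open>(b \<odot> p, q) \<sim> (p, b \<odot> q)\<close>.
  Which of \<open>P\<close>, \<open>Q\<close> is a right and which is a left module is not recorded; so \<open>\<^sup>LA \<otimes> N\<^sub>L\<close> is
  written in this order as well.\<close>

definition tensor_rels ::
  "('b, 'e) ring_scheme \<Rightarrow> ('b, 'p) module \<Rightarrow> ('b, 'q) module \<Rightarrow> ('p \<times> 'q \<Rightarrow>\<^sub>0 int) set" where
  "tensor_rels B P Q =
     {frag_of (p \<oplus>\<^bsub>P\<^esub> p', q) - frag_of (p, q) - frag_of (p', q) | p p' q.
        p \<in> carrier P \<and> p' \<in> carrier P \<and> q \<in> carrier Q}
   \<union> {frag_of (p, q \<oplus>\<^bsub>Q\<^esub> q') - frag_of (p, q) - frag_of (p, q') | p q q'.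
        p \<in> carrier P \<and> q \<in> carrier Q \<and> q' \<in> carrier Q}
   \<union> {frag_of (b \<odot>\<^bsub>P\<^esub> p, q) - frag_of (p, b \<odot>\<^bsub>Q\<^esub> q) | b p q.
        b \<in> carrier B \<and> p \<in> carrier P \<and> q \<in> carrier Q}"

definition tensor ::
  "('b, 'e) ring_scheme \<Rightarrow> ('b, 'p) module \<Rightarrow> ('b, 'q) module \<Rightarrow> ('p \<times> 'q \<Rightarrow>\<^sub>0 int) set ring" where
  "tensor B P Q = pres_group (carrier P \<times> carrier Q) (tensor_rels B P Q)"

definition tens ::
  "('b, 'e) ring_scheme \<Rightarrow> ('b, 'p) module \<Rightarrow> ('b, 'q) module \<Rightarrow> 'p \<Rightarrow> 'q
    \<Rightarrow> ('p \<times> 'q \<Rightarrow>\<^sub>0 int) set" where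
  "tens B P Q p q = pres_gen (carrier P \<times> carrier Q) (tensor_rels B P Q) (p, q)"

text \<open>Unparenthesised triple tensor product \<open>P \<otimes>\<^sub>B Q \<otimes>\<^sub>C U\<close>. The two module structures of the middle
  factor are passed as two modules \<open>Q\<close>, \<open>Q'\<close> with the same underlying abelian group.\<close>

definition tensor3_rels ::
  "('b, 'e) ring_scheme \<Rightarrow> ('c, 'f) ring_scheme \<Rightarrow> ('b, 'p) module \<Rightarrow> ('b, 'q) module
    \<Rightarrow> ('c, 'q) module \<Rightarrow> ('c, 'u) module \<Rightarrow> ('p \<times> 'q \<times> 'u \<Rightarrow>\<^sub>0 int) set" where
  "tensor3_rels B C P Q Q' U =
     {frag_of (p \<oplus>\<^bsub>P\<^esub> p', q, u) - frag_of (p, q, u) - frag_of (p', q, u) | p p' q u.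
        p \<in> carrier P \<and> p' \<in> carrier P \<and> q \<in> carrier Q \<and> u \<in> carrier U}
   \<union> {frag_of (p, q \<oplus>\<^bsub>Q\<^esub> q', u) - frag_of (p, q, u) - frag_of (p, q', u) | p q q' u.
        p \<in> carrier P \<and> q \<in> carrier Q \<and> q' \<in> carrier Q \<and> u \<in> carrier U}
   \<union> {frag_of (p, q, u \<oplus>\<^bsub>U\<^esub> u') - frag_of (p, q, u) - frag_of (p, q, u') | p q u u'.
        p \<in> carrier P \<and> q \<in> carrier Q \<and> u \<in> carrier U \<and> u' \<in> carrier U}
   \<union> {frag_of (b \<odot>\<^bsub>P\<^esub> p, q, u) - frag_of (p, b \<odot>\<^bsub>Q\<^esub> q, u) | b p q u.
        b \<in> carrier B \<and> p \<in> carrier P \<and> q \<in> carrier Q \<and> u \<in> carrier U}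
   \<union> {frag_of (p, c \<odot>\<^bsub>Q'\<^esub> q, u) - frag_of (p, q, c \<odot>\<^bsub>U\<^esub> u) | c p q u.
        c \<in> carrier C \<and> p \<in> carrier P \<and> q \<in> carrier Q \<and> u \<in> carrier U}"

definition tensor3 ::
  "('b, 'e) ring_scheme \<Rightarrow> ('c, 'f) ring_scheme \<Rightarrow> ('b, 'p) module \<Rightarrow> ('b, 'q) module
    \<Rightarrow> ('c, 'q) module \<Rightarrow> ('c, 'u) module \<Rightarrow> ('p \<times> 'q \<times> 'u \<Rightarrow>\<^sub>0 int) set ring" where
  "tensor3 B C P Q Q' U =
     pres_group (carrier P \<times> carrier Q \<times> carrier U) (tensor3_rels B C P Q Q' U)"

definition tens3 ::
  "('b, 'e) ring_scheme \<Rightarrow> ('c, 'f) ring_scheme \<Rightarrow> ('b, 'p) module \<Rightarrow> ('b, 'q) module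
    \<Rightarrow> ('c, 'q) module \<Rightarrow> ('c, 'u) module \<Rightarrow> 'p \<Rightarrow> 'q \<Rightarrow> 'u
    \<Rightarrow> ('p \<times> 'q \<times> 'u \<Rightarrow>\<^sub>0 int) set" where
  "tens3 B C P Q Q' U p q u =
     pres_gen (carrier P \<times> carrier Q \<times> carrier U) (tensor3_rels B C P Q Q' U) (p, q, u)"


section \<open>Hopf algebroids\<close>

text \<open>\<open>A\<^sub>L \<otimes> \<^sub>LA\<close> and \<open>A\<^sub>L \<otimes> \<^sub>LM\<close>\<close>

abbreviation AA :: "('k, 'a) module \<Rightarrow> ('k, 'b) module \<Rightarrow> ('b \<Rightarrow> 'a) \<Rightarrow> ('b \<Rightarrow> 'a)
    \<Rightarrow> ('a \<times> 'a \<Rightarrow>\<^sub>0 int) set ring" where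
  "AA A L s t \<equiv> tensor L (lmul A t) (lmul A s)"

abbreviation aa where
  "aa A L s t \<equiv> tens L (lmul A t) (lmul A s)"

abbreviation AM :: "('k, 'a) module \<Rightarrow> ('k, 'b) module \<Rightarrow> ('b \<Rightarrow> 'a) \<Rightarrow> ('b \<Rightarrow> 'a)
    \<Rightarrow> ('a, 'm) module \<Rightarrow> ('a \<times> 'm \<Rightarrow>\<^sub>0 int) set ring" where
  "AM A L s t M \<equiv> tensor L (lmul A t) (restrict_scalars M s)"

abbreviation am where
  "am A L s t M \<equiv> tens L (lmul A t) (restrict_scalars M s)"

text \<open>Sums in Sweedler notation are written with \<^const>\<open>pres_lift\<close>:
  for \<open>\<gamma> a = a\<^sub>1 \<otimes> a\<^sub>2\<close>, the element \<open>pres_lift G (\<lambda>(x, y). f x y) (\<gamma> a)\<close> is \<open>f a\<^sub>1 a\<^sub>2\<close>.\<close>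

locale left_bialgebroid =
  fixes K :: "'k ring" and A :: "('k, 'a) module" (structure) and L :: "('k, 'b) module"
    and s t :: "'b \<Rightarrow> 'a" and \<gamma> :: "'a \<Rightarrow> ('a \<times> 'a \<Rightarrow>\<^sub>0 int) set" and \<pi> :: "'a \<Rightarrow> 'b"
  assumes total: "assoc_algebra K A"
    and base: "assoc_algebra K L"
    and source: "s \<in> algebra_hom K L A"
    and target: "t \<in> algebra_hom K (opp L) A"
    and commuting: "\<lbrakk>l \<in> carrier L; l' \<in> carrier L\<rbrakk> \<Longrightarrow> s l \<otimes> t l' = t l' \<otimes> s l"
    and coproduct_additive: "additive_on A (AA A L s t) \<gamma>"
    and coproduct_bilinear:
      "\<lbrakk>l \<in> carrier L; l' \<in> carrier L; a \<in> carrier A\<rbrakk> \<Longrightarrow>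
        \<gamma> (s l \<otimes> t l' \<otimes> a) =
        pres_lift (AA A L s t) (\<lambda>(x, y). aa A L s t (s l \<otimes> x) (t l' \<otimes> y)) (\<gamma> a)"
    and counit_additive: "additive_on A L \<pi>"
    and counit_bilinear:
      "\<lbrakk>l \<in> carrier L; l' \<in> carrier L; a \<in> carrier A\<rbrakk> \<Longrightarrow>
        \<pi> (s l \<otimes> t l' \<otimes> a) = l \<otimes>\<^bsub>L\<^esub> \<pi> a \<otimes>\<^bsub>L\<^esub> l'"
    and coassociative:
      "a \<in> carrier A \<Longrightarrow>
        pres_lift (tensor3 L L (lmul A t) (lmul A s) (lmul A t) (lmul A s))
          (\<lambda>(x, y). pres_lift (tensor3 L L (lmul A t) (lmul A s) (lmul A t) (lmul A s))
             (\<lambda>(u, v). tens3 L L (lmul A t) (lmul A s) (lmul A t) (lmul A s) u v y) (\<gamma> x)) (\<gamma> a) =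
        pres_lift (tensor3 L L (lmul A t) (lmul A s) (lmul A t) (lmul A s))
          (\<lambda>(x, y). pres_lift (tensor3 L L (lmul A t) (lmul A s) (lmul A t) (lmul A s))
             (\<lambda>(u, v). tens3 L L (lmul A t) (lmul A s) (lmul A t) (lmul A s) x u v) (\<gamma> y)) (\<gamma> a)"
    and counital_left:
      "a \<in> carrier A \<Longrightarrow> pres_lift A (\<lambda>(x, y). s (\<pi> x) \<otimes> y) (\<gamma> a) = a"
    and counital_right:
      "a \<in> carrier A \<Longrightarrow> pres_lift A (\<lambda>(x, y). t (\<pi> y) \<otimes> x) (\<gamma> a) = a"
    and takeuchi:
      "\<lbrakk>l \<in> carrier L; a \<in> carrier A\<rbrakk> \<Longrightarrow>
        pres_lift (AA A L s t) (\<lambda>(x, y). aa A L s t (x \<otimes> t l) y) (\<gamma> a) =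
        pres_lift (AA A L s t) (\<lambda>(x, y). aa A L s t x (y \<otimes> s l)) (\<gamma> a)"
    and coproduct_one: "\<gamma> \<one> = aa A L s t \<one> \<one>"
    and coproduct_mult:
      "\<lbrakk>a \<in> carrier A; a' \<in> carrier A\<rbrakk> \<Longrightarrow>
        \<gamma> (a \<otimes> a') =
        pres_lift (AA A L s t)
          (\<lambda>(u, v). pres_lift (AA A L s t)
             (\<lambda>(x, y). aa A L s t (x \<otimes> u) (y \<otimes> v)) (\<gamma> a)) (\<gamma> a')"
    and counit_one: "\<pi> \<one> = \<one>\<^bsub>L\<^esub>"
    and counit_source:
      "\<lbrakk>a \<in> carrier A; a' \<in> carrier A\<rbrakk> \<Longrightarrow> \<pi> (a \<otimes> s (\<pi> a')) = \<pi> (a \<otimes> a')"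
    and counit_target:
      "\<lbrakk>a \<in> carrier A; a' \<in> carrier A\<rbrakk> \<Longrightarrow> \<pi> (a \<otimes> t (\<pi> a')) = \<pi> (a \<otimes> a')"

text \<open>Here \<open>\<gamma>\<close> takes values in \<open>tensor R (lmul (opp A) s) (lmul (opp A) t)\<close>, which is
  \<open>tensor R (rmul A s) (rmul A t) = A\<^sup>R \<otimes> \<^sup>RA\<close>.\<close>

definition right_bialgebroid ::
  "'k ring \<Rightarrow> ('k, 'a) module \<Rightarrow> ('k, 'r) module \<Rightarrow> ('r \<Rightarrow> 'a) \<Rightarrow> ('r \<Rightarrow> 'a)
    \<Rightarrow> ('a \<Rightarrow> ('a \<times> 'a \<Rightarrow>\<^sub>0 int) set) \<Rightarrow> ('a \<Rightarrow> 'r) \<Rightarrow> bool" where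
  "right_bialgebroid K A R s t \<gamma> \<pi> \<longleftrightarrow> left_bialgebroid K (opp A) R t s \<gamma> \<pi>"

locale hopf_algebroid =
  fixes K :: "'k ring" and A :: "('k, 'a) module" (structure)
    and L :: "('k, 'b) module" and sL tL :: "'b \<Rightarrow> 'a"
    and \<gamma>L :: "'a \<Rightarrow> ('a \<times> 'a \<Rightarrow>\<^sub>0 int) set" and \<pi>L :: "'a \<Rightarrow> 'b"
    and R :: "('k, 'r) module" and sR tR :: "'r \<Rightarrow> 'a"
    and \<gamma>R :: "'a \<Rightarrow> ('a \<times> 'a \<Rightarrow>\<^sub>0 int) set" and \<pi>R :: "'a \<Rightarrow> 'r"
    and S :: "'a \<Rightarrow> 'a"
  assumes left: "left_bialgebroid K A L sL tL \<gamma>L \<pi>L"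
    and right: "right_bialgebroid K A R sR tR \<gamma>R \<pi>R"
    and ranges_R: "r \<in> carrier R \<Longrightarrow> sL (\<pi>L (tR r)) = tR r \<and> tL (\<pi>L (sR r)) = sR r"
    and ranges_L: "l \<in> carrier L \<Longrightarrow> sR (\<pi>R (tL l)) = tL l \<and> tR (\<pi>R (sL l)) = sL l"
    and mixed_coassociative_LR:
      "a \<in> carrier A \<Longrightarrow>
        pres_lift (tensor3 L R (lmul A tL) (lmul A sL) (rmul A sR) (rmul A tR))
          (\<lambda>(x, y). pres_lift (tensor3 L R (lmul A tL) (lmul A sL) (rmul A sR) (rmul A tR))
             (\<lambda>(u, v). tens3 L R (lmul A tL) (lmul A sL) (rmul A sR) (rmul A tR) u v y) (\<gamma>L x))
          (\<gamma>R a) =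
        pres_lift (tensor3 L R (lmul A tL) (lmul A sL) (rmul A sR) (rmul A tR))
          (\<lambda>(x, y). pres_lift (tensor3 L R (lmul A tL) (lmul A sL) (rmul A sR) (rmul A tR))
             (\<lambda>(u, v). tens3 L R (lmul A tL) (lmul A sL) (rmul A sR) (rmul A tR) x u v) (\<gamma>R y))
          (\<gamma>L a)"
    and mixed_coassociative_RL:
      "a \<in> carrier A \<Longrightarrow>
        pres_lift (tensor3 R L (rmul A sR) (rmul A tR) (lmul A tL) (lmul A sL))
          (\<lambda>(x, y). pres_lift (tensor3 R L (rmul A sR) (rmul A tR) (lmul A tL) (lmul A sL))
             (\<lambda>(u, v). tens3 R L (rmul A sR) (rmul A tR) (lmul A tL) (lmul A sL) u v y) (\<gamma>R x))
          (\<gamma>L a) =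
        pres_lift (tensor3 R L (rmul A sR) (rmul A tR) (lmul A tL) (lmul A sL))
          (\<lambda>(x, y). pres_lift (tensor3 R L (rmul A sR) (rmul A tR) (lmul A tL) (lmul A sL))
             (\<lambda>(u, v). tens3 R L (rmul A sR) (rmul A tR) (lmul A tL) (lmul A sL) x u v) (\<gamma>L y))
          (\<gamma>R a)"
    and antipode_additive: "additive_on A A S"
    and antipode_smult:
      "\<lbrakk>c \<in> carrier K; a \<in> carrier A\<rbrakk> \<Longrightarrow> S (c \<odot> a) = c \<odot> S a"
    and antipode_L:
      "\<lbrakk>l \<in> carrier L; l' \<in> carrier L; a \<in> carrier A\<rbrakk> \<Longrightarrow>
        S (tL l' \<otimes> a \<otimes> tL l) = sL l \<otimes> S a \<otimes> sL l'"
    and antipode_R: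
      "\<lbrakk>r \<in> carrier R; r' \<in> carrier R; a \<in> carrier A\<rbrakk> \<Longrightarrow>
        S (tR r' \<otimes> a \<otimes> tR r) = sR r \<otimes> S a \<otimes> sR r'"
    and antipode_left:
      "a \<in> carrier A \<Longrightarrow> pres_lift A (\<lambda>(x, y). S x \<otimes> y) (\<gamma>L a) = sR (\<pi>R a)"
    and antipode_right:
      "a \<in> carrier A \<Longrightarrow> pres_lift A (\<lambda>(x, y). x \<otimes> S y) (\<gamma>R a) = sL (\<pi>L a)"


section \<open>Hopf modules\<close>

type_synonym ('a, 'm) hopf_mod = "('a, 'm) module \<times> ('m \<Rightarrow> ('a \<times> 'm \<Rightarrow>\<^sub>0 int) set)"

locale left_hopf_module =
  fixes A :: "('k, 'a) module" (structure) and L :: "('k, 'b) module"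
    and s t :: "'b \<Rightarrow> 'a" and \<gamma> :: "'a \<Rightarrow> ('a \<times> 'a \<Rightarrow>\<^sub>0 int) set" and \<pi> :: "'a \<Rightarrow> 'b"
    and M :: "('a, 'm) module" and \<tau> :: "'m \<Rightarrow> ('a \<times> 'm \<Rightarrow>\<^sub>0 int) set"
  assumes module: "left_module A M"
    and coaction_additive: "additive_on M (AM A L s t M) \<tau>"
    and coaction_linear:
      "\<lbrakk>l \<in> carrier L; m \<in> carrier M\<rbrakk> \<Longrightarrow>
        \<tau> (s l \<odot>\<^bsub>M\<^esub> m) =
        pres_lift (AM A L s t M) (\<lambda>(x, n). am A L s t M (s l \<otimes> x) n) (\<tau> m)"
    and coassociative:
      "m \<in> carrier M \<Longrightarrow>
        pres_lift (tensor3 L L (lmul A t) (lmul A s) (lmul A t) (restrict_scalars M s))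
          (\<lambda>(x, n). pres_lift (tensor3 L L (lmul A t) (lmul A s) (lmul A t) (restrict_scalars M s))
             (\<lambda>(u, v). tens3 L L (lmul A t) (lmul A s) (lmul A t) (restrict_scalars M s) u v n)
             (\<gamma> x)) (\<tau> m) =
        pres_lift (tensor3 L L (lmul A t) (lmul A s) (lmul A t) (restrict_scalars M s))
          (\<lambda>(x, n). pres_lift (tensor3 L L (lmul A t) (lmul A s) (lmul A t) (restrict_scalars M s))
             (\<lambda>(u, v). tens3 L L (lmul A t) (lmul A s) (lmul A t) (restrict_scalars M s) x u v)
             (\<tau> n)) (\<tau> m)"
    and counital:
      "m \<in> carrier M \<Longrightarrow> pres_lift M (\<lambda>(x, n). s (\<pi> x) \<odot>\<^bsub>M\<^esub> n) (\<tau> m) = m"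
    and compatible:
      "\<lbrakk>a \<in> carrier A; m \<in> carrier M\<rbrakk> \<Longrightarrow>
        \<tau> (a \<odot>\<^bsub>M\<^esub> m) =
        pres_lift (AM A L s t M)
          (\<lambda>(u, n). pres_lift (AM A L s t M)
             (\<lambda>(x, y). am A L s t M (x \<otimes> u) (y \<odot>\<^bsub>M\<^esub> n)) (\<gamma> a)) (\<tau> m)"

definition hopf_module_homs ::
  "('k, 'a) module \<Rightarrow> ('k, 'b) module \<Rightarrow> ('b \<Rightarrow> 'a) \<Rightarrow> ('b \<Rightarrow> 'a)
    \<Rightarrow> ('a, 'm) hopf_mod \<Rightarrow> ('a, 'n) hopf_mod \<Rightarrow> ('m \<Rightarrow> 'n) set" where
  "hopf_module_homs A L s t = (\<lambda>(M, \<tau>) (M', \<tau>').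
     {f \<in> linear_maps A M M'. \<forall>m \<in> carrier M.
        \<tau>' (f m) = pres_lift (AM A L s t M') (\<lambda>(x, n). am A L s t M' x (f n)) (\<tau> m)})"

definition coinv :: "('k, 'a) module \<Rightarrow> ('k, 'b) module \<Rightarrow> ('b \<Rightarrow> 'a) \<Rightarrow> ('b \<Rightarrow> 'a)
    \<Rightarrow> ('a, 'm) hopf_mod \<Rightarrow> ('b, 'm) module" where
  "coinv A L s t = (\<lambda>(M, \<tau>).
     (restrict_scalars M t)\<lparr>carrier := {m \<in> carrier M. \<tau> m = am A L s t M \<one>\<^bsub>A\<^esub> m}\<rparr>)"

text \<open>\<open>AN A L t N\<close> is the abelian group \<open>\<^sup>LA \<otimes> N\<^sub>L\<close>, and \<open>induced_map A L t N f\<close> is \<open>\<^sup>LA \<otimes> f\<close> for a map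
  \<open>f\<close> of right \<open>L\<close>-modules with codomain \<open>N\<close>.\<close>

abbreviation AN :: "('k, 'a) module \<Rightarrow> ('k, 'b) module \<Rightarrow> ('b \<Rightarrow> 'a) \<Rightarrow> ('b, 'n) module
    \<Rightarrow> ('a \<times> 'n \<Rightarrow>\<^sub>0 int) set ring" where
  "AN A L t N \<equiv> tensor L (rmul A t) N"

abbreviation an where
  "an A L t N \<equiv> tens L (rmul A t) N"

definition induced_map :: "('k, 'a) module \<Rightarrow> ('k, 'b) module \<Rightarrow> ('b \<Rightarrow> 'a)
    \<Rightarrow> ('b, 'n) module \<Rightarrow> ('n0 \<Rightarrow> 'n) \<Rightarrow> ('a \<times> 'n0 \<Rightarrow>\<^sub>0 int) set \<Rightarrow> ('a \<times> 'n \<Rightarrow>\<^sub>0 int) set" where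
  "induced_map A L t N f = pres_lift (AN A L t N) (\<lambda>(x, n). an A L t N x (f n))"

definition induced_module :: "('k, 'a) module \<Rightarrow> ('k, 'b) module \<Rightarrow> ('b \<Rightarrow> 'a)
    \<Rightarrow> ('b, 'n) module \<Rightarrow> ('a, ('a \<times> 'n \<Rightarrow>\<^sub>0 int) set) module" where
  "induced_module A L t N = with_action (AN A L t N)
     (\<lambda>a. pres_lift (AN A L t N) (\<lambda>(x, n). an A L t N (a \<otimes>\<^bsub>A\<^esub> x) n))"

definition induced_hopf_module :: "('k, 'a) module \<Rightarrow> ('k, 'b) module \<Rightarrow> ('b \<Rightarrow> 'a) \<Rightarrow> ('b \<Rightarrow> 'a)
    \<Rightarrow> ('a \<Rightarrow> ('a \<times> 'a \<Rightarrow>\<^sub>0 int) set) \<Rightarrow> ('b, 'n) module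
    \<Rightarrow> ('a, ('a \<times> 'n \<Rightarrow>\<^sub>0 int) set) hopf_mod" where
  "induced_hopf_module A L s t \<gamma> N = (let I = induced_module A L t N in
     (I, pres_lift (AM A L s t I)
           (\<lambda>(x, n). pres_lift (AM A L s t I)
              (\<lambda>(u, v). am A L s t I u (an A L t N v n)) (\<gamma> x))))"

text \<open>\<open>A\<^sub>L \<otimes> \<^sub>LM\<close> as a right \<open>L\<close>-module by \<open>t\<close> on the factor \<open>M\<close>.\<close>

definition AM_right :: "('k, 'a) module \<Rightarrow> ('k, 'b) module \<Rightarrow> ('b \<Rightarrow> 'a) \<Rightarrow> ('b \<Rightarrow> 'a)
    \<Rightarrow> ('a, 'm) module \<Rightarrow> ('b, ('a \<times> 'm \<Rightarrow>\<^sub>0 int) set) module" where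
  "AM_right A L s t M = with_action (AM A L s t M)
     (\<lambda>l. pres_lift (AM A L s t M) (\<lambda>(x, m). am A L s t M x (t l \<odot>\<^bsub>M\<^esub> m)))"

text \<open>The canonical map from \<open>\<^sup>LA \<otimes> Coinv(M)\<^sub>L\<close>, induced by the inclusion, is bijective onto the kernel
  of \<open>\<^sup>LA \<otimes> (\<tau> - 1 \<otimes> -)\<close>.\<close>

definition coinv_kernel_preserved :: "('k, 'a) module \<Rightarrow> ('k, 'b) module \<Rightarrow> ('b \<Rightarrow> 'a) \<Rightarrow> ('b \<Rightarrow> 'a)
    \<Rightarrow> ('a, 'm) hopf_mod \<Rightarrow> bool" where
  "coinv_kernel_preserved A L s t = (\<lambda>(M, \<tau>).
     bij_betw (induced_map A L t (restrict_scalars M t) (\<lambda>m. m))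
       (carrier (AN A L t (coinv A L s t (M, \<tau>))))
       {z \<in> carrier (AN A L t (restrict_scalars M t)).
          induced_map A L t (AM_right A L s t M)
            (\<lambda>m. \<tau> m \<ominus>\<^bsub>AM A L s t M\<^esub> am A L s t M \<one>\<^bsub>A\<^esub> m) z
          = \<zero>\<^bsub>AN A L t (AM_right A L s t M)\<^esub>})"


section \<open>Categories\<close>

text \<open>Hom-sets of different pairs of objects may overlap, so the composition
  \<open>comp C X Y Z g f\<close> of \<open>f : X \<rightarrow> Y\<close> and \<open>g : Y \<rightarrow> Z\<close> takes the objects as arguments.\<close>

record ('o, 'm) cat =
  obj :: "'o set"
  arr :: "'o \<Rightarrow> 'o \<Rightarrow> 'm set"
  ident :: "'o \<Rightarrow> 'm"
  comp :: "'o \<Rightarrow> 'o \<Rightarrow> 'o \<Rightarrow> 'm \<Rightarrow> 'm \<Rightarrow> 'm"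

record ('o, 'm, 'p, 'n) fctr =
  on_obj :: "'o \<Rightarrow> 'p"
  on_arr :: "'o \<Rightarrow> 'o \<Rightarrow> 'm \<Rightarrow> 'n"

definition is_category :: "('o, 'm) cat \<Rightarrow> bool" where
  "is_category C \<longleftrightarrow>
     (\<forall>X \<in> obj C. ident C X \<in> arr C X X) \<and>
     (\<forall>X \<in> obj C. \<forall>Y \<in> obj C. \<forall>Z \<in> obj C. \<forall>f \<in> arr C X Y. \<forall>g \<in> arr C Y Z.
        comp C X Y Z g f \<in> arr C X Z) \<and>
     (\<forall>X \<in> obj C. \<forall>Y \<in> obj C. \<forall>f \<in> arr C X Y.
        comp C X X Y f (ident C X) = f \<and> comp C X Y Y (ident C Y) f = f) \<and>
     (\<forall>W \<in> obj C. \<forall>X \<in> obj C. \<forall>Y \<in> obj C. \<forall>Z \<in> obj C.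
        \<forall>f \<in> arr C W X. \<forall>g \<in> arr C X Y. \<forall>h \<in> arr C Y Z.
        comp C W Y Z h (comp C W X Y g f) = comp C W X Z (comp C X Y Z h g) f)"

definition is_functor :: "('o, 'm) cat \<Rightarrow> ('p, 'n) cat \<Rightarrow> ('o, 'm, 'p, 'n) fctr \<Rightarrow> bool" where
  "is_functor C D F \<longleftrightarrow>
     (\<forall>X \<in> obj C. on_obj F X \<in> obj D \<and> on_arr F X X (ident C X) = ident D (on_obj F X)) \<and>
     (\<forall>X \<in> obj C. \<forall>Y \<in> obj C. \<forall>f \<in> arr C X Y.
        on_arr F X Y f \<in> arr D (on_obj F X) (on_obj F Y)) \<and>
     (\<forall>X \<in> obj C. \<forall>Y \<in> obj C. \<forall>Z \<in> obj C. \<forall>f \<in> arr C X Y. \<forall>g \<in> arr C Y Z.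
        on_arr F X Z (comp C X Y Z g f) =
        comp D (on_obj F X) (on_obj F Y) (on_obj F Z) (on_arr F Y Z g) (on_arr F X Y f))"

definition id_functor :: "('o, 'm, 'o, 'm) fctr" where
  "id_functor = \<lparr>on_obj = (\<lambda>X. X), on_arr = (\<lambda>X Y f. f)\<rparr>"

definition comp_functor ::
  "('p, 'n, 'q, 'l) fctr \<Rightarrow> ('o, 'm, 'p, 'n) fctr \<Rightarrow> ('o, 'm, 'q, 'l) fctr" where
  "comp_functor G F = \<lparr>on_obj = (\<lambda>X. on_obj G (on_obj F X)),
     on_arr = (\<lambda>X Y f. on_arr G (on_obj F X) (on_obj F Y) (on_arr F X Y f))\<rparr>"

definition is_iso_arr :: "('o, 'm) cat \<Rightarrow> 'o \<Rightarrow> 'o \<Rightarrow> 'm \<Rightarrow> bool" where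
  "is_iso_arr C X Y f \<longleftrightarrow> f \<in> arr C X Y \<and>
     (\<exists>g \<in> arr C Y X. comp C X Y X g f = ident C X \<and> comp C Y X Y f g = ident C Y)"

definition naturally_isomorphic ::
  "('o, 'm) cat \<Rightarrow> ('p, 'n) cat \<Rightarrow> ('o, 'm, 'p, 'n) fctr \<Rightarrow> ('o, 'm, 'p, 'n) fctr \<Rightarrow> bool" where
  "naturally_isomorphic C D F G \<longleftrightarrow>
     (\<exists>\<eta>. (\<forall>X \<in> obj C. is_iso_arr D (on_obj F X) (on_obj G X) (\<eta> X)) \<and>
       (\<forall>X \<in> obj C. \<forall>Y \<in> obj C. \<forall>f \<in> arr C X Y.
          comp D (on_obj F X) (on_obj F Y) (on_obj G Y) (\<eta> Y) (on_arr F X Y f) =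
          comp D (on_obj F X) (on_obj G X) (on_obj G Y) (on_arr G X Y f) (\<eta> X)))"

definition inverse_equivalences ::
  "('o, 'm) cat \<Rightarrow> ('p, 'n) cat \<Rightarrow> ('o, 'm, 'p, 'n) fctr \<Rightarrow> ('p, 'n, 'o, 'm) fctr \<Rightarrow> bool" where
  "inverse_equivalences C D G F \<longleftrightarrow>
     is_category C \<and> is_category D \<and> is_functor C D G \<and> is_functor D C F \<and>
     naturally_isomorphic D D (comp_functor G F) id_functor \<and>
     naturally_isomorphic C C (comp_functor F G) id_functor"

text \<open>The categories of all modules with carrier in a fixed type \<open>'u\<close>, which plays the role of the
  set-theoretic universe. Arrows are functions that are \<^const>\<open>undefined\<close> off the carrier.\<close>

definition hopf_module_cat :: "('k, 'a) module \<Rightarrow> ('k, 'b) module \<Rightarrow> ('b \<Rightarrow> 'a) \<Rightarrow> ('b \<Rightarrow> 'a)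
    \<Rightarrow> ('a \<Rightarrow> ('a \<times> 'a \<Rightarrow>\<^sub>0 int) set) \<Rightarrow> ('a \<Rightarrow> 'b) \<Rightarrow> (('a, 'u) hopf_mod, 'u \<Rightarrow> 'u) cat" where
  "hopf_module_cat A L s t \<gamma> \<pi> =
     \<lparr>obj = {(M, \<tau>). left_hopf_module A L s t \<gamma> \<pi> M \<tau>},
      arr = hopf_module_homs A L s t,
      ident = (\<lambda>(M, \<tau>). restrict id (carrier M)),
      comp = (\<lambda>(M, \<tau>) Y Z g f. compose (carrier M) g f)\<rparr>"

definition right_module_cat :: "('k, 'b) module \<Rightarrow> (('b, 'u) module, 'u \<Rightarrow> 'u) cat" where
  "right_module_cat L =
     \<lparr>obj = {N. right_module L N},
      arr = linear_maps L,
      ident = (\<lambda>N. restrict id (carrier N)),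
      comp = (\<lambda>N Y Z g f. compose (carrier N) g f)\<rparr>"

definition coinv_functor :: "('k, 'a) module \<Rightarrow> ('k, 'b) module \<Rightarrow> ('b \<Rightarrow> 'a) \<Rightarrow> ('b \<Rightarrow> 'a)
    \<Rightarrow> (('a, 'u) hopf_mod, 'u \<Rightarrow> 'u, ('b, 'u) module, 'u \<Rightarrow> 'u) fctr" where
  "coinv_functor A L s t =
     \<lparr>on_obj = coinv A L s t,
      on_arr = (\<lambda>X Y f. restrict f (carrier (coinv A L s t X)))\<rparr>"

text \<open>The tensor product \<open>\<^sup>LA \<otimes> N\<^sub>L\<close> has carrier in a type different from \<open>'u\<close>. To obtain a functor
  between the categories above, its elements are renamed to elements of \<open>'u\<close> by a chosen injection,
  which exists if \<open>'u\<close> is infinite and of at least the cardinality of \<open>A\<close>.\<close>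

definition renaming :: "'x set \<Rightarrow> 'x \<Rightarrow> 'u" where
  "renaming X = (SOME e. inj_on e X)"

definition transport_module :: "('x \<Rightarrow> 'u) \<Rightarrow> ('a, 'x) module \<Rightarrow> ('a, 'u) module" where
  "transport_module e M = (let d = inv_into (carrier M) e in
     \<lparr>carrier = e ` carrier M, monoid.mult = undefined, monoid.one = undefined, ring.zero = e \<zero>\<^bsub>M\<^esub>,
      add = (\<lambda>x y. e (d x \<oplus>\<^bsub>M\<^esub> d y)), smult = (\<lambda>a x. e (a \<odot>\<^bsub>M\<^esub> d x))\<rparr>)"

definition transport_hopf_module :: "('k, 'a) module \<Rightarrow> ('k, 'b) module \<Rightarrow> ('b \<Rightarrow> 'a) \<Rightarrow> ('b \<Rightarrow> 'a)
    \<Rightarrow> ('x \<Rightarrow> 'u) \<Rightarrow> ('a, 'x) hopf_mod \<Rightarrow> ('a, 'u) hopf_mod" where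
  "transport_hopf_module A L s t e = (\<lambda>(M, \<tau>). let M' = transport_module e M in
     (M', \<lambda>x. pres_lift (AM A L s t M') (\<lambda>(a, m). am A L s t M' a (e m))
                (\<tau> (inv_into (carrier M) e x))))"

definition induction_functor :: "('k, 'a) module \<Rightarrow> ('k, 'b) module \<Rightarrow> ('b \<Rightarrow> 'a) \<Rightarrow> ('b \<Rightarrow> 'a)
    \<Rightarrow> ('a \<Rightarrow> ('a \<times> 'a \<Rightarrow>\<^sub>0 int) set)
    \<Rightarrow> (('b, 'u) module, 'u \<Rightarrow> 'u, ('a, 'u) hopf_mod, 'u \<Rightarrow> 'u) fctr" where
  "induction_functor A L s t \<gamma> =
     \<lparr>on_obj = (\<lambda>N. transport_hopf_module A L s t (renaming (carrier (AN A L t N)))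
                      (induced_hopf_module A L s t \<gamma> N)),
      on_arr = (\<lambda>N N' g. \<lambda>x \<in> renaming (carrier (AN A L t N)) ` carrier (AN A L t N).
        renaming (carrier (AN A L t N'))
          (induced_map A L t N' g
            (inv_into (carrier (AN A L t N)) (renaming (carrier (AN A L t N))) x)))\<rparr>"

text \<open>Flatness of \<open>\<^sup>LA\<close>, tested on right \<open>L\<close>-modules with carrier in the type \<open>'u\<close>.\<close>

definition flat :: "'u itself \<Rightarrow> ('k, 'a) module \<Rightarrow> ('k, 'b) module \<Rightarrow> ('b \<Rightarrow> 'a) \<Rightarrow> bool" where
  "flat _ A L t \<longleftrightarrow> (\<forall>(N :: ('b, 'u) module) (N' :: ('b, 'u) module) f.
     right_module L N \<longrightarrow> right_module L N' \<longrightarrow> f \<in> linear_maps L N N' \<longrightarrow> inj_on f (carrier N)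
     \<longrightarrow> inj_on (induced_map A L t N' f) (carrier (AN A L t N)))"

end

theory Submission
  imports Defs
begin

text \<open>The Galois map \<open>\<beta>\<^sub>M : \<^sup>LA \<otimes> M\<^sub>L \<rightarrow> A\<^sub>L \<otimes> \<^sub>LM\<close>, \<open>a \<otimes> m \<mapsto> a\<^sub>1 \<otimes> a\<^sub>2m\<close>, is bijective for every left
  \<open>A\<close>-module \<open>M\<close>: by mixed coassociativity and the antipode axioms its inverse is
  \<open>a \<otimes> m \<mapsto> a\<^sup>1 \<otimes> S(a\<^sup>2)m\<close>. Let \<open>(M, \<tau>)\<close> be a Hopf module and \<open>V = A\<^sub>L \<otimes> \<^sub>LM\<close> with the diagonal action.
  If \<open>\<beta>\<^sub>M z = \<tau> m\<close>, then by coassociativity \<open>\<beta>\<^sub>V\<close> takes the same value on \<open>(A \<otimes> \<tau>)z\<close> and on the image of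
  \<open>z\<close> under \<open>A \<otimes> (1 \<otimes> -)\<close>; so \<open>z\<close> lies in the kernel of \<open>A \<otimes> (\<tau> - 1 \<otimes> -)\<close>, which by assumption is
  \<open>\<^sup>LA \<otimes> Coinv(M)\<^sub>L\<close>. There \<open>\<beta>\<^sub>M\<close> is the composite of the counit \<open>a \<otimes> m \<mapsto> am\<close> with the injective map
  \<open>\<tau>\<close>, so the counit is bijective. The unit \<open>n \<mapsto> 1 \<otimes> n\<close> has the retraction \<open>a \<otimes> n \<mapsto> n \<cdot> \<pi>\<^sub>L(S a)\<close>;
  applying this retraction to \<open>\<beta>\<^sup>-\<^sup>1(\<tau> z) = 1 \<otimes> z\<close> for a coinvariant \<open>z\<close> of \<open>\<^sup>LA \<otimes> N\<^sub>L\<close> writes \<open>z\<close> as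
  \<open>1 \<otimes> n\<close>. If \<open>\<^sup>LA\<close> is flat, the assumption on kernels follows from the right exactness of
  \<open>\<^sup>LA \<otimes> -\<close>.\<close>

section \<open>Abelian groups given by generators and relators\<close>

text \<open>The Galois map is needed for arbitrary left \<open>A\<close>-modules, since the argument
  for the counit also uses its injectivity on \<open>A\<^sub>L \<otimes> \<^sub>LM\<close> with the
  diagonal action. The obstacle to writing down its inverse is that the two coproducts are balanced
  over different rings. Axiom (i) overcomes it: \<open>sL\<close> and \<open>tR\<close> have the
  same range, and so have \<open>tL\<close> and \<open>sR\<close>, so that linearity over
  \<open>R\<close> can be traded for linearity over \<open>L\<close>. The kernel assumption enters
  for the counit only. The unit is split because \<open>S\<close> turns right multiplication by
  \<open>tL\<close> into left multiplication by \<open>sL\<close>; naturality of the splitting,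
  applied to the unit itself, replaces the kernel argument. A second obstacle is formal:
  \<open>pres_lift\<close> has no specified value on a map that violates the relators, so each
  Sweedler expression must be shown balanced before it is evaluated. To keep this bounded, the
  recurring expressions become named additive maps, equations between them are tested on pure
  tensors, and iterated tensor products replace triple ones wherever no axiom forces the
  latter.\<close>

lemma abelian_group_iff: "abelian_group G \<longleftrightarrow> comm_group (add_monoid G)"
  by (auto simp: abelian_group_def abelian_monoid_def abelian_group_axioms_def comm_group_def)

lemma abelian_group_cong:
  "\<lbrakk>carrier G = carrier H; add G = add H; \<zero>\<^bsub>G\<^esub> = \<zero>\<^bsub>H\<^esub>\<rbrakk> \<Longrightarrow> abelian_group G = abelian_group H"
  unfolding abelian_group_iff comm_group_def comm_monoid_def group_def monoid_def
    comm_monoid_axioms_def group_axioms_def Units_def by simp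

lemma additive_on_closed: "\<lbrakk>additive_on M N f; x \<in> carrier M\<rbrakk> \<Longrightarrow> f x \<in> carrier N"
  by (auto simp: additive_on_def)

lemma additive_on_add:
  "\<lbrakk>additive_on M N f; x \<in> carrier M; y \<in> carrier M\<rbrakk> \<Longrightarrow> f (x \<oplus>\<^bsub>M\<^esub> y) = f x \<oplus>\<^bsub>N\<^esub> f y"
  by (auto simp: additive_on_def)

lemma additive_onI:
  "\<lbrakk>\<And>x. x \<in> carrier M \<Longrightarrow> f x \<in> carrier N;
    \<And>x y. \<lbrakk>x \<in> carrier M; y \<in> carrier M\<rbrakk> \<Longrightarrow> f (x \<oplus>\<^bsub>M\<^esub> y) = f x \<oplus>\<^bsub>N\<^esub> f y\<rbrakk> \<Longrightarrow> additive_on M N f"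
  by (auto simp: additive_on_def)

lemma additive_on_comp:
  "\<lbrakk>additive_on M N f; additive_on N P g\<rbrakk> \<Longrightarrow> additive_on M P (\<lambda>x. g (f x))"
  by (auto simp: additive_on_def Pi_iff)

lemma additive_on_hom:
  "\<lbrakk>additive_on M N f; abelian_group M; abelian_group N\<rbrakk> \<Longrightarrow> group_hom (add_monoid M) (add_monoid N) f"
  by (auto simp: additive_on_def group_hom_def group_hom_axioms_def hom_def abelian_group_iff comm_group_def)

lemma additive_on_zero:
  "\<lbrakk>additive_on M N f; abelian_group M; abelian_group N\<rbrakk> \<Longrightarrow> f \<zero>\<^bsub>M\<^esub> = \<zero>\<^bsub>N\<^esub>"
  using group_hom.hom_one[OF additive_on_hom] by fastforce

lemma additive_on_uminus:
  "\<lbrakk>additive_on M N f; abelian_group M; abelian_group N; x \<in> carrier M\<rbrakk> \<Longrightarrow> f (\<ominus>\<^bsub>M\<^esub> x) = \<ominus>\<^bsub>N\<^esub> f x"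
  using group_hom.hom_inv[OF additive_on_hom] by (fastforce simp: a_inv_def)

lemma additive_on_minus:
  "\<lbrakk>additive_on M N f; abelian_group M; abelian_group N; x \<in> carrier M; y \<in> carrier M\<rbrakk>
    \<Longrightarrow> f (x \<ominus>\<^bsub>M\<^esub> y) = f x \<ominus>\<^bsub>N\<^esub> f y"
  by (simp add: a_minus_def additive_on_add additive_on_uminus abelian_group.a_inv_closed)

text \<open>Ties the explicit sum in the definition of \<open>pres_lift\<close> to the universal
  property of the free abelian group, so that independence of the representative can be read off
  from a homomorphism.\<close>

lemma hom_free_Abelian_group_eq_finsum:
  assumes G: "abelian_group G" and h: "h \<in> hom (free_Abelian_group X) (add_monoid G)"
    and hf: "\<And>x. x \<in> X \<Longrightarrow> h (frag_of x) = f x" and c: "Poly_Mapping.keys c \<subseteq> X"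
  shows "h c = (\<Oplus>\<^bsub>G\<^esub>x \<in> Poly_Mapping.keys c. [Poly_Mapping.lookup c x] \<cdot>\<^bsub>G\<^esub> f x)"
proof -
  interpret G: abelian_group G by (rule G)
  interpret h: group_hom "free_Abelian_group X" "add_monoid G" h
    using h by (simp add: group_hom_def group_hom_axioms_def G.a_group)
  have fX: "f x \<in> carrier G" if "x \<in> X" for x
    using h.hom_closed[of "frag_of x"] hf that by simp
  have pow: "h (frag_cmul k (frag_of x)) = [k] \<cdot>\<^bsub>G\<^esub> f x" if "x \<in> X" for x k
    using h.hom_int_pow[of "frag_of x" k] that by (simp add: hf add_pow_def)
  \<comment> \<open>The coefficients \<open>k\<close> stay arbitrary for the induction on the
    support. The claim on keys is carried along because \<open>h\<close> is additive only on the
    carrier of the free group.\<close>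
  have "h (\<Sum>x\<in>I. frag_cmul (k x) (frag_of x)) = (\<Oplus>\<^bsub>G\<^esub>x\<in>I. [k x] \<cdot>\<^bsub>G\<^esub> f x)
      \<and> Poly_Mapping.keys (\<Sum>x\<in>I. frag_cmul (k x) (frag_of x)) \<subseteq> X"
    if "finite I" "I \<subseteq> X" for I k
    using that
  proof (induction I rule: finite_induct)
    case empty
    then show ?case using h.hom_one by simp
  next
    case (insert x I)
    have kx: "Poly_Mapping.keys (frag_cmul (k x) (frag_of x)) \<subseteq> X"
      using keys_cmul[of "k x" "frag_of x"] insert.prems by auto
    have ks: "Poly_Mapping.keys (\<Sum>x\<in>I. frag_cmul (k x) (frag_of x)) \<subseteq> X"
      using insert by simp
    have "h (\<Sum>x\<in>insert x I. frag_cmul (k x) (frag_of x))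
        = h (frag_cmul (k x) (frag_of x)) \<oplus>\<^bsub>G\<^esub> h (\<Sum>x\<in>I. frag_cmul (k x) (frag_of x))"
      using h.hom_mult[of "frag_cmul (k x) (frag_of x)" "\<Sum>x\<in>I. frag_cmul (k x) (frag_of x)"] insert kx ks
      by simp
    also have "\<dots> = (\<Oplus>\<^bsub>G\<^esub>x\<in>insert x I. [k x] \<cdot>\<^bsub>G\<^esub> f x)"
      using insert by (simp add: pow fX subset_iff G.finsum_insert Pi_iff)
    finally show ?case
      using insert kx ks keys_add[of "frag_cmul (k x) (frag_of x)" "\<Sum>x\<in>I. frag_cmul (k x) (frag_of x)"]
      by auto
  qed
  from this[of "Poly_Mapping.keys c" "Poly_Mapping.lookup c"] show ?thesis
    using c frag_expansion[of c] by (simp add: frag_extend_def)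
qed

locale presentation =
  fixes X :: "'x set" and Rl :: "('x \<Rightarrow>\<^sub>0 int) set"
  assumes relators: "r \<in> Rl \<Longrightarrow> Poly_Mapping.keys r \<subseteq> X"
begin

abbreviation "F \<equiv> free_Abelian_group X"
abbreviation "N \<equiv> generate F Rl"

lemma normal_relators: "N \<lhd> F"
  by (rule comm_group.subgroup_imp_normal)
    (auto intro!: abelian_free_Abelian_group group.generate_is_subgroup simp: relators)

sublocale N: normal N F by (rule normal_relators)

lemma add_monoid_pres: "add_monoid (pres_group X Rl) = pres_quotient X Rl"
  by (simp add: pres_group_def)

lemma abelian_pres: "abelian_group (pres_group X Rl)"
  unfolding abelian_group_iff add_monoid_pres pres_quotient_def
  by (rule comm_group.abelian_FactGroup) (auto simp: abelian_free_Abelian_group N.subgroup_axioms)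

lemma carrier_pres: "carrier (pres_group X Rl) = (\<lambda>c. N #>\<^bsub>F\<^esub> c) ` {c. Poly_Mapping.keys c \<subseteq> X}"
  by (auto simp: pres_group_def pres_quotient_def FactGroup_def RCOSETS_def)

lemma add_pres:
  "\<lbrakk>Poly_Mapping.keys c \<subseteq> X; Poly_Mapping.keys c' \<subseteq> X\<rbrakk> \<Longrightarrow>
    (N #>\<^bsub>F\<^esub> c) \<oplus>\<^bsub>pres_group X Rl\<^esub> (N #>\<^bsub>F\<^esub> c') = N #>\<^bsub>F\<^esub> (c + c')"
  using N.rcos_sum[of c c'] by (simp add: pres_group_def pres_quotient_def FactGroup_def)

lemma zero_pres: "\<zero>\<^bsub>pres_group X Rl\<^esub> = N #>\<^bsub>F\<^esub> 0"
  using N.coset_mult_one by (simp add: pres_group_def pres_quotient_def FactGroup_def N.subset)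

lemma pres_gen_closed: "x \<in> X \<Longrightarrow> pres_gen X Rl x \<in> carrier (pres_group X Rl)"
  by (auto simp: carrier_pres pres_gen_def)

lemma uminus_pres:
  "Poly_Mapping.keys c \<subseteq> X \<Longrightarrow> \<ominus>\<^bsub>pres_group X Rl\<^esub> (N #>\<^bsub>F\<^esub> c) = N #>\<^bsub>F\<^esub> (- c)"
  by (rule abelian_group.minus_equality[OF abelian_pres, symmetric, THEN sym])
    (auto simp: add_pres carrier_pres zero_pres)

lemma pres_induct [consumes 1, case_names zero gen diff]:
  assumes "z \<in> carrier (pres_group X Rl)"
    and zero: "P \<zero>\<^bsub>pres_group X Rl\<^esub>"
    and gen: "\<And>x. x \<in> X \<Longrightarrow> P (pres_gen X Rl x)"
    and diff: "\<And>y z. \<lbrakk>y \<in> carrier (pres_group X Rl); z \<in> carrier (pres_group X Rl); P y; P z\<rbrakk>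
                \<Longrightarrow> P (y \<ominus>\<^bsub>pres_group X Rl\<^esub> z)"
  shows "P z"
proof -
  obtain c where c: "Poly_Mapping.keys c \<subseteq> X" "z = N #>\<^bsub>F\<^esub> c"
    using assms(1) by (auto simp: carrier_pres)
  have "P (N #>\<^bsub>F\<^esub> c)"
  proof (rule free_Abelian_group_induct[OF c(1)])
    show "P (N #>\<^bsub>F\<^esub> 0)" using zero by (simp add: zero_pres)
  next
    fix x y
    assume 2: "Poly_Mapping.keys x \<subseteq> X" "Poly_Mapping.keys y \<subseteq> X" "P (N #>\<^bsub>F\<^esub> x)" "P (N #>\<^bsub>F\<^esub> y)"
    have "N #>\<^bsub>F\<^esub> (x - y) = (N #>\<^bsub>F\<^esub> x) \<ominus>\<^bsub>pres_group X Rl\<^esub> (N #>\<^bsub>F\<^esub> y)"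
      using 2 by (simp add: a_minus_def uminus_pres add_pres)
    then show "P (N #>\<^bsub>F\<^esub> (x - y))" using 2 diff by (auto simp: carrier_pres)
  next
    fix a assume "a \<in> X"
    then show "P (N #>\<^bsub>F\<^esub> frag_of a)" using gen by (simp add: pres_gen_def)
  qed
  then show ?thesis using c by simp
qed

text \<open>Exactly one homomorphism on the free group extends \<open>f\<close>, so
  \<open>kill\<close> says that this extension annihilates the relators; quantifying over
  \<open>h\<close> spares a name for it. The extension is then constant on cosets, which makes the
  image in the definition of \<open>pres_lift\<close> a singleton.\<close>

lemma pres_lift_hom:
  assumes G: "abelian_group G" and f: "f \<in> X \<rightarrow> carrier G"
    and kill: "\<And>h r. \<lbrakk>h \<in> hom F (add_monoid G); \<And>x. x \<in> X \<Longrightarrow> h (frag_of x) = f x; r \<in> Rl\<rbrakk> \<Longrightarrow> h r = \<zero>\<^bsub>G\<^esub>"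
  shows "additive_on (pres_group X Rl) G (pres_lift G f)"
    and "x \<in> X \<Longrightarrow> pres_lift G f (pres_gen X Rl x) = f x"
proof -
  interpret G: abelian_group G by (rule G)
  obtain h where h: "h \<in> hom F (add_monoid G)" "\<And>x. x \<in> X \<Longrightarrow> h (frag_of x) = f x"
    using comm_group.free_Abelian_group_universal[OF G.a_comm_group, of f X] f by (auto simp: image_subset_iff_funcset)
  interpret h: group_hom F "add_monoid G" h
    using h by (simp add: group_hom_def group_hom_axioms_def G.a_group)
  have N0: "h n = \<zero>\<^bsub>G\<^esub>" if "n \<in> N" for n
  proof -
    have "N \<subseteq> kernel F (add_monoid G) h"
      by (rule group.generate_subgroup_incl[OF group_free_Abelian_group _ h.subgroup_kernel])
        (auto simp: kernel_def h kill dest: relators)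
    then show ?thesis using that by (auto simp: kernel_def)
  qed
  have val: "pres_lift G f (N #>\<^bsub>F\<^esub> c) = h c" if c: "Poly_Mapping.keys c \<subseteq> X" for c
  proof -
    have *: "(\<Oplus>\<^bsub>G\<^esub>x \<in> Poly_Mapping.keys c'. [Poly_Mapping.lookup c' x] \<cdot>\<^bsub>G\<^esub> f x) = h c"
      if c': "c' \<in> N #>\<^bsub>F\<^esub> c" for c'
    proof -
      obtain n where n: "n \<in> N" "c' = n + c" using c' by (auto simp: r_coset_def)
      have nX: "n \<in> carrier F" using n(1) N.subset by blast
      have "Poly_Mapping.keys c' \<subseteq> X"
        using n nX c keys_add[of n c] by auto
      moreover have "h c' = h c"
        using h.hom_mult[of n c] n c nX N0 h.hom_closed[of c] by simp
      ultimately show ?thesis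
        using hom_free_Abelian_group_eq_finsum[OF G h] by simp
    qed
    have "c \<in> N #>\<^bsub>F\<^esub> c"
      using c by (intro N.rcos_self N.subgroup_axioms) simp
    then have "(\<lambda>c. \<Oplus>\<^bsub>G\<^esub>x \<in> Poly_Mapping.keys c. [Poly_Mapping.lookup c x] \<cdot>\<^bsub>G\<^esub> f x) ` (N #>\<^bsub>F\<^esub> c) = {h c}"
      using * by (auto simp: image_iff intro!: bexI[of _ c])
    then show ?thesis by (simp add: pres_lift_def)
  qed
  show "additive_on (pres_group X Rl) G (pres_lift G f)"
  proof (rule additive_onI)
    fix y z assume "y \<in> carrier (pres_group X Rl)" "z \<in> carrier (pres_group X Rl)"
    then obtain c d where "Poly_Mapping.keys c \<subseteq> X" "y = N #>\<^bsub>F\<^esub> c" "Poly_Mapping.keys d \<subseteq> X" "z = N #>\<^bsub>F\<^esub> d"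
      by (auto simp: carrier_pres)
    moreover from this have "Poly_Mapping.keys (c + d) \<subseteq> X" using keys_add[of c d] by auto
    ultimately show "pres_lift G f (y \<oplus>\<^bsub>pres_group X Rl\<^esub> z) = pres_lift G f y \<oplus>\<^bsub>G\<^esub> pres_lift G f z"
      using h.hom_mult[of c d] by (simp add: add_pres val)
  next
    fix y assume "y \<in> carrier (pres_group X Rl)"
    then show "pres_lift G f y \<in> carrier G"
      using h.hom_closed by (auto simp: carrier_pres val)
  qed
  show "pres_lift G f (pres_gen X Rl x) = f x" if "x \<in> X"
    using that by (simp add: pres_gen_def val h)
qed

lemma relator_zero:
  assumes "r \<in> Rl" shows "N #>\<^bsub>F\<^esub> r = \<zero>\<^bsub>pres_group X Rl\<^esub>"
proof -
  have "r \<in> N" using assms by (rule generate.incl)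
  then show ?thesis
    using N.rcos_const[of r] by (simp add: pres_group_def pres_quotient_def FactGroup_def)
qed

text \<open>The sums agree for every element of the coset \<open>z\<close>, so
  \<open>the_elem\<close> is applied to the same set twice. Rewriting under \<open>pres_lift\<close>
  is thus possible before balancedness is known.\<close>

lemma pres_lift_cong:
  assumes "\<And>x. x \<in> X \<Longrightarrow> f x = g x" "z \<in> carrier (pres_group X Rl)" "abelian_group G" "g \<in> X \<rightarrow> carrier G"
  shows "pres_lift G f z = pres_lift G g z"
proof -
  obtain c where c: "Poly_Mapping.keys c \<subseteq> X" "z = N #>\<^bsub>F\<^esub> c"
    using assms(2) by (auto simp: carrier_pres)
  have "Poly_Mapping.keys d \<subseteq> X" if "d \<in> z" for d
    using that N.r_coset_subset_G[OF N.subset, of c] c(1) unfolding c(2)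
    by (metis carrier_free_Abelian_group_iff subsetD)
  then have "(\<Oplus>\<^bsub>G\<^esub>x \<in> Poly_Mapping.keys d. [Poly_Mapping.lookup d x] \<cdot>\<^bsub>G\<^esub> f x)
    = (\<Oplus>\<^bsub>G\<^esub>x \<in> Poly_Mapping.keys d. [Poly_Mapping.lookup d x] \<cdot>\<^bsub>G\<^esub> g x)" if "d \<in> z" for d
    using that assms group.int_pow_closed[OF abelian_group.a_group[OF assms(3)]]
    by (intro abelian_monoid.finsum_cong'[OF abelian_group.axioms(1)[OF assms(3)]])
      (auto simp: Pi_iff subset_iff add_pow_def)
  then show ?thesis by (auto simp: pres_lift_def intro!: arg_cong[where f = the_elem] image_cong)
qed

lemma pres_gen_add:
  assumes "frag_of x - frag_of y - frag_of w \<in> Rl" "x \<in> X" "y \<in> X" "w \<in> X"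
  shows "pres_gen X Rl x = pres_gen X Rl y \<oplus>\<^bsub>pres_group X Rl\<^esub> pres_gen X Rl w"
proof -
  interpret G: abelian_group "pres_group X Rl" by (rule abelian_pres)
  let ?r = "frag_of x - frag_of y - frag_of w"
  have yw: "Poly_Mapping.keys (frag_of y + frag_of w) \<subseteq> X"
    using keys_add[of "frag_of y" "frag_of w"] assms by auto
  have "N #>\<^bsub>F\<^esub> (?r + (frag_of y + frag_of w)) = N #>\<^bsub>F\<^esub> (frag_of y + frag_of w)"
    using add_pres[of ?r "frag_of y + frag_of w"] relator_zero[OF assms(1)] relators[OF assms(1)] yw
    by (auto simp: carrier_pres)
  then show ?thesis
    using assms by (simp add: pres_gen_def add_pres)
qed

lemma pres_gen_eq:
  assumes "frag_of x - frag_of y \<in> Rl" "x \<in> X" "y \<in> X"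
  shows "pres_gen X Rl x = pres_gen X Rl y"
proof -
  interpret G: abelian_group "pres_group X Rl" by (rule abelian_pres)
  let ?r = "frag_of x - frag_of y"
  have "N #>\<^bsub>F\<^esub> (?r + frag_of y) = N #>\<^bsub>F\<^esub> frag_of y"
    using add_pres[of ?r "frag_of y"] relator_zero[OF assms(1)] relators[OF assms(1)] assms
    by (auto simp: carrier_pres)
  then show ?thesis by (simp add: pres_gen_def)
qed

text \<open>The relators of both kinds of tensor product have one of these two shapes, which reduces
  \<open>kill\<close> in \<open>pres_lift_hom\<close> to identities for \<open>f\<close> on
  generators.\<close>

lemma pres_lift_relators:
  assumes G: "abelian_group G" and f: "f \<in> X \<rightarrow> carrier G"
    and rel: "\<And>r. r \<in> Rl \<Longrightarrow>
      (\<exists>x\<in>X. \<exists>y\<in>X. \<exists>w\<in>X. r = frag_of x - frag_of y - frag_of w \<and> f x = f y \<oplus>\<^bsub>G\<^esub> f w) \<or>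
      (\<exists>x\<in>X. \<exists>y\<in>X. r = frag_of x - frag_of y \<and> f x = f y)"
  shows "additive_on (pres_group X Rl) G (pres_lift G f)"
    and "x \<in> X \<Longrightarrow> pres_lift G f (pres_gen X Rl x) = f x"
proof -
  interpret G: abelian_group G by (rule G)
  have kill: "h r = \<zero>\<^bsub>G\<^esub>"
    if h: "h \<in> hom F (add_monoid G)" and hf: "\<And>x. x \<in> X \<Longrightarrow> h (frag_of x) = f x" and r: "r \<in> Rl" for h r
  proof -
    interpret h: group_hom F "add_monoid G" h
      using h by (simp add: group_hom_def group_hom_axioms_def G.a_group)
    have hadd: "h (a + b) = h a \<oplus>\<^bsub>G\<^esub> h b"
      if "Poly_Mapping.keys a \<subseteq> X" "Poly_Mapping.keys b \<subseteq> X" for a b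
      using h.hom_mult[of a b] that by simp
    have hr: "h r \<in> carrier G" using h.hom_closed[of r] relators[OF r] by simp
    from rel[OF r] show ?thesis
    proof
      assume "\<exists>x\<in>X. \<exists>y\<in>X. \<exists>w\<in>X. r = frag_of x - frag_of y - frag_of w \<and> f x = f y \<oplus>\<^bsub>G\<^esub> f w"
      then obtain x y w where *: "x \<in> X" "y \<in> X" "w \<in> X" "r = frag_of x - frag_of y - frag_of w"
        "f x = f y \<oplus>\<^bsub>G\<^esub> f w" by auto
      have "Poly_Mapping.keys (frag_of y + frag_of w) \<subseteq> X"
        using keys_add[of "frag_of y" "frag_of w"] * by auto
      \<comment> \<open>Adding the subtracted generators back to \<open>r\<close> leaves only sums
        to evaluate under \<open>h\<close>; cancellation in \<open>G\<close> then gives the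
        claim.\<close>
      then have "h (r + (frag_of y + frag_of w)) = h r \<oplus>\<^bsub>G\<^esub> (f y \<oplus>\<^bsub>G\<^esub> f w)"
        using *(1-3) relators[OF r] by (simp add: hadd hf)
      moreover have "h (r + (frag_of y + frag_of w)) = f x"
        using * by (simp add: hf)
      ultimately show ?thesis
        using * f hr by (metis G.add.l_cancel_one G.add.m_comm G.add.m_closed Pi_mem)
    next
      assume "\<exists>x\<in>X. \<exists>y\<in>X. r = frag_of x - frag_of y \<and> f x = f y"
      then obtain x y where *: "x \<in> X" "y \<in> X" "r = frag_of x - frag_of y" "f x = f y" by auto
      have "h (r + frag_of y) = h r \<oplus>\<^bsub>G\<^esub> f y"
        using *(1-2) relators[OF r] by (simp add: hadd hf)
      moreover have "h (r + frag_of y) = f x"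
        using * by (simp add: hf)
      ultimately show ?thesis
        using * f hr by (metis G.add.l_cancel_one G.add.m_comm Pi_mem)
    qed
  qed
  show "additive_on (pres_group X Rl) G (pres_lift G f)"
    by (rule pres_lift_hom(1)[OF G f]) (rule kill, auto)
  show "pres_lift G f (pres_gen X Rl x) = f x" if "x \<in> X"
    by (rule pres_lift_hom(2)[OF G f _ that]) (rule kill, auto)
qed

end

section \<open>Tensor products\<close>

text \<open>The part of a module structure that the tensor relators refer to. It does not mention
  sides, so it covers left and right modules alike, as \<open>tensor\<close> does.\<close>

definition act_group :: "('b, 'e) ring_scheme \<Rightarrow> ('b, 'p) module \<Rightarrow> bool" where
  "act_group B P \<longleftrightarrow> abelian_group P \<and> (\<forall>b\<in>carrier B. \<forall>p\<in>carrier P. b \<odot>\<^bsub>P\<^esub> p \<in> carrier P)"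

definition biadditive :: "('p, 'e) ring_scheme \<Rightarrow> ('q, 'f) ring_scheme \<Rightarrow> ('g, 'h) ring_scheme
    \<Rightarrow> ('p \<Rightarrow> 'q \<Rightarrow> 'g) \<Rightarrow> bool" where
  "biadditive P Q G f \<longleftrightarrow> (\<forall>p\<in>carrier P. additive_on Q G (f p)) \<and>
     (\<forall>q\<in>carrier Q. additive_on P G (\<lambda>p. f p q))"

definition balanced :: "('b, 'e) ring_scheme \<Rightarrow> ('b, 'p) module \<Rightarrow> ('b, 'q) module
    \<Rightarrow> ('g, 'h) ring_scheme \<Rightarrow> ('p \<Rightarrow> 'q \<Rightarrow> 'g) \<Rightarrow> bool" where
  "balanced B P Q G f \<longleftrightarrow> biadditive P Q G f \<and>
     (\<forall>b\<in>carrier B. \<forall>p\<in>carrier P. \<forall>q\<in>carrier Q. f (b \<odot>\<^bsub>P\<^esub> p) q = f p (b \<odot>\<^bsub>Q\<^esub> q))"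

lemma balancedI:
  assumes "\<And>p. p \<in> carrier P \<Longrightarrow> additive_on Q G (f p)"
    and "\<And>q. q \<in> carrier Q \<Longrightarrow> additive_on P G (\<lambda>p. f p q)"
    and "\<And>b p q. \<lbrakk>b \<in> carrier B; p \<in> carrier P; q \<in> carrier Q\<rbrakk> \<Longrightarrow> f (b \<odot>\<^bsub>P\<^esub> p) q = f p (b \<odot>\<^bsub>Q\<^esub> q)"
  shows "balanced B P Q G f"
  using assms by (auto simp: balanced_def biadditive_def)

lemma balanced_right: "\<lbrakk>balanced B P Q G f; p \<in> carrier P\<rbrakk> \<Longrightarrow> additive_on Q G (f p)"
  and balanced_left: "\<lbrakk>balanced B P Q G f; q \<in> carrier Q\<rbrakk> \<Longrightarrow> additive_on P G (\<lambda>p. f p q)"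
  and balanced_mid: "\<lbrakk>balanced B P Q G f; b \<in> carrier B; p \<in> carrier P; q \<in> carrier Q\<rbrakk>
    \<Longrightarrow> f (b \<odot>\<^bsub>P\<^esub> p) q = f p (b \<odot>\<^bsub>Q\<^esub> q)"
  by (auto simp: balanced_def biadditive_def)

lemma balanced_comp:
  assumes f: "balanced B P Q G f" and h: "additive_on G H h"
  shows "balanced B P Q H (\<lambda>p q. h (f p q))"
proof (rule balancedI)
  show "additive_on Q H (\<lambda>q. h (f p q))" if "p \<in> carrier P" for p
    using additive_on_comp[OF balanced_right[OF f that] h] .
  show "additive_on P H (\<lambda>p. h (f p q))" if "q \<in> carrier Q" for q
    using additive_on_comp[OF balanced_left[OF f that] h] .
qed (simp add: balanced_mid[OF f])

definition balanced3 :: "('b, 'e) ring_scheme \<Rightarrow> ('c, 'f) ring_scheme \<Rightarrow> ('b, 'p) module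
    \<Rightarrow> ('b, 'q) module \<Rightarrow> ('c, 'q) module \<Rightarrow> ('c, 'u) module \<Rightarrow> ('g, 'h) ring_scheme
    \<Rightarrow> ('p \<Rightarrow> 'q \<Rightarrow> 'u \<Rightarrow> 'g) \<Rightarrow> bool" where
  "balanced3 B C P Q Q' U G f \<longleftrightarrow>
     (\<forall>p\<in>carrier P. \<forall>q\<in>carrier Q. additive_on U G (f p q)) \<and>
     (\<forall>p\<in>carrier P. \<forall>u\<in>carrier U. additive_on Q G (\<lambda>q. f p q u)) \<and>
     (\<forall>q\<in>carrier Q. \<forall>u\<in>carrier U. additive_on P G (\<lambda>p. f p q u)) \<and>
     (\<forall>b\<in>carrier B. \<forall>p\<in>carrier P. \<forall>q\<in>carrier Q. \<forall>u\<in>carrier U.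
        f (b \<odot>\<^bsub>P\<^esub> p) q u = f p (b \<odot>\<^bsub>Q\<^esub> q) u) \<and>
     (\<forall>c\<in>carrier C. \<forall>p\<in>carrier P. \<forall>q\<in>carrier Q. \<forall>u\<in>carrier U.
        f p (c \<odot>\<^bsub>Q'\<^esub> q) u = f p q (c \<odot>\<^bsub>U\<^esub> u))"

lemma additive_ext_of_gen:
  assumes pr: "presentation X Rl"
    and "additive_on (pres_group X Rl) G g" "additive_on (pres_group X Rl) G h" "abelian_group G"
    and "\<And>x. x \<in> X \<Longrightarrow> g (pres_gen X Rl x) = h (pres_gen X Rl x)" "z \<in> carrier (pres_group X Rl)"
  shows "g z = h z"
proof -
  interpret presentation X Rl by (rule pr)
  show ?thesis
    using assms(6)
  proof (induction z rule: pres_induct)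
    case zero
    then show ?case using assms abelian_pres by (simp add: additive_on_zero[of "pres_group X Rl" G])
  next
    case (diff y z)
    then show ?case using assms abelian_pres by (simp add: additive_on_minus[of "pres_group X Rl" G])
  qed (simp add: assms)
qed

lemma tensor_rels_left:
  "\<lbrakk>p \<in> carrier P; p' \<in> carrier P; q \<in> carrier Q\<rbrakk> \<Longrightarrow>
    frag_of (p \<oplus>\<^bsub>P\<^esub> p', q) - frag_of (p, q) - frag_of (p', q) \<in> tensor_rels B P Q"
  and tensor_rels_right:
  "\<lbrakk>p \<in> carrier P; q \<in> carrier Q; q' \<in> carrier Q\<rbrakk> \<Longrightarrow>
    frag_of (p, q \<oplus>\<^bsub>Q\<^esub> q') - frag_of (p, q) - frag_of (p, q') \<in> tensor_rels B P Q"
  and tensor_rels_mid: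
  "\<lbrakk>b \<in> carrier B; p \<in> carrier P; q \<in> carrier Q\<rbrakk> \<Longrightarrow>
    frag_of (b \<odot>\<^bsub>P\<^esub> p, q) - frag_of (p, b \<odot>\<^bsub>Q\<^esub> q) \<in> tensor_rels B P Q"
  unfolding tensor_rels_def by blast+

lemma tensor3_rels_mem:
  "\<lbrakk>p \<in> carrier P; p' \<in> carrier P; q \<in> carrier Q; u \<in> carrier U\<rbrakk> \<Longrightarrow>
    frag_of (p \<oplus>\<^bsub>P\<^esub> p', q, u) - frag_of (p, q, u) - frag_of (p', q, u) \<in> tensor3_rels B C P Q Q' U"
  "\<lbrakk>p \<in> carrier P; q \<in> carrier Q; q' \<in> carrier Q; u \<in> carrier U\<rbrakk> \<Longrightarrow>
    frag_of (p, q \<oplus>\<^bsub>Q\<^esub> q', u) - frag_of (p, q, u) - frag_of (p, q', u) \<in> tensor3_rels B C P Q Q' U"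
  "\<lbrakk>p \<in> carrier P; q \<in> carrier Q; u \<in> carrier U; u' \<in> carrier U\<rbrakk> \<Longrightarrow>
    frag_of (p, q, u \<oplus>\<^bsub>U\<^esub> u') - frag_of (p, q, u) - frag_of (p, q, u') \<in> tensor3_rels B C P Q Q' U"
  "\<lbrakk>b \<in> carrier B; p \<in> carrier P; q \<in> carrier Q; u \<in> carrier U\<rbrakk> \<Longrightarrow>
    frag_of (b \<odot>\<^bsub>P\<^esub> p, q, u) - frag_of (p, b \<odot>\<^bsub>Q\<^esub> q, u) \<in> tensor3_rels B C P Q Q' U"
  "\<lbrakk>c \<in> carrier C; p \<in> carrier P; q \<in> carrier Q; u \<in> carrier U\<rbrakk> \<Longrightarrow>
    frag_of (p, c \<odot>\<^bsub>Q'\<^esub> q, u) - frag_of (p, q, c \<odot>\<^bsub>U\<^esub> u) \<in> tensor3_rels B C P Q Q' U"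
  unfolding tensor3_rels_def by blast+

locale tensor_product =
  fixes B :: "('b, 'e) ring_scheme" and P :: "('b, 'p) module" and Q :: "('b, 'q) module"
  assumes P: "act_group B P" and Q: "act_group B Q"
begin

interpretation P: abelian_group P using P by (simp add: act_group_def)
interpretation Q: abelian_group Q using Q by (simp add: act_group_def)

lemma presentation: "presentation (carrier P \<times> carrier Q) (tensor_rels B P Q)"
proof
  fix r assume r: "r \<in> tensor_rels B P Q"
  have keys3: "Poly_Mapping.keys (frag_of x - frag_of y - frag_of w) \<subseteq> {x, y, w}" for x y w :: "'p \<times> 'q"
    using keys_diff[of "frag_of x - frag_of y" "frag_of w"] keys_diff[of "frag_of x" "frag_of y"] by auto
  have keys2: "Poly_Mapping.keys (frag_of x - frag_of y) \<subseteq> {x, y}" for x y :: "'p \<times> 'q"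
    using keys_diff[of "frag_of x" "frag_of y"] by auto
  from r show "Poly_Mapping.keys r \<subseteq> carrier P \<times> carrier Q"
    unfolding tensor_rels_def using P Q
    by (elim UnE CollectE exE conjE)
      (auto simp: act_group_def intro: order_trans[OF keys3] order_trans[OF keys2] dest!: subsetD[OF keys3] subsetD[OF keys2])
qed

interpretation presentation "carrier P \<times> carrier Q" "tensor_rels B P Q" by (rule presentation)

abbreviation "TPQ \<equiv> tensor B P Q"
abbreviation "tpq \<equiv> tens B P Q"

lemma abelian: "abelian_group TPQ"
  by (simp add: tensor_def abelian_pres)

sublocale T: abelian_group "TPQ" by (rule abelian)

lemma tens_closed: "\<lbrakk>p \<in> carrier P; q \<in> carrier Q\<rbrakk> \<Longrightarrow> tpq p q \<in> carrier TPQ"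
  by (simp add: tensor_def tens_def pres_gen_closed)

lemma tens_balanced: "balanced B P Q TPQ tpq"
proof (rule balancedI)
  fix p assume "p \<in> carrier P"
  then show "additive_on Q TPQ (tpq p)"
    unfolding tens_def tensor_def
    by (intro additive_onI pres_gen_add pres_gen_closed) (auto intro: tensor_rels_left tensor_rels_right)
next
  fix q assume "q \<in> carrier Q"
  then show "additive_on P TPQ (\<lambda>p. tpq p q)"
    unfolding tens_def tensor_def
    by (intro additive_onI pres_gen_add pres_gen_closed) (auto intro: tensor_rels_left tensor_rels_right)
next
  fix b p q assume "b \<in> carrier B" "p \<in> carrier P" "q \<in> carrier Q"
  then show "tpq (b \<odot>\<^bsub>P\<^esub> p) q = tpq p (b \<odot>\<^bsub>Q\<^esub> q)"
    unfolding tens_def using P Q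
    by (intro pres_gen_eq) (auto simp: act_group_def intro: tensor_rels_mid)
qed

lemma ext:
  assumes "additive_on TPQ G g" "additive_on TPQ G h" "abelian_group G"
    and "\<And>p q. \<lbrakk>p \<in> carrier P; q \<in> carrier Q\<rbrakk> \<Longrightarrow> g (tpq p q) = h (tpq p q)"
    and "z \<in> carrier TPQ"
  shows "g z = h z"
  using assms additive_ext_of_gen[OF presentation, of G g h z]
  by (auto simp: tensor_def tens_def)

lemma lift_additive:
  assumes "balanced B P Q G f" "abelian_group G"
  shows "additive_on TPQ G (pres_lift G (\<lambda>(p, q). f p q))"
    and "\<lbrakk>p \<in> carrier P; q \<in> carrier Q\<rbrakk> \<Longrightarrow> pres_lift G (\<lambda>(p, q). f p q) (tpq p q) = f p q"
proof -
  have c: "f p q \<in> carrier G" if "p \<in> carrier P" "q \<in> carrier Q" for p q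
    using additive_on_closed[OF balanced_right[OF assms(1)]] that by simp
  note a = additive_on_add[OF balanced_right[OF assms(1)]] additive_on_add[OF balanced_left[OF assms(1)]]
  have rel: "(\<exists>x\<in>carrier P \<times> carrier Q. \<exists>y\<in>carrier P \<times> carrier Q. \<exists>w\<in>carrier P \<times> carrier Q.
        r = frag_of x - frag_of y - frag_of w \<and> (case x of (p, q) \<Rightarrow> f p q) =
          (case y of (p, q) \<Rightarrow> f p q) \<oplus>\<^bsub>G\<^esub> (case w of (p, q) \<Rightarrow> f p q)) \<or>
      (\<exists>x\<in>carrier P \<times> carrier Q. \<exists>y\<in>carrier P \<times> carrier Q. r = frag_of x - frag_of y \<and>
        (case x of (p, q) \<Rightarrow> f p q) = (case y of (p, q) \<Rightarrow> f p q))"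
    if r: "r \<in> tensor_rels B P Q" for r
    using r unfolding tensor_rels_def
  proof (elim UnE CollectE exE conjE)
    fix p p' q assume *: "r = frag_of (p \<oplus>\<^bsub>P\<^esub> p', q) - frag_of (p, q) - frag_of (p', q)"
      "p \<in> carrier P" "p' \<in> carrier P" "q \<in> carrier Q"
    then show ?thesis
      by (intro disjI1 bexI[of _ "(p \<oplus>\<^bsub>P\<^esub> p', q)"] bexI[of _ "(p, q)"] bexI[of _ "(p', q)"]) (auto simp: a)
  next
    fix p q q' assume *: "r = frag_of (p, q \<oplus>\<^bsub>Q\<^esub> q') - frag_of (p, q) - frag_of (p, q')"
      "p \<in> carrier P" "q \<in> carrier Q" "q' \<in> carrier Q"
    then show ?thesis
      by (intro disjI1 bexI[of _ "(p, q \<oplus>\<^bsub>Q\<^esub> q')"] bexI[of _ "(p, q)"] bexI[of _ "(p, q')"]) (auto simp: a)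
  next
    fix b p q assume *: "r = frag_of (b \<odot>\<^bsub>P\<^esub> p, q) - frag_of (p, b \<odot>\<^bsub>Q\<^esub> q)"
      "b \<in> carrier B" "p \<in> carrier P" "q \<in> carrier Q"
    then show ?thesis using P Q
      by (intro disjI2 bexI[of _ "(b \<odot>\<^bsub>P\<^esub> p, q)"] bexI[of _ "(p, b \<odot>\<^bsub>Q\<^esub> q)"])
        (auto simp: balanced_mid[OF assms(1)] act_group_def)
  qed
  note * = pres_lift_relators[OF assms(2) _ rel]
  show "additive_on TPQ G (pres_lift G (\<lambda>(p, q). f p q))"
    unfolding tensor_def by (rule *(1)) (auto simp: c)
  show "pres_lift G (\<lambda>(p, q). f p q) (tpq p q) = f p q" if "p \<in> carrier P" "q \<in> carrier Q"
    unfolding tens_def using that by (subst *(2)) (auto simp: c)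
qed

lemma lift_closed:
  assumes "balanced B P Q G f" "abelian_group G" "z \<in> carrier TPQ"
  shows "pres_lift G (\<lambda>(p, q). f p q) z \<in> carrier G"
  using additive_on_closed[OF lift_additive(1)[OF assms(1,2)] assms(3)] .

lemma lift_cong:
  assumes "\<And>p q. \<lbrakk>p \<in> carrier P; q \<in> carrier Q\<rbrakk> \<Longrightarrow> f p q = g p q"
    and "\<And>p q. \<lbrakk>p \<in> carrier P; q \<in> carrier Q\<rbrakk> \<Longrightarrow> g p q \<in> carrier G"
    and "abelian_group G" "z \<in> carrier TPQ"
  shows "pres_lift G (\<lambda>(p, q). f p q) z = pres_lift G (\<lambda>(p, q). g p q) z"
  by (rule pres_lift_cong) (use assms in \<open>auto simp: tensor_def\<close>)

text \<open>Balancedness of \<open>f\<close> follows from the existence of the factorisation \<open>h\<close>.\<close>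

lemma lift_eq:
  assumes h: "additive_on TPQ G h" and G: "abelian_group G"
    and f: "\<And>p q. \<lbrakk>p \<in> carrier P; q \<in> carrier Q\<rbrakk> \<Longrightarrow> f p q = h (tpq p q)"
    and z: "z \<in> carrier TPQ"
  shows "pres_lift G (\<lambda>(p, q). f p q) z = h z"
proof -
  have b: "balanced B P Q G (\<lambda>p q. h (tpq p q))"
    by (rule balanced_comp[OF tens_balanced h])
  have "pres_lift G (\<lambda>(p, q). f p q) z = pres_lift G (\<lambda>(p, q). h (tpq p q)) z"
    by (rule lift_cong) (use f G z additive_on_closed[OF h tens_closed] in auto)
  also have "\<dots> = h z"
    by (rule ext[OF lift_additive(1)[OF b G] h G _ z]) (simp add: lift_additive(2)[OF b G])
  finally show ?thesis .
qed

lemma lift_hom: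
  assumes f: "balanced B P Q G f" and h: "additive_on G H h" and "abelian_group G" "abelian_group H"
    and z: "z \<in> carrier TPQ"
  shows "h (pres_lift G (\<lambda>(p, q). f p q) z) = pres_lift H (\<lambda>(p, q). h (f p q)) z"
  using assms by (intro lift_eq[symmetric] additive_on_comp[OF lift_additive(1)])
    (auto simp: lift_additive(2))

text \<open>Serves to show that a lifted map is additive in a parameter of the map that is
  lifted.\<close>

lemma lift_add:
  assumes f: "balanced B P Q G f" and g: "balanced B P Q G g" and G: "abelian_group G"
    and h: "\<And>p q. \<lbrakk>p \<in> carrier P; q \<in> carrier Q\<rbrakk> \<Longrightarrow> h p q = f p q \<oplus>\<^bsub>G\<^esub> g p q"
    and z: "z \<in> carrier TPQ"
  shows "pres_lift G (\<lambda>(p, q). h p q) z = pres_lift G (\<lambda>(p, q). f p q) z \<oplus>\<^bsub>G\<^esub> pres_lift G (\<lambda>(p, q). g p q) z"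
proof (rule lift_eq[OF _ G _ z])
  interpret G: abelian_group G by (rule G)
  note l = lift_additive[OF f G] lift_additive[OF g G]
  show "additive_on TPQ G
     (\<lambda>z. pres_lift G (\<lambda>(p, q). f p q) z \<oplus>\<^bsub>G\<^esub> pres_lift G (\<lambda>(p, q). g p q) z)"
    by (rule additive_onI)
      (simp_all add: additive_on_closed[OF l(1)] additive_on_closed[OF l(3)]
        additive_on_add[OF l(1)] additive_on_add[OF l(3)] G.a_ac)
qed (simp add: h lift_additive[OF f G] lift_additive[OF g G])

end

section \<open>Triple tensor products\<close>

locale tensor_product3 =
  fixes B :: "('b, 'e) ring_scheme" and C :: "('c, 'f) ring_scheme" and P :: "('b, 'p) module"
    and Q :: "('b, 'q) module" and Q' :: "('c, 'q) module" and U :: "('c, 'u) module"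
  assumes P: "act_group B P" and Q: "act_group B Q" and Q': "act_group C Q'" and U: "act_group C U"
    and QQ': "carrier Q' = carrier Q"
begin

interpretation P: abelian_group P using P by (simp add: act_group_def)
interpretation Q: abelian_group Q using Q by (simp add: act_group_def)
interpretation U: abelian_group U using U by (simp add: act_group_def)

lemma presentation:
  "presentation (carrier P \<times> carrier Q \<times> carrier U) (tensor3_rels B C P Q Q' U)"
proof
  fix r assume r: "r \<in> tensor3_rels B C P Q Q' U"
  have keys3: "Poly_Mapping.keys (frag_of x - frag_of y - frag_of w) \<subseteq> {x, y, w}" for x y w :: "'p \<times> 'q \<times> 'u"
    using keys_diff[of "frag_of x - frag_of y" "frag_of w"] keys_diff[of "frag_of x" "frag_of y"] by auto
  have keys2: "Poly_Mapping.keys (frag_of x - frag_of y) \<subseteq> {x, y}" for x y :: "'p \<times> 'q \<times> 'u"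
    using keys_diff[of "frag_of x" "frag_of y"] by auto
  from r show "Poly_Mapping.keys r \<subseteq> carrier P \<times> carrier Q \<times> carrier U"
    unfolding tensor3_rels_def using P Q Q' U QQ'
    by (elim UnE CollectE exE conjE)
      (auto simp: act_group_def dest!: subsetD[OF keys3] subsetD[OF keys2])
qed

interpretation presentation "carrier P \<times> carrier Q \<times> carrier U" "tensor3_rels B C P Q Q' U"
  by (rule presentation)

lemma abelian: "abelian_group (tensor3 B C P Q Q' U)"
  by (simp add: tensor3_def abelian_pres)

lemma tens3_balanced: "balanced3 B C P Q Q' U (tensor3 B C P Q Q' U) (tens3 B C P Q Q' U)"
proof -
  let ?X = "carrier P \<times> carrier Q \<times> carrier U" and ?R = "tensor3_rels B C P Q Q' U"
  let ?g = "pres_gen ?X ?R"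
  have 1: "additive_on U (pres_group ?X ?R) (\<lambda>u. ?g (p, q, u))" if "p \<in> carrier P" "q \<in> carrier Q" for p q
    using that by (intro additive_onI pres_gen_add pres_gen_closed) (auto intro: tensor3_rels_mem)
  have 2: "additive_on Q (pres_group ?X ?R) (\<lambda>q. ?g (p, q, u))" if "p \<in> carrier P" "u \<in> carrier U" for p u
    using that by (intro additive_onI pres_gen_add pres_gen_closed) (auto intro: tensor3_rels_mem)
  have 3: "additive_on P (pres_group ?X ?R) (\<lambda>p. ?g (p, q, u))" if "q \<in> carrier Q" "u \<in> carrier U" for q u
    using that by (intro additive_onI pres_gen_add pres_gen_closed) (auto intro: tensor3_rels_mem)
  have 4: "?g (b \<odot>\<^bsub>P\<^esub> p, q, u) = ?g (p, b \<odot>\<^bsub>Q\<^esub> q, u)"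
    if "b \<in> carrier B" "p \<in> carrier P" "q \<in> carrier Q" "u \<in> carrier U" for b p q u
    using that P Q by (intro pres_gen_eq) (auto simp: act_group_def intro: tensor3_rels_mem)
  have 5: "?g (p, c \<odot>\<^bsub>Q'\<^esub> q, u) = ?g (p, q, c \<odot>\<^bsub>U\<^esub> u)"
    if "c \<in> carrier C" "p \<in> carrier P" "q \<in> carrier Q" "u \<in> carrier U" for c p q u
    using that Q' U QQ' by (intro pres_gen_eq) (auto simp: act_group_def intro: tensor3_rels_mem)
  show ?thesis
    unfolding balanced3_def tens3_def tensor3_def using 1 2 3 4 5 by simp
qed

lemma lift_additive:
  assumes f: "balanced3 B C P Q Q' U G f" and G: "abelian_group G"
  shows "additive_on (tensor3 B C P Q Q' U) G (pres_lift G (\<lambda>(p, q, u). f p q u))"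
    and "\<lbrakk>p \<in> carrier P; q \<in> carrier Q; u \<in> carrier U\<rbrakk>
      \<Longrightarrow> pres_lift G (\<lambda>(p, q, u). f p q u) (tens3 B C P Q Q' U p q u) = f p q u"
proof -
  let ?X = "carrier P \<times> carrier Q \<times> carrier U"
  have c: "f p q u \<in> carrier G" if "p \<in> carrier P" "q \<in> carrier Q" "u \<in> carrier U" for p q u
    using f that by (auto simp: balanced3_def additive_on_def)
  have rel: "(\<exists>x\<in>?X. \<exists>y\<in>?X. \<exists>w\<in>?X.
        r = frag_of x - frag_of y - frag_of w \<and> (case x of (p, q, u) \<Rightarrow> f p q u) =
          (case y of (p, q, u) \<Rightarrow> f p q u) \<oplus>\<^bsub>G\<^esub> (case w of (p, q, u) \<Rightarrow> f p q u)) \<or>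
      (\<exists>x\<in>?X. \<exists>y\<in>?X. r = frag_of x - frag_of y \<and>
        (case x of (p, q, u) \<Rightarrow> f p q u) = (case y of (p, q, u) \<Rightarrow> f p q u))"
    if r: "r \<in> tensor3_rels B C P Q Q' U" for r
    using r unfolding tensor3_rels_def
  proof (elim UnE CollectE exE conjE)
    fix p p' q u assume *: "r = frag_of (p \<oplus>\<^bsub>P\<^esub> p', q, u) - frag_of (p, q, u) - frag_of (p', q, u)"
      "p \<in> carrier P" "p' \<in> carrier P" "q \<in> carrier Q" "u \<in> carrier U"
    then show ?thesis using f
      by (intro disjI1 bexI[of _ "(p \<oplus>\<^bsub>P\<^esub> p', q, u)"] bexI[of _ "(p, q, u)"] bexI[of _ "(p', q, u)"])
        (auto simp: balanced3_def additive_on_def)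
  next
    fix p q q' u assume *: "r = frag_of (p, q \<oplus>\<^bsub>Q\<^esub> q', u) - frag_of (p, q, u) - frag_of (p, q', u)"
      "p \<in> carrier P" "q \<in> carrier Q" "q' \<in> carrier Q" "u \<in> carrier U"
    then show ?thesis using f
      by (intro disjI1 bexI[of _ "(p, q \<oplus>\<^bsub>Q\<^esub> q', u)"] bexI[of _ "(p, q, u)"] bexI[of _ "(p, q', u)"])
        (auto simp: balanced3_def additive_on_def)
  next
    fix p q u u' assume *: "r = frag_of (p, q, u \<oplus>\<^bsub>U\<^esub> u') - frag_of (p, q, u) - frag_of (p, q, u')"
      "p \<in> carrier P" "q \<in> carrier Q" "u \<in> carrier U" "u' \<in> carrier U"
    then show ?thesis using f
      by (intro disjI1 bexI[of _ "(p, q, u \<oplus>\<^bsub>U\<^esub> u')"] bexI[of _ "(p, q, u)"] bexI[of _ "(p, q, u')"])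
        (auto simp: balanced3_def additive_on_def)
  next
    fix b p q u assume *: "r = frag_of (b \<odot>\<^bsub>P\<^esub> p, q, u) - frag_of (p, b \<odot>\<^bsub>Q\<^esub> q, u)"
      "b \<in> carrier B" "p \<in> carrier P" "q \<in> carrier Q" "u \<in> carrier U"
    then show ?thesis using P Q f
      by (intro disjI2 bexI[of _ "(b \<odot>\<^bsub>P\<^esub> p, q, u)"] bexI[of _ "(p, b \<odot>\<^bsub>Q\<^esub> q, u)"])
        (auto simp: balanced3_def act_group_def)
  next
    fix b p q u assume *: "r = frag_of (p, b \<odot>\<^bsub>Q'\<^esub> q, u) - frag_of (p, q, b \<odot>\<^bsub>U\<^esub> u)"
      "b \<in> carrier C" "p \<in> carrier P" "q \<in> carrier Q" "u \<in> carrier U"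
    then show ?thesis using Q' U QQ' f
      by (intro disjI2 bexI[of _ "(p, b \<odot>\<^bsub>Q'\<^esub> q, u)"] bexI[of _ "(p, q, b \<odot>\<^bsub>U\<^esub> u)"])
        (auto simp: balanced3_def act_group_def)
  qed
  note * = pres_lift_relators[OF G _ rel]
  show "additive_on (tensor3 B C P Q Q' U) G (pres_lift G (\<lambda>(p, q, u). f p q u))"
    unfolding tensor3_def by (rule *(1)) (auto simp: c)
  show "pres_lift G (\<lambda>(p, q, u). f p q u) (tens3 B C P Q Q' U p q u) = f p q u"
    if "p \<in> carrier P" "q \<in> carrier Q" "u \<in> carrier U"
    unfolding tens3_def using that by (subst *(2)) (auto simp: c)
qed

end

section \<open>Equivariant maps and functoriality of the tensor product\<close>

definition equivariant :: "('b, 'e) ring_scheme \<Rightarrow> ('b, 'p) module \<Rightarrow> ('b, 'q) module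
    \<Rightarrow> ('p \<Rightarrow> 'q) \<Rightarrow> bool" where
  "equivariant B P Q f \<longleftrightarrow> additive_on P Q f \<and>
     (\<forall>b\<in>carrier B. \<forall>p\<in>carrier P. f (b \<odot>\<^bsub>P\<^esub> p) = b \<odot>\<^bsub>Q\<^esub> f p)"

lemma equivariantI:
  assumes "\<And>p. p \<in> carrier P \<Longrightarrow> f p \<in> carrier Q"
    and "\<And>p p'. \<lbrakk>p \<in> carrier P; p' \<in> carrier P\<rbrakk> \<Longrightarrow> f (p \<oplus>\<^bsub>P\<^esub> p') = f p \<oplus>\<^bsub>Q\<^esub> f p'"
    and "\<And>b p. \<lbrakk>b \<in> carrier B; p \<in> carrier P\<rbrakk> \<Longrightarrow> f (b \<odot>\<^bsub>P\<^esub> p) = b \<odot>\<^bsub>Q\<^esub> f p"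
  shows "equivariant B P Q f"
  using assms by (auto simp: equivariant_def additive_on_def)

lemma equivariant_additive: "equivariant B P Q f \<Longrightarrow> additive_on P Q f"
  and equivariant_act: "\<lbrakk>equivariant B P Q f; b \<in> carrier B; p \<in> carrier P\<rbrakk> \<Longrightarrow> f (b \<odot>\<^bsub>P\<^esub> p) = b \<odot>\<^bsub>Q\<^esub> f p"
  and equivariant_closed: "\<lbrakk>equivariant B P Q f; p \<in> carrier P\<rbrakk> \<Longrightarrow> f p \<in> carrier Q"
  and equivariant_add: "\<lbrakk>equivariant B P Q f; p \<in> carrier P; p' \<in> carrier P\<rbrakk> \<Longrightarrow> f (p \<oplus>\<^bsub>P\<^esub> p') = f p \<oplus>\<^bsub>Q\<^esub> f p'"
  by (auto simp: equivariant_def additive_on_def)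

lemma equivariant_comp:
  "\<lbrakk>equivariant B P Q f; equivariant B Q U g\<rbrakk> \<Longrightarrow> equivariant B P U (\<lambda>x. g (f x))"
  by (auto simp: equivariant_def additive_on_def Pi_iff)

lemma equivariant_id: "equivariant B P P (\<lambda>x. x)"
  by (auto simp: equivariant_def additive_on_def)

text \<open>Separates linearity from extensionality. The algebra is done with
  \<open>equivariant\<close>, for which lambda terms qualify as maps; extensionality returns only
  for the arrows of the categories.\<close>

lemma linear_maps_iff:
  "f \<in> linear_maps A M N \<longleftrightarrow> f \<in> extensional (carrier M) \<and> equivariant A M N f"
  by (auto simp: linear_maps_def equivariant_def additive_on_def PiE_def)

lemma equivariant_cong:
  assumes "equivariant B P Q f" "act_group B P" "\<And>p. p \<in> carrier P \<Longrightarrow> g p = f p"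
  shows "equivariant B P Q g"
proof -
  interpret P: abelian_group P using assms by (simp add: act_group_def)
  show ?thesis using assms by (auto simp: equivariant_def additive_on_def act_group_def)
qed

section \<open>Change of the action on a fixed abelian group\<close>

lemma with_action_simps [simp]:
  "carrier (with_action M act) = carrier M" "add (with_action M act) = add M"
  "\<zero>\<^bsub>with_action M act\<^esub> = \<zero>\<^bsub>M\<^esub>" "smult (with_action M act) = act"
  by (simp_all add: with_action_def)

lemma abelian_group_with_action [simp]: "abelian_group (with_action M act) = abelian_group M"
  by (rule abelian_group_cong) simp_all

lemma additive_on_with_action [simp]:
  "additive_on (with_action M act) G f = additive_on M G f"
  by (simp add: additive_on_def)

lemma additive_on_with_action' [simp]:
  "additive_on G (with_action M act) f = additive_on G M f"
  by (simp add: additive_on_def)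

lemma a_minus_with_action [simp]: "x \<ominus>\<^bsub>with_action M act\<^esub> y = x \<ominus>\<^bsub>M\<^esub> y"
  by (simp add: a_minus_def a_inv_def m_inv_def)

text \<open>\<open>pres_lift\<close> sees only the additive structure of its target, so the various
  module structures on one group may be exchanged in it.\<close>

lemma pres_lift_group_cong:
  assumes "carrier G = carrier H" "add G = add H" "\<zero>\<^bsub>G\<^esub> = \<zero>\<^bsub>H\<^esub>"
  shows "pres_lift G f = pres_lift H f"
proof -
  have "m_inv (add_monoid G) = m_inv (add_monoid H)"
    using assms by (simp add: m_inv_def fun_eq_iff)
  then have "add_pow G = (add_pow H :: int \<Rightarrow> _)"
    using assms by (intro ext) (simp add: add_pow_def int_pow_def nat_pow_def Let_def)
  then show ?thesis
    using assms by (intro ext) (simp add: pres_lift_def finsum_def finprod_def)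
qed

lemma pres_lift_with_action [simp]: "pres_lift (with_action M act) f = pres_lift M f"
  by (rule pres_lift_group_cong) simp_all

lemma with_action_with_action [simp]: "with_action (with_action M act) act' = with_action M act'"
  by (simp add: with_action_def)

text \<open>With \<open>M = regular A\<close> the group \<open>A\<^sub>L \<otimes> \<^sub>LM\<close>
  is literally the target of the coproduct. Facts on the coproduct thereby become instances of facts
  on coactions.\<close>

definition regular :: "('k, 'a) module \<Rightarrow> ('a, 'a) module" where
  "regular A = with_action A (monoid.mult A)"

lemma restrict_scalars_regular [simp]: "restrict_scalars (regular A) f = lmul A f"
  by (simp add: restrict_scalars_def regular_def lmul_def)

lemma lmul_simps [simp]:
  "carrier (lmul A f) = carrier A" "add (lmul A f) = add A" "\<zero>\<^bsub>lmul A f\<^esub> = \<zero>\<^bsub>A\<^esub>"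
  "b \<odot>\<^bsub>lmul A f\<^esub> a = f b \<otimes>\<^bsub>A\<^esub> a"
  "abelian_group (lmul A f) = abelian_group A" "pres_lift (lmul A f) h = pres_lift A h"
  by (simp_all add: lmul_def)

lemma rmul_simps [simp]:
  "carrier (rmul A f) = carrier A" "add (rmul A f) = add A" "\<zero>\<^bsub>rmul A f\<^esub> = \<zero>\<^bsub>A\<^esub>"
  "b \<odot>\<^bsub>rmul A f\<^esub> a = a \<otimes>\<^bsub>A\<^esub> f b"
  "abelian_group (rmul A f) = abelian_group A" "pres_lift (rmul A f) h = pres_lift A h"
  by (simp_all add: rmul_def)

lemma regular_simps [simp]:
  "carrier (regular A) = carrier A" "add (regular A) = add A" "\<zero>\<^bsub>regular A\<^esub> = \<zero>\<^bsub>A\<^esub>"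
  "b \<odot>\<^bsub>regular A\<^esub> a = b \<otimes>\<^bsub>A\<^esub> a"
  "abelian_group (regular A) = abelian_group A" "pres_lift (regular A) h = pres_lift A h"
  by (simp_all add: regular_def)

lemma restrict_scalars_simps [simp]:
  "carrier (restrict_scalars M f) = carrier M" "add (restrict_scalars M f) = add M"
  "\<zero>\<^bsub>restrict_scalars M f\<^esub> = \<zero>\<^bsub>M\<^esub>" "b \<odot>\<^bsub>restrict_scalars M f\<^esub> m = f b \<odot>\<^bsub>M\<^esub> m"
  "abelian_group (restrict_scalars M f) = abelian_group M"
  "pres_lift (restrict_scalars M f) h = pres_lift M h"
  "x \<ominus>\<^bsub>restrict_scalars M f\<^esub> y = x \<ominus>\<^bsub>M\<^esub> y"
  by (simp_all add: restrict_scalars_def)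

text \<open>The map \<open>P \<otimes> f\<close>; as in \<^const>\<open>induced_map\<close>, only the codomain of \<open>f\<close> enters.\<close>

definition tmap :: "('b, 'e) ring_scheme \<Rightarrow> ('b, 'p) module \<Rightarrow> ('b, 'q) module
    \<Rightarrow> ('u \<Rightarrow> 'q) \<Rightarrow> ('p \<times> 'u \<Rightarrow>\<^sub>0 int) set \<Rightarrow> ('p \<times> 'q \<Rightarrow>\<^sub>0 int) set" where
  "tmap B P Q f = pres_lift (tensor B P Q) (\<lambda>(p, q). tens B P Q p (f q))"

lemma tens_map_balanced:
  assumes "equivariant B P P' f" "equivariant B Q Q' g"
    and T: "tensor_product B P' Q'"
  shows "balanced B P Q (tensor B P' Q') (\<lambda>p q. tens B P' Q' (f p) (g q))"
proof -
  interpret tensor_product B P' Q' by (rule T)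
  show ?thesis
    by (rule balancedI)
      (simp_all add: equivariant_closed[OF assms(1)] equivariant_closed[OF assms(2)]
        equivariant_act[OF assms(1)] equivariant_act[OF assms(2)] balanced_mid[OF tens_balanced]
        additive_on_comp[OF equivariant_additive[OF assms(2)] balanced_right[OF tens_balanced]]
        additive_on_comp[OF equivariant_additive[OF assms(1)] balanced_left[OF tens_balanced]])
qed

lemma
  assumes T: "tensor_product B P Q" "tensor_product B P Q'" and f: "equivariant B Q Q' f"
  shows tmap_additive: "additive_on (tensor B P Q) (tensor B P Q') (tmap B P Q' f)"
    and tmap_tens: "\<lbrakk>p \<in> carrier P; q \<in> carrier Q\<rbrakk> \<Longrightarrow> tmap B P Q' f (tens B P Q p q) = tens B P Q' p (f q)"
  unfolding tmap_def
  using tensor_product.lift_additive[OF T(1) tens_map_balanced[OF equivariant_id f T(2)]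
      tensor_product.abelian[OF T(2)]]
  by simp_all

lemma tmap_cong:
  assumes T: "tensor_product B P Q" "tensor_product B P Q'"
    and f: "\<And>q. q \<in> carrier Q \<Longrightarrow> f q \<in> carrier Q'"
    and g: "\<And>q. q \<in> carrier Q \<Longrightarrow> g q = f q" and z: "z \<in> carrier (tensor B P Q)"
  shows "tmap B P Q' g z = tmap B P Q' f z"
  unfolding tmap_def
  by (rule tensor_product.lift_cong[OF T(1)])
    (use assms in \<open>auto intro: tensor_product.abelian tensor_product.tens_closed\<close>)

lemma tmap_id:
  assumes T: "tensor_product B P Q" and z: "z \<in> carrier (tensor B P Q)"
  shows "tmap B P Q (\<lambda>x. x) z = z"
  unfolding tmap_def
  by (rule tensor_product.lift_eq[OF T _ tensor_product.abelian[OF T] _ z, of "\<lambda>z. z"])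
    (auto simp: additive_on_def)

lemma tmap_comp:
  assumes T: "tensor_product B P Q" "tensor_product B P Q'" "tensor_product B P Q''"
    and f: "equivariant B Q Q' f" "equivariant B Q' Q'' g" and z: "z \<in> carrier (tensor B P Q)"
  shows "tmap B P Q'' g (tmap B P Q' f z) = tmap B P Q'' (\<lambda>x. g (f x)) z"
  by (rule tensor_product.ext[OF T(1) additive_on_comp[OF tmap_additive tmap_additive] tmap_additive _ _ z])
    (use T f z equivariant_closed[OF f(1)] equivariant_comp[OF f] in
      \<open>simp_all add: tmap_tens[of B P Q Q'] tmap_tens[of B P Q' Q''] tmap_tens[of B P Q Q''] tensor_product.abelian\<close>)

lemma tmap_minus:
  assumes T: "tensor_product B P Q" "tensor_product B P Q'"
    and f: "equivariant B Q Q' f" "equivariant B Q Q' g" "equivariant B Q Q' (\<lambda>x. f x \<ominus>\<^bsub>Q'\<^esub> g x)"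
    and z: "z \<in> carrier (tensor B P Q)"
  shows "tmap B P Q' (\<lambda>x. f x \<ominus>\<^bsub>Q'\<^esub> g x) z = tmap B P Q' f z \<ominus>\<^bsub>tensor B P Q'\<^esub> tmap B P Q' g z"
proof -
  interpret T': tensor_product B P Q' by (rule T)
  have Q: "abelian_group Q" "abelian_group Q'"
    using T by (auto simp: tensor_product_def act_group_def)
  note a = tmap_additive[OF T f(1)] tmap_additive[OF T f(2)]
  show ?thesis
  proof (rule tensor_product.ext[OF T(1) tmap_additive[OF T f(3)] _ T'.abelian _ z])
    show "additive_on (tensor B P Q) (tensor B P Q')
        (\<lambda>z. tmap B P Q' f z \<ominus>\<^bsub>tensor B P Q'\<^esub> tmap B P Q' g z)"
      by (rule additive_onI)
        (simp_all add: additive_on_closed[OF a(1)] additive_on_closed[OF a(2)] a_minus_def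
          additive_on_add[OF a(1)] additive_on_add[OF a(2)] T'.T.minus_add T'.T.a_ac)
  next
    fix p q assume "p \<in> carrier P" "q \<in> carrier Q"
    then show "tmap B P Q' (\<lambda>x. f x \<ominus>\<^bsub>Q'\<^esub> g x) (tens B P Q p q) =
      tmap B P Q' f (tens B P Q p q) \<ominus>\<^bsub>tensor B P Q'\<^esub> tmap B P Q' g (tens B P Q p q)"
      by (simp add: tmap_tens[OF T f(1)] tmap_tens[OF T f(2)] tmap_tens[OF T f(3)]
          additive_on_minus[OF balanced_right[OF T'.tens_balanced] Q(2) T'.abelian]
          equivariant_closed[OF f(1)] equivariant_closed[OF f(2)])
  qed
qed

section \<open>Left and right modules and restriction of scalars\<close>

lemma left_moduleD:
  assumes "left_module A M"
  shows "ring A" "abelian_group M"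
  using assms by (simp_all add: left_module_def)

lemma act_group_restrict_scalars:
  assumes "left_module A M" "\<And>b. b \<in> carrier B \<Longrightarrow> f b \<in> carrier A"
  shows "act_group B (restrict_scalars M f)"
  using assms left_module.act_closed[OF assms(1)]
  by (auto simp: act_group_def left_moduleD)

lemma act_group_lmul:
  assumes "ring A" "\<And>b. b \<in> carrier B \<Longrightarrow> f b \<in> carrier A"
  shows "act_group B (lmul A f)" "act_group B (rmul A f)"
proof -
  interpret ring A by fact
  show "act_group B (lmul A f)" "act_group B (rmul A f)"
    using assms by (auto simp: act_group_def is_abelian_group)
qed

lemma act_group_right_module:
  assumes "right_module L N" shows "act_group L N"
  using left_moduleD[of "opp L" N] left_module.act_closed[of "opp L" N] assms
  by (auto simp: act_group_def right_module_def opp_def)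

lemma right_module_mult:
  "\<lbrakk>right_module L N; l \<in> carrier L; l' \<in> carrier L; n \<in> carrier N\<rbrakk>
    \<Longrightarrow> (l \<otimes>\<^bsub>L\<^esub> l') \<odot>\<^bsub>N\<^esub> n = l' \<odot>\<^bsub>N\<^esub> (l \<odot>\<^bsub>N\<^esub> n)"
  using left_module.act_mult[of "opp L" N l' l n] by (simp add: right_module_def opp_def)

lemma right_module_one:
  "\<lbrakk>right_module L N; n \<in> carrier N\<rbrakk> \<Longrightarrow> \<one>\<^bsub>L\<^esub> \<odot>\<^bsub>N\<^esub> n = n"
  using left_module.act_one[of "opp L" N n] by (simp add: right_module_def opp_def)

lemma right_module_add:
  "\<lbrakk>right_module L N; l \<in> carrier L; l' \<in> carrier L; n \<in> carrier N\<rbrakk>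
    \<Longrightarrow> (l \<oplus>\<^bsub>L\<^esub> l') \<odot>\<^bsub>N\<^esub> n = l \<odot>\<^bsub>N\<^esub> n \<oplus>\<^bsub>N\<^esub> l' \<odot>\<^bsub>N\<^esub> n"
  "\<lbrakk>right_module L N; l \<in> carrier L; n \<in> carrier N; n' \<in> carrier N\<rbrakk>
    \<Longrightarrow> l \<odot>\<^bsub>N\<^esub> (n \<oplus>\<^bsub>N\<^esub> n') = l \<odot>\<^bsub>N\<^esub> n \<oplus>\<^bsub>N\<^esub> l \<odot>\<^bsub>N\<^esub> n'"
  using left_module.act_add_left[of "opp L" N l l' n] left_module.act_add_right[of "opp L" N l n n']
  by (simp_all add: right_module_def opp_def)

lemma ring_opp:
  assumes "ring L" shows "ring (opp L)"
proof -
  interpret ring L by fact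
  show ?thesis
    by (intro ringI monoidI) (auto simp: opp_def m_assoc ring_simprules intro: abelian_group_cong[THEN iffD1, OF _ _ _ is_abelian_group])
qed

lemma equivariant_restrict_scalars:
  assumes "equivariant A M M' f" "\<And>b. b \<in> carrier B \<Longrightarrow> g b \<in> carrier A"
  shows "equivariant B (restrict_scalars M g) (restrict_scalars M' g) f"
  using assms by (auto simp: equivariant_def additive_on_def)

lemma equivariant_act_on:
  assumes M: "left_module A M" and "n \<in> carrier M" and g: "\<And>b. b \<in> carrier B \<Longrightarrow> g b \<in> carrier A"
  shows "equivariant B (lmul A g) (restrict_scalars M g) (\<lambda>v. v \<odot>\<^bsub>M\<^esub> n)"
    and "equivariant A (regular A) M (\<lambda>v. v \<odot>\<^bsub>M\<^esub> n)"
  using assms left_module.act_closed[OF M] left_module.act_add_left[OF M] left_module.act_mult[OF M]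
  by (auto intro!: equivariantI simp: act_group_def)

lemma left_module_regular:
  assumes "ring A" shows "left_module A (regular A)"
proof -
  interpret ring A by fact
  show ?thesis
    by (intro left_module.intro left_module_axioms.intro)
      (auto simp: ring_simprules m_assoc is_abelian_group ring_axioms)
qed

section \<open>Modules over a left bialgebroid\<close>

context left_bialgebroid
begin

lemma ring_A: "ring A" and ring_L: "ring L"
  using total base by (auto simp: assoc_algebra_def)

interpretation A: ring A by (rule ring_A)
interpretation L: ring L by (rule ring_L)

lemma s_hom: "s \<in> ring_hom L A" and t_hom: "t \<in> ring_hom (opp L) A"
  using source target by (auto simp: algebra_hom_def)

lemma s_closed [simp]: "l \<in> carrier L \<Longrightarrow> s l \<in> carrier A"
  and t_closed [simp]: "l \<in> carrier L \<Longrightarrow> t l \<in> carrier A"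
  using ring_hom_closed[OF s_hom, of l] ring_hom_closed[OF t_hom, of l] by (simp_all add: opp_def)

lemma s_one [simp]: "s \<one>\<^bsub>L\<^esub> = \<one>" and t_one [simp]: "t \<one>\<^bsub>L\<^esub> = \<one>"
  using ring_hom_one[OF s_hom] ring_hom_one[OF t_hom] by (simp_all add: opp_def)

lemma s_mult: "\<lbrakk>l \<in> carrier L; l' \<in> carrier L\<rbrakk> \<Longrightarrow> s (l \<otimes>\<^bsub>L\<^esub> l') = s l \<otimes> s l'"
  and t_mult: "\<lbrakk>l \<in> carrier L; l' \<in> carrier L\<rbrakk> \<Longrightarrow> t (l \<otimes>\<^bsub>L\<^esub> l') = t l' \<otimes> t l"
  using ring_hom_mult[OF s_hom, of l l'] ring_hom_mult[OF t_hom, of l' l] by (simp_all add: opp_def)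

lemma s_add: "\<lbrakk>l \<in> carrier L; l' \<in> carrier L\<rbrakk> \<Longrightarrow> s (l \<oplus>\<^bsub>L\<^esub> l') = s l \<oplus> s l'"
  and t_add: "\<lbrakk>l \<in> carrier L; l' \<in> carrier L\<rbrakk> \<Longrightarrow> t (l \<oplus>\<^bsub>L\<^esub> l') = t l \<oplus> t l'"
  using ring_hom_add[OF s_hom, of l l'] ring_hom_add[OF t_hom, of l l'] by (simp_all add: opp_def)

lemma \<pi>_closed [simp]: "a \<in> carrier A \<Longrightarrow> \<pi> a \<in> carrier L"
  using counit_additive by (auto simp: additive_on_def)

lemma \<gamma>_closed [simp]: "a \<in> carrier A \<Longrightarrow> \<gamma> a \<in> carrier (AA A L s t)"
  using coproduct_additive by (auto simp: additive_on_def)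

lemma \<pi>_s: "\<lbrakk>l \<in> carrier L; a \<in> carrier A\<rbrakk> \<Longrightarrow> \<pi> (s l \<otimes> a) = l \<otimes>\<^bsub>L\<^esub> \<pi> a"
  and \<pi>_t: "\<lbrakk>l \<in> carrier L; a \<in> carrier A\<rbrakk> \<Longrightarrow> \<pi> (t l \<otimes> a) = \<pi> a \<otimes>\<^bsub>L\<^esub> l"
  using counit_bilinear[of l "\<one>\<^bsub>L\<^esub>" a] counit_bilinear[of "\<one>\<^bsub>L\<^esub>" l a] by simp_all

lemma act_t: "act_group L (lmul A t)" and act_s: "act_group L (lmul A s)"
  and act_rt: "act_group L (rmul A t)"
  by (simp_all add: act_group_lmul ring_A)

lemma tensor_AM: "left_module A M \<Longrightarrow> tensor_product L (lmul A t) (restrict_scalars M s)"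
  by (simp add: tensor_product_def act_t act_group_restrict_scalars)

lemma tensor_AA: "tensor_product L (lmul A t) (lmul A s)"
  by (simp add: tensor_product_def act_t act_s)

lemma tensor_AN: "right_module L N \<Longrightarrow> tensor_product L (rmul A t) N"
  by (simp add: tensor_product_def act_rt act_group_right_module)

lemma right_module_restrict_t: "left_module A M \<Longrightarrow> right_module L (restrict_scalars M t)"
  unfolding right_module_def
  by (intro left_module.intro left_module_axioms.intro ring_opp ring_L)
    (auto simp: opp_def left_moduleD t_add t_mult
      left_module.act_closed[of A M] left_module.act_add_left[of A M] left_module.act_add_right[of A M]
      left_module.act_mult[of A M] left_module.act_one[of A M])

abbreviation "T M \<equiv> AM A L s t M"
abbreviation "te M \<equiv> am A L s t M"

lemma abelian_T: "left_module A M \<Longrightarrow> abelian_group (T M)"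
  by (rule tensor_product.abelian[OF tensor_AM])

lemma te_closed [simp]:
  "\<lbrakk>left_module A M; x \<in> carrier A; n \<in> carrier M\<rbrakk> \<Longrightarrow> te M x n \<in> carrier (T M)"
  by (rule tensor_product.tens_closed[OF tensor_AM]) simp_all

lemma te_add_right:
  "\<lbrakk>left_module A M; x \<in> carrier A; n \<in> carrier M; n' \<in> carrier M\<rbrakk>
    \<Longrightarrow> te M x (n \<oplus>\<^bsub>M\<^esub> n') = te M x n \<oplus>\<^bsub>T M\<^esub> te M x n'"
  using additive_on_add[OF balanced_right[OF tensor_product.tens_balanced[OF tensor_AM]], of M x n n']
  by (simp)

lemma te_add_left:
  "\<lbrakk>left_module A M; x \<in> carrier A; x' \<in> carrier A; n \<in> carrier M\<rbrakk>
    \<Longrightarrow> te M (x \<oplus> x') n = te M x n \<oplus>\<^bsub>T M\<^esub> te M x' n"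
  using additive_on_add[OF balanced_left[OF tensor_product.tens_balanced[OF tensor_AM]], of M n x x']
  by (simp)

lemma te_mid:
  "\<lbrakk>left_module A M; l \<in> carrier L; x \<in> carrier A; n \<in> carrier M\<rbrakk>
    \<Longrightarrow> te M (t l \<otimes> x) n = te M x (s l \<odot>\<^bsub>M\<^esub> n)"
  using balanced_mid[OF tensor_product.tens_balanced[OF tensor_AM], of M l x n]
  by (simp)

lemma equivariant_rmult: "c \<in> carrier A \<Longrightarrow> equivariant L (lmul A t) (lmul A t) (\<lambda>u. u \<otimes> c)"
  by (rule equivariantI) (simp_all add: A.ring_simprules A.m_assoc)

lemma equivariant_s: "l \<in> carrier L \<Longrightarrow> equivariant L (lmul A t) (lmul A t) (\<lambda>x. s l \<otimes> x)"
  by (rule equivariantI) (simp_all add: A.ring_simprules commuting flip: A.m_assoc)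

lemma equivariant_t:
  assumes M: "left_module A M" and l: "l \<in> carrier L"
  shows "equivariant L (restrict_scalars M s) (restrict_scalars M s) (\<lambda>m. t l \<odot>\<^bsub>M\<^esub> m)"
  using l left_module.act_closed[OF M] left_module.act_add_right[OF M]
  by (intro equivariantI) (auto simp: commuting simp flip: left_module.act_mult[OF M])

text \<open>\<open>diag M\<close> is the diagonal action \<open>a \<cdot> (x \<otimes> n) = a\<^sub>1x \<otimes> a\<^sub>2n\<close> on \<open>A\<^sub>L \<otimes> \<^sub>LM\<close>; it is well defined by the
  axiom \<open>a\<^sub>1t(l) \<otimes> a\<^sub>2 = a\<^sub>1 \<otimes> a\<^sub>2s(l)\<close>.\<close>

definition spread :: "('a, 'm) module \<Rightarrow> 'a \<Rightarrow> 'm \<Rightarrow> ('a \<times> 'a \<Rightarrow>\<^sub>0 int) set \<Rightarrow> ('a \<times> 'm \<Rightarrow>\<^sub>0 int) set" where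
  "spread M x n = pres_lift (T M) (\<lambda>(u, v). te M (u \<otimes> x) (v \<odot>\<^bsub>M\<^esub> n))"

definition diag :: "('a, 'm) module \<Rightarrow> 'a \<Rightarrow> ('a \<times> 'm \<Rightarrow>\<^sub>0 int) set \<Rightarrow> ('a \<times> 'm \<Rightarrow>\<^sub>0 int) set" where
  "diag M a = pres_lift (T M) (\<lambda>(x, n). spread M x n (\<gamma> a))"

definition diag_module :: "('a, 'm) module \<Rightarrow> ('a, ('a \<times> 'm \<Rightarrow>\<^sub>0 int) set) module" where
  "diag_module M = with_action (T M) (diag M)"

context
  fixes M :: "('a, 'm) module"
  assumes M: "left_module A M"
begin

interpretation M: left_module A M by (rule M)
interpretation TM: tensor_product L "lmul A t" "restrict_scalars M s" by (rule tensor_AM[OF M])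
interpretation AA: tensor_product L "lmul A t" "lmul A s" by (rule tensor_AA)

lemma spread_balanced:
  "\<lbrakk>x \<in> carrier A; n \<in> carrier M\<rbrakk>
    \<Longrightarrow> balanced L (lmul A t) (lmul A s) (T M) (\<lambda>u v. te M (u \<otimes> x) (v \<odot>\<^bsub>M\<^esub> n))"
  by (rule tens_map_balanced[OF equivariant_rmult equivariant_act_on(1)[OF M] tensor_AM[OF M]]) simp_all

lemma spread_additive:
  "\<lbrakk>x \<in> carrier A; n \<in> carrier M\<rbrakk> \<Longrightarrow> additive_on (AA A L s t) (T M) (spread M x n)"
  unfolding spread_def by (rule AA.lift_additive(1)[OF spread_balanced abelian_T[OF M]])

lemma spread_tens:
  "\<lbrakk>x \<in> carrier A; n \<in> carrier M; u \<in> carrier A; v \<in> carrier A\<rbrakk>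
    \<Longrightarrow> spread M x n (aa A L s t u v) = te M (u \<otimes> x) (v \<odot>\<^bsub>M\<^esub> n)"
  unfolding spread_def by (rule AA.lift_additive(2)[OF spread_balanced abelian_T[OF M]]) simp_all

lemma spread_closed [simp]:
  "\<lbrakk>x \<in> carrier A; n \<in> carrier M; z \<in> carrier (AA A L s t)\<rbrakk> \<Longrightarrow> spread M x n z \<in> carrier (T M)"
  by (rule additive_on_closed[OF spread_additive])

lemma spread_add_left:
  assumes "x \<in> carrier A" "x' \<in> carrier A" "n \<in> carrier M" "z \<in> carrier (AA A L s t)"
  shows "spread M (x \<oplus> x') n z = spread M x n z \<oplus>\<^bsub>T M\<^esub> spread M x' n z"
  unfolding spread_def using assms
  by (intro AA.lift_add[OF spread_balanced spread_balanced abelian_T[OF M]])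
    (simp_all add: A.r_distr te_add_left M M.act_closed)

lemma spread_add_right:
  assumes "x \<in> carrier A" "n \<in> carrier M" "n' \<in> carrier M" "z \<in> carrier (AA A L s t)"
  shows "spread M x (n \<oplus>\<^bsub>M\<^esub> n') z = spread M x n z \<oplus>\<^bsub>T M\<^esub> spread M x n' z"
  unfolding spread_def using assms
  by (intro AA.lift_add[OF spread_balanced spread_balanced abelian_T[OF M]])
    (simp_all add: te_add_right M M.act_closed M.act_add_right)

text \<open>The axiom \<open>takeuchi\<close> is an identity in
  \<open>A\<^sub>L \<otimes> \<^sub>LA\<close>; applying the additive map
  \<open>spread M x n\<close> to both of its sides carries it to
  \<open>A\<^sub>L \<otimes> \<^sub>LM\<close>.\<close>

lemma spread_takeuchi:
  assumes l: "l \<in> carrier L" and a: "a \<in> carrier A" and x: "x \<in> carrier A" and n: "n \<in> carrier M"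
  shows "spread M (t l \<otimes> x) n (\<gamma> a) = spread M x (s l \<odot>\<^bsub>M\<^esub> n) (\<gamma> a)"
proof -
  note h = spread_additive[OF x n]
  have R: "left_module A (regular A)" by (rule left_module_regular[OF ring_A])
  have id: "equivariant L (lmul A t) (lmul A t) (\<lambda>u. u)" "equivariant L (lmul A s) (lmul A s) (\<lambda>u. u)"
    by (rule equivariant_id)+
  have b1: "balanced L (lmul A t) (lmul A s) (AA A L s t) (\<lambda>u v. aa A L s t (u \<otimes> t l) v)"
    using l by (intro tens_map_balanced[OF equivariant_rmult id(2) tensor_AA]) simp
  have b2: "balanced L (lmul A t) (lmul A s) (AA A L s t) (\<lambda>u v. aa A L s t u (v \<otimes> s l))"
    using l equivariant_act_on(1)[OF R, of "s l" L s]
    by (intro tens_map_balanced[OF id(1) _ tensor_AA]) (simp)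
  have "spread M (t l \<otimes> x) n (\<gamma> a) = pres_lift (T M) (\<lambda>(u, v). spread M x n (aa A L s t (u \<otimes> t l) v)) (\<gamma> a)"
    unfolding spread_def[of M "t l \<otimes> x"] using assms
    by (intro AA.lift_cong abelian_T[OF M]) (simp_all add: spread_tens A.m_assoc AA.tens_closed M M.act_closed)
  also have "\<dots> = spread M x n (pres_lift (AA A L s t) (\<lambda>(u, v). aa A L s t (u \<otimes> t l) v) (\<gamma> a))"
    by (rule AA.lift_hom[OF b1 h AA.abelian abelian_T[OF M], symmetric]) (simp add: a)
  also have "\<dots> = spread M x n (pres_lift (AA A L s t) (\<lambda>(u, v). aa A L s t u (v \<otimes> s l)) (\<gamma> a))"
    by (simp add: takeuchi l a)
  also have "\<dots> = pres_lift (T M) (\<lambda>(u, v). spread M x n (aa A L s t u (v \<otimes> s l))) (\<gamma> a)"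
    by (rule AA.lift_hom[OF b2 h AA.abelian abelian_T[OF M]]) (simp add: a)
  also have "\<dots> = spread M x (s l \<odot>\<^bsub>M\<^esub> n) (\<gamma> a)"
    unfolding spread_def[of M x "s l \<odot>\<^bsub>M\<^esub> n"] using assms
    by (intro AA.lift_cong abelian_T[OF M]) (simp_all add: spread_tens M.act_mult M.act_closed M)
  finally show ?thesis .
qed

lemma diag_balanced:
  assumes a: "a \<in> carrier A"
  shows "balanced L (lmul A t) (restrict_scalars M s) (T M) (\<lambda>x n. spread M x n (\<gamma> a))"
  using a by (intro balancedI additive_onI)
    (simp_all add: spread_add_left spread_add_right spread_takeuchi)

lemma diag_additive: "a \<in> carrier A \<Longrightarrow> additive_on (T M) (T M) (diag M a)"
  unfolding diag_def by (rule TM.lift_additive(1)[OF diag_balanced abelian_T[OF M]])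

lemma diag_closed [simp]: "\<lbrakk>a \<in> carrier A; z \<in> carrier (T M)\<rbrakk> \<Longrightarrow> diag M a z \<in> carrier (T M)"
  by (rule additive_on_closed[OF diag_additive])

lemma diag_tens:
  "\<lbrakk>a \<in> carrier A; x \<in> carrier A; n \<in> carrier M\<rbrakk> \<Longrightarrow> diag M a (te M x n) = spread M x n (\<gamma> a)"
  unfolding diag_def by (rule TM.lift_additive(2)[OF diag_balanced abelian_T[OF M]]) simp_all

end

lemma spread_spread:
  assumes M: "left_module A M" and "x \<in> carrier A" "n \<in> carrier M" "p \<in> carrier A" "q \<in> carrier A"
    and y: "y \<in> carrier (AA A L s t)"
  shows "spread M x n (spread (regular A) p q y) = spread M (p \<otimes> x) (q \<odot>\<^bsub>M\<^esub> n) y"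
proof -
  note R = left_module_regular[OF ring_A]
  have sR: "additive_on (AA A L s t) (AA A L s t) (spread (regular A) p q)"
    "\<And>u v. \<lbrakk>u \<in> carrier A; v \<in> carrier A\<rbrakk> \<Longrightarrow> spread (regular A) p q (aa A L s t u v) = aa A L s t (u \<otimes> p) (v \<otimes> q)"
    using spread_additive[OF R, of p q] spread_tens[OF R, of p q] assms by (simp_all)
  show ?thesis
    using assms left_module.act_closed[OF M]
    by (intro tensor_product.ext[OF tensor_AA additive_on_comp[OF sR(1) spread_additive]
          spread_additive abelian_T[OF M] _ y])
      (simp_all add: sR spread_tens A.m_assoc left_module.act_mult[OF M])
qed

text \<open>Left multiplication by the coproduct of \<open>a\<close> commutes with right
  multiplication by \<open>x \<otimes> n\<close>. For \<open>w = \<gamma> b\<close> this becomes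
  associativity of the diagonal action.\<close>

lemma spread_diag:
  assumes M: "left_module A M" and a: "a \<in> carrier A" and x: "x \<in> carrier A" and n: "n \<in> carrier M"
    and w: "w \<in> carrier (AA A L s t)"
  shows "spread M x n (diag (regular A) a w) = diag M a (spread M x n w)"
proof -
  note R = left_module_regular[OF ring_A]
  have dR: "additive_on (AA A L s t) (AA A L s t) (diag (regular A) a)"
    "\<And>u v. \<lbrakk>u \<in> carrier A; v \<in> carrier A\<rbrakk> \<Longrightarrow> diag (regular A) a (aa A L s t u v) = spread (regular A) u v (\<gamma> a)"
    using diag_additive[OF R a] diag_tens[OF R a] by (simp_all)
  show ?thesis
    using assms left_module.act_closed[OF M]
    by (intro tensor_product.ext[OF tensor_AA additive_on_comp[OF dR(1) spread_additive]
          additive_on_comp[OF spread_additive diag_additive] abelian_T[OF M] _ w])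
      (simp_all add: dR spread_tens diag_tens spread_spread)
qed

text \<open>Multiplicativity of the coproduct, read as \<open>A\<close>-linearity of
  \<open>\<gamma>\<close> into a diagonal module.\<close>

lemma coproduct_mult_diag:
  "\<lbrakk>a \<in> carrier A; b \<in> carrier A\<rbrakk> \<Longrightarrow> \<gamma> (a \<otimes> b) = diag (regular A) a (\<gamma> b)"
  using coproduct_mult[of a b] unfolding diag_def spread_def by (simp)

lemma left_module_diag:
  assumes M: "left_module A M"
  shows "left_module A (diag_module M)"
proof -
  interpret M: left_module A M by (rule M)
  interpret TM: tensor_product L "lmul A t" "restrict_scalars M s" by (rule tensor_AM[OF M])
  note ad = additive_on_add[OF diag_additive[OF M]]
  have add: "diag M (a \<oplus> b) z = diag M a z \<oplus>\<^bsub>T M\<^esub> diag M b z"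
    if "a \<in> carrier A" "b \<in> carrier A" "z \<in> carrier (T M)" for a b z
    using that
    by (intro TM.ext[OF diag_additive[OF M] _ TM.abelian _ that(3)])
      (simp_all add: additive_on_def diag_closed[OF M] ad TM.T.a_ac diag_tens[OF M]
        additive_on_add[OF coproduct_additive] additive_on_add[OF spread_additive[OF M]])
  have mult: "diag M (a \<otimes> b) z = diag M a (diag M b z)"
    if "a \<in> carrier A" "b \<in> carrier A" "z \<in> carrier (T M)" for a b z
    using that
    by (intro TM.ext[OF diag_additive[OF M] additive_on_comp[OF diag_additive[OF M] diag_additive[OF M]]
          TM.abelian _ that(3)])
      (simp_all add: diag_tens[OF M] coproduct_mult_diag spread_diag M)
  have one: "diag M \<one> z = z" if "z \<in> carrier (T M)" for z
    using that
    by (intro TM.ext[OF diag_additive[OF M] _ TM.abelian _ that])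
      (simp_all add: additive_on_def diag_tens[OF M] coproduct_one spread_tens[OF M] M.act_one)
  show ?thesis
    unfolding diag_module_def
    by (intro left_module.intro left_module_axioms.intro ring_A)
      (simp_all add: TM.abelian diag_closed[OF M] add mult one ad)
qed

lemma tmap_AM:
  assumes "left_module A M" "left_module A M'"
    and "equivariant L (restrict_scalars M s) (restrict_scalars M' s) f"
  shows "additive_on (T M) (T M') (tmap L (lmul A t) (restrict_scalars M' s) f)"
    and "\<lbrakk>x \<in> carrier A; n \<in> carrier M\<rbrakk> \<Longrightarrow> tmap L (lmul A t) (restrict_scalars M' s) f (te M x n) = te M' x (f n)"
  using tmap_additive[OF tensor_AM[OF assms(1)] tensor_AM[OF assms(2)] assms(3)]
    tmap_tens[OF tensor_AM[OF assms(1)] tensor_AM[OF assms(2)] assms(3)] by simp_all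

abbreviation "amap M' f \<equiv> tmap L (lmul A t) (restrict_scalars M' s) f"

lemma equivariant_scalars: "equivariant A M M' f \<Longrightarrow> equivariant L (restrict_scalars M s) (restrict_scalars M' s) f"
  "equivariant A M M' f \<Longrightarrow> equivariant L (restrict_scalars M t) (restrict_scalars M' t) f"
  by (simp_all add: equivariant_restrict_scalars)

lemma amap_spread:
  assumes M: "left_module A M" "left_module A M'" and f: "equivariant A M M' f"
    and "x \<in> carrier A" "n \<in> carrier M" and z: "z \<in> carrier (AA A L s t)"
  shows "amap M' f (spread M x n z) = spread M' x (f n) z"
  using assms left_module.act_closed[OF M(1)]
  by (intro tensor_product.ext[OF tensor_AA additive_on_comp[OF spread_additive[OF M(1)] tmap_AM(1)]
        spread_additive[OF M(2)] abelian_T[OF M(2)] _ z])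
    (simp_all add: equivariant_scalars spread_tens tmap_AM(2)[OF M] equivariant_closed[OF f] equivariant_act[OF f])

lemma equivariant_amap:
  assumes M: "left_module A M" "left_module A M'" and f: "equivariant A M M' f"
  shows "equivariant A (diag_module M) (diag_module M') (amap M' f)"
proof -
  note a = tmap_AM[OF M equivariant_scalars(1)[OF f]]
  have "amap M' f (diag M a z) = diag M' a (amap M' f z)" if "a \<in> carrier A" "z \<in> carrier (T M)" for a z
    using that
    by (intro tensor_product.ext[OF tensor_AM[OF M(1)] additive_on_comp[OF diag_additive[OF M(1)] a(1)]
          additive_on_comp[OF a(1) diag_additive[OF M(2)]] abelian_T[OF M(2)] _ that(2)])
      (simp_all add: diag_tens M a amap_spread[OF M f] equivariant_closed[OF f])
  then show ?thesis
    using a(1) by (simp add: equivariant_def diag_module_def)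
qed

text \<open>Bilinearity of the coproduct at \<open>a = \<one>\<close>, with one of the two elements
  of \<open>L\<close> equal to 1.\<close>

lemma coproduct_s: assumes "l \<in> carrier L" shows "\<gamma> (s l) = aa A L s t (s l) \<one>"
  and coproduct_t: "\<gamma> (t l) = aa A L s t \<one> (t l)"
proof -
  have R: "left_module A (regular A)" by (rule left_module_regular[OF ring_A])
  interpret AA: tensor_product L "lmul A t" "lmul A s" by (rule tensor_AA)
  have eq: "equivariant L (lmul A s) (lmul A s) (\<lambda>x. t l \<otimes> x)" if "l \<in> carrier L" for l
    using equivariant_t[OF R that] by (simp)
  have b: "balanced L (lmul A t) (lmul A s) (AA A L s t) (\<lambda>x y. aa A L s t (s l \<otimes> x) (t l' \<otimes> y))"
    if "l \<in> carrier L" "l' \<in> carrier L" for l l'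
    using that by (intro tens_map_balanced[OF equivariant_s eq tensor_AA])
  have "\<gamma> (s l \<otimes> t l') = aa A L s t (s l) (t l')" if "l \<in> carrier L" "l' \<in> carrier L" for l l'
    using coproduct_bilinear[of l l' \<one>] AA.lift_additive(2)[OF b AA.abelian, of l l' \<one> \<one>] that
    by (simp add: coproduct_one)
  from this[of l "\<one>\<^bsub>L\<^esub>"] this[of "\<one>\<^bsub>L\<^esub>" l] show "\<gamma> (s l) = aa A L s t (s l) \<one>" "\<gamma> (t l) = aa A L s t \<one> (t l)"
    using assms by simp_all
qed

text \<open>Restricted along \<open>s\<close>, the diagonal action is the left
  \<open>L\<close>-action on the factor \<open>A\<close>; restricted along \<open>t\<close>, it is
  the right \<open>L\<close>-action on the factor \<open>M\<close>. So \<open>diag_module M\<close>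
  contains both \<open>L\<close>-structures on \<open>A\<^sub>L \<otimes> \<^sub>LM\<close> that
  occur in coassociativity and in the kernel condition.\<close>

lemma diag_s:
  "\<lbrakk>left_module A M; l \<in> carrier L; x \<in> carrier A; n \<in> carrier M\<rbrakk> \<Longrightarrow> diag M (s l) (te M x n) = te M (s l \<otimes> x) n"
  and diag_t:
  "\<lbrakk>left_module A M; l \<in> carrier L; x \<in> carrier A; n \<in> carrier M\<rbrakk> \<Longrightarrow> diag M (t l) (te M x n) = te M x (t l \<odot>\<^bsub>M\<^esub> n)"
  by (simp_all add: diag_tens coproduct_s coproduct_t spread_tens left_module.act_one)

end

section \<open>Coassociativity and Hopf modules\<close>

context left_bialgebroid
begin

interpretation A: ring A by (rule ring_A)
interpretation L: ring L by (rule ring_L)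
interpretation AA: tensor_product L "lmul A t" "lmul A s" by (rule tensor_AA)

lemma diag_module_simps [simp]:
  "carrier (diag_module M) = carrier (T M)" "add (diag_module M) = add (T M)"
  "\<zero>\<^bsub>diag_module M\<^esub> = \<zero>\<^bsub>T M\<^esub>" "a \<odot>\<^bsub>diag_module M\<^esub> z = diag M a z"
  "additive_on (diag_module M) G f = additive_on (T M) G f"
  "x \<ominus>\<^bsub>diag_module M\<^esub> y = x \<ominus>\<^bsub>T M\<^esub> y"
  by (simp_all add: diag_module_def)

lemma additive_on_diag_module [simp]: "additive_on G (diag_module M) f = additive_on G (T M) f"
  by (simp add: diag_module_def)

lemma left_module_regular_A: "left_module A (regular A)"
  by (rule left_module_regular[OF ring_A])

lemma equivariant_coproduct: "equivariant A (regular A) (diag_module (regular A)) \<gamma>"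
  using coproduct_additive by (simp add: equivariant_def coproduct_mult_diag additive_on_def)

text \<open>\<open>expand M\<close> is the map \<open>x \<otimes> n \<mapsto> x\<^sub>1 \<otimes> (x\<^sub>2 \<otimes> n)\<close>. Coassociativity is stated with values in
  \<open>A\<^sub>L \<otimes> \<^sub>L(A\<^sub>L \<otimes> \<^sub>LM)\<close> rather than in the triple tensor product.\<close>

definition expand :: "('a, 'm) module \<Rightarrow> ('a \<times> 'm \<Rightarrow>\<^sub>0 int) set
    \<Rightarrow> ('a \<times> ('a \<times> 'm \<Rightarrow>\<^sub>0 int) set \<Rightarrow>\<^sub>0 int) set" where
  "expand M = pres_lift (T (diag_module M))
     (\<lambda>(x, n). amap (diag_module M) (\<lambda>v. te M v n) (\<gamma> x))"

definition counit :: "('a, 'm) module \<Rightarrow> ('a \<times> 'm \<Rightarrow>\<^sub>0 int) set \<Rightarrow> 'm" where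
  "counit M = pres_lift M (\<lambda>(x, n). s (\<pi> x) \<odot>\<^bsub>M\<^esub> n)"

text \<open>Compatibility of the coaction with the action is \<open>A\<close>-linearity of
  \<open>\<tau>\<close> into the diagonal module, and \<open>L\<close>-linearity of the coaction is
  its restriction along \<open>s\<close>. Both are therefore contained in the single condition
  \<open>equivariant\<close>.\<close>

definition hopf_module :: "('a, 'm) module \<Rightarrow> ('m \<Rightarrow> ('a \<times> 'm \<Rightarrow>\<^sub>0 int) set) \<Rightarrow> bool" where
  "hopf_module M \<tau> \<longleftrightarrow> left_module A M \<and> equivariant A M (diag_module M) \<tau> \<and>
     (\<forall>m\<in>carrier M. counit M (\<tau> m) = m) \<and>
     (\<forall>m\<in>carrier M. expand M (\<tau> m) = amap (diag_module M) \<tau> (\<tau> m))"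

abbreviation "T3 M \<equiv> tensor3 L L (lmul A t) (lmul A s) (lmul A t) (restrict_scalars M s)"
abbreviation "te3 M \<equiv> tens3 L L (lmul A t) (lmul A s) (lmul A t) (restrict_scalars M s)"

definition lassoc :: "('a, 'm) module \<Rightarrow> ('a \<times> 'a \<times> 'm \<Rightarrow>\<^sub>0 int) set
    \<Rightarrow> ('a \<times> ('a \<times> 'm \<Rightarrow>\<^sub>0 int) set \<Rightarrow>\<^sub>0 int) set" where
  "lassoc M = pres_lift (T (diag_module M)) (\<lambda>(p, q, n). te (diag_module M) p (te M q n))"

definition rassoc :: "('a, 'm) module \<Rightarrow> ('a \<times> ('a \<times> 'm \<Rightarrow>\<^sub>0 int) set \<Rightarrow>\<^sub>0 int) set
    \<Rightarrow> ('a \<times> 'a \<times> 'm \<Rightarrow>\<^sub>0 int) set" where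
  "rassoc M = pres_lift (T3 M) (\<lambda>(p, w). pres_lift (T3 M) (\<lambda>(q, n). te3 M p q n) w)"

context
  fixes M :: "('a, 'm) module"
  assumes M: "left_module A M"
begin

interpretation M: left_module A M by (rule M)
interpretation TM: tensor_product L "lmul A t" "restrict_scalars M s" by (rule tensor_AM[OF M])

private lemmas D = left_module_diag[OF M]

interpretation TD: tensor_product L "lmul A t" "restrict_scalars (diag_module M) s"
  by (rule tensor_AM[OF D])
interpretation T3: tensor_product3 L L "lmul A t" "lmul A s" "lmul A t" "restrict_scalars M s"
  by unfold_locales (simp_all add: act_t act_s act_group_restrict_scalars[OF M])

lemma equivariant_te_left:
  "n \<in> carrier M \<Longrightarrow> equivariant L (lmul A s) (restrict_scalars (diag_module M) s) (\<lambda>v. te M v n)"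
  by (rule equivariantI) (simp_all add: M te_add_left diag_s)

lemma equivariant_te_one:
  "equivariant L (restrict_scalars M t) (restrict_scalars (diag_module M) t) (te M \<one>)"
  by (rule equivariantI) (simp_all add: M te_add_right diag_t)

lemma expand_balanced:
  "balanced L (lmul A t) (restrict_scalars M s) (T (diag_module M))
     (\<lambda>x n. amap (diag_module M) (\<lambda>v. te M v n) (\<gamma> x))"
proof (rule balancedI)
  note a = tmap_AM[OF left_module_regular_A D, simplified, OF equivariant_te_left]
  have b: "balanced L (lmul A t) (lmul A s) (T (diag_module M)) (\<lambda>u v. te (diag_module M) u (te M v n))"
    if "n \<in> carrier M" for n
    by (rule tens_map_balanced[OF equivariant_id equivariant_te_left[OF that] tensor_AM[OF D]])
  fix x assume x: "x \<in> carrier (lmul A t)"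
  show "additive_on (restrict_scalars M s) (T (diag_module M)) (\<lambda>n. amap (diag_module M) (\<lambda>v. te M v n) (\<gamma> x))"
  proof (rule additive_onI)
    fix n n' assume n: "n \<in> carrier (restrict_scalars M s)" "n' \<in> carrier (restrict_scalars M s)"
    then show "amap (diag_module M) (\<lambda>v. te M v (n \<oplus>\<^bsub>restrict_scalars M s\<^esub> n')) (\<gamma> x) =
        amap (diag_module M) (\<lambda>v. te M v n) (\<gamma> x) \<oplus>\<^bsub>T (diag_module M)\<^esub> amap (diag_module M) (\<lambda>v. te M v n') (\<gamma> x)"
      unfolding tmap_def using x
      by (intro AA.lift_add[OF b b TD.abelian])
        (simp_all add: te_add_right M te_add_right[OF D, simplified])
  qed (use x in \<open>simp add: additive_on_closed[OF a(1)]\<close>)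
next
  fix n assume n: "n \<in> carrier (restrict_scalars M s)"
  then show "additive_on (lmul A t) (T (diag_module M)) (\<lambda>x. amap (diag_module M) (\<lambda>v. te M v n) (\<gamma> x))"
    using additive_on_comp[OF coproduct_additive
        tmap_AM(1)[OF left_module_regular_A D, simplified, OF equivariant_te_left]]
    by (simp add: additive_on_def)
next
  note a = tmap_AM[OF left_module_regular_A D, simplified, OF equivariant_te_left]
  fix l x n assume "l \<in> carrier L" "x \<in> carrier (lmul A t)" "n \<in> carrier (restrict_scalars M s)"
  then have l: "l \<in> carrier L" and x: "x \<in> carrier A" and n: "n \<in> carrier M" by simp_all
  \<comment> \<open>The factor \<open>t l\<close> passes through the coproduct to the second leg,
    and from there over the inner tensor sign to \<open>n\<close> as \<open>s l\<close>.\<close>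
  have "amap (diag_module M) (\<lambda>v. te M v n) (diag (regular A) (t l) w) =
      amap (diag_module M) (\<lambda>v. te M v (s l \<odot>\<^bsub>M\<^esub> n)) w" if w: "w \<in> carrier (AA A L s t)" for w
  proof (rule AA.ext[OF additive_on_comp[OF _ a(1)] a(1) TD.abelian _ w])
    show "additive_on (AA A L s t) (AA A L s t) (diag (regular A) (t l))"
      using diag_additive[OF left_module_regular_A, of "t l"] l by simp
    fix u v assume "u \<in> carrier (lmul A t)" "v \<in> carrier (lmul A s)"
    then show "amap (diag_module M) (\<lambda>v. te M v n) (diag (regular A) (t l) (aa A L s t u v)) =
      amap (diag_module M) (\<lambda>v. te M v (s l \<odot>\<^bsub>M\<^esub> n)) (aa A L s t u v)"
      using diag_t[OF left_module_regular_A, of l u v] l n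
      by (simp add: a te_mid M M.act_closed)
  qed (use l n M.act_closed in simp_all)
  then show "amap (diag_module M) (\<lambda>v. te M v n) (\<gamma> (l \<odot>\<^bsub>lmul A t\<^esub> x)) =
      amap (diag_module M) (\<lambda>v. te M v (l \<odot>\<^bsub>restrict_scalars M s\<^esub> n)) (\<gamma> x)"
    using l x by (simp add: coproduct_mult_diag)
qed

lemma expand_additive: "additive_on (T M) (T (diag_module M)) (expand M)"
  unfolding expand_def by (rule TM.lift_additive(1)[OF expand_balanced TD.abelian])

lemma expand_tens:
  "\<lbrakk>x \<in> carrier A; n \<in> carrier M\<rbrakk> \<Longrightarrow> expand M (te M x n) = amap (diag_module M) (\<lambda>v. te M v n) (\<gamma> x)"
  unfolding expand_def by (rule TM.lift_additive(2)[OF expand_balanced TD.abelian]) simp_all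

lemma counit_balanced: "balanced L (lmul A t) (restrict_scalars M s) M (\<lambda>x n. s (\<pi> x) \<odot>\<^bsub>M\<^esub> n)"
  by (intro balancedI additive_onI)
    (simp_all add: M.act_closed M.act_add_right M.act_add_left additive_on_add[OF counit_additive]
      s_add \<pi>_t s_mult M.act_mult)

lemma counit_additive_M: "additive_on (T M) M (counit M)"
  unfolding counit_def by (rule TM.lift_additive(1)[OF counit_balanced left_moduleD(2)[OF M]])

lemma counit_tens: "\<lbrakk>x \<in> carrier A; n \<in> carrier M\<rbrakk> \<Longrightarrow> counit M (te M x n) = s (\<pi> x) \<odot>\<^bsub>M\<^esub> n"
  unfolding counit_def by (rule TM.lift_additive(2)[OF counit_balanced left_moduleD(2)[OF M]]) simp_all

lemma lassoc_balanced:
  "balanced3 L L (lmul A t) (lmul A s) (lmul A t) (restrict_scalars M s) (T (diag_module M))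
     (\<lambda>p q n. te (diag_module M) p (te M q n))"
  using te_add_right[OF D, simplified] te_add_left[OF D, simplified] te_mid[OF D, simplified]
  by (auto simp: balanced3_def additive_on_def M D te_add_left te_add_right te_mid diag_s)

lemma lassoc_additive: "additive_on (T3 M) (T (diag_module M)) (lassoc M)"
  and lassoc_tens: "\<lbrakk>p \<in> carrier A; q \<in> carrier A; n \<in> carrier M\<rbrakk>
    \<Longrightarrow> lassoc M (te3 M p q n) = te (diag_module M) p (te M q n)"
  unfolding lassoc_def using T3.lift_additive[OF lassoc_balanced TD.abelian] by simp_all

private lemma te3:
  assumes "p \<in> carrier A" "q \<in> carrier A" "n \<in> carrier M"
  shows "te3 M p q n \<in> carrier (T3 M)"
    and "n' \<in> carrier M \<Longrightarrow> te3 M p q (n \<oplus>\<^bsub>M\<^esub> n') = te3 M p q n \<oplus>\<^bsub>T3 M\<^esub> te3 M p q n'"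
    and "q' \<in> carrier A \<Longrightarrow> te3 M p (q \<oplus> q') n = te3 M p q n \<oplus>\<^bsub>T3 M\<^esub> te3 M p q' n"
    and "p' \<in> carrier A \<Longrightarrow> te3 M (p \<oplus> p') q n = te3 M p q n \<oplus>\<^bsub>T3 M\<^esub> te3 M p' q n"
    and "l \<in> carrier L \<Longrightarrow> te3 M (t l \<otimes> p) q n = te3 M p (s l \<otimes> q) n"
    and "l \<in> carrier L \<Longrightarrow> te3 M p (t l \<otimes> q) n = te3 M p q (s l \<odot>\<^bsub>M\<^esub> n)"
  using T3.tens3_balanced assms by (auto simp: balanced3_def additive_on_def)

lemma rassoc_inner_balanced:
  "p \<in> carrier A \<Longrightarrow> balanced L (lmul A t) (restrict_scalars M s) (T3 M) (te3 M p)"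
  by (intro balancedI additive_onI) (simp_all add: te3)

lemma rassoc_balanced:
  "balanced L (lmul A t) (restrict_scalars (diag_module M) s) (T3 M)
     (\<lambda>p w. pres_lift (T3 M) (\<lambda>(q, n). te3 M p q n) w)"
proof (rule balancedI)
  fix p assume "p \<in> carrier (lmul A t)"
  then show "additive_on (restrict_scalars (diag_module M) s) (T3 M) (\<lambda>w. pres_lift (T3 M) (\<lambda>(q, n). te3 M p q n) w)"
    using TM.lift_additive(1)[OF rassoc_inner_balanced T3.abelian] by (simp add: additive_on_def)
next
  fix w assume w: "w \<in> carrier (restrict_scalars (diag_module M) s)"
  show "additive_on (lmul A t) (T3 M) (\<lambda>p. pres_lift (T3 M) (\<lambda>(q, n). te3 M p q n) w)"
  proof (rule additive_onI)
    fix p p' assume p: "p \<in> carrier (lmul A t)" "p' \<in> carrier (lmul A t)"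
    then show "pres_lift (T3 M) (\<lambda>(q, n). te3 M (p \<oplus>\<^bsub>lmul A t\<^esub> p') q n) w =
        pres_lift (T3 M) (\<lambda>(q, n). te3 M p q n) w \<oplus>\<^bsub>T3 M\<^esub> pres_lift (T3 M) (\<lambda>(q, n). te3 M p' q n) w"
      using w by (intro TM.lift_add[OF rassoc_inner_balanced rassoc_inner_balanced T3.abelian]) (simp_all add: te3)
  qed (use w in \<open>simp add: TM.lift_closed[OF rassoc_inner_balanced T3.abelian]\<close>)
next
  fix l p w assume "l \<in> carrier L" "p \<in> carrier (lmul A t)" "w \<in> carrier (restrict_scalars (diag_module M) s)"
  then have l: "l \<in> carrier L" and p: "p \<in> carrier A" and w: "w \<in> carrier (T M)" by simp_all
  note a = TM.lift_additive[OF rassoc_inner_balanced T3.abelian]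
  have "pres_lift (T3 M) (\<lambda>(q, n). te3 M (t l \<otimes> p) q n) w =
      pres_lift (T3 M) (\<lambda>(q, n). te3 M p q n) (diag M (s l) w)"
    using l p
    by (intro TM.ext[OF a(1) additive_on_comp[OF diag_additive[OF M] a(1)] T3.abelian _ w])
      (simp_all add: a diag_s M te3)
  then show "pres_lift (T3 M) (\<lambda>(q, n). te3 M (l \<odot>\<^bsub>lmul A t\<^esub> p) q n) w =
      pres_lift (T3 M) (\<lambda>(q, n). te3 M p q n) (l \<odot>\<^bsub>restrict_scalars (diag_module M) s\<^esub> w)"
    by simp
qed

lemma rassoc_additive: "additive_on (T (diag_module M)) (T3 M) (rassoc M)"
  unfolding rassoc_def by (rule TD.lift_additive(1)[OF rassoc_balanced T3.abelian])

lemma rassoc_tens: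
  "\<lbrakk>p \<in> carrier A; w \<in> carrier (T M)\<rbrakk>
    \<Longrightarrow> rassoc M (te (diag_module M) p w) = pres_lift (T3 M) (\<lambda>(q, n). te3 M p q n) w"
  unfolding rassoc_def by (rule TD.lift_additive(2)[OF rassoc_balanced T3.abelian]) simp_all

lemma rassoc_tens_tens:
  "\<lbrakk>p \<in> carrier A; q \<in> carrier A; n \<in> carrier M\<rbrakk>
    \<Longrightarrow> rassoc M (te (diag_module M) p (te M q n)) = te3 M p q n"
  using M by (simp add: rassoc_tens TM.lift_additive(2)[OF rassoc_inner_balanced T3.abelian])

text \<open>A left inverse makes \<open>rassoc\<close> injective, which is what it takes to cancel
  it from an equation in the triple tensor product.\<close>

lemma lassoc_rassoc:
  assumes "z \<in> carrier (T (diag_module M))"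
  shows "lassoc M (rassoc M z) = z"
proof (rule TD.ext[OF additive_on_comp[OF rassoc_additive lassoc_additive] _ TD.abelian _ assms])
  fix p w assume "p \<in> carrier (lmul A t)" "w \<in> carrier (restrict_scalars (diag_module M) s)"
  then have p: "p \<in> carrier A" and w: "w \<in> carrier (T M)" by simp_all
  have "additive_on (T M) (T (diag_module M)) (te (diag_module M) p)"
    using te_add_right[OF D p] p D by (simp add: additive_on_def)
  note a = this
  show "lassoc M (rassoc M (te (diag_module M) p w)) = te (diag_module M) p w"
    by (rule TM.ext[OF additive_on_comp[OF additive_on_comp[OF a rassoc_additive] lassoc_additive] a TD.abelian _ w])
      (simp add: rassoc_tens_tens lassoc_tens p)
qed (simp add: additive_on_def)

lemma expand_eq_triple:
  assumes z: "z \<in> carrier (T M)"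
  shows "pres_lift (T3 M) (\<lambda>(x, n). pres_lift (T3 M) (\<lambda>(u, v). te3 M u v n) (\<gamma> x)) z = rassoc M (expand M z)"
proof (rule TM.lift_eq[OF additive_on_comp[OF expand_additive rassoc_additive] T3.abelian _ z])
  fix x n assume "x \<in> carrier (lmul A t)" "n \<in> carrier (restrict_scalars M s)"
  then have x: "x \<in> carrier A" and n: "n \<in> carrier M" by simp_all
  note a = tmap_AM[OF left_module_regular_A D, simplified, OF equivariant_te_left[OF n]]
  show "pres_lift (T3 M) (\<lambda>(u, v). te3 M u v n) (\<gamma> x) = rassoc M (expand M (te M x n))"
    unfolding expand_tens[OF x n]
    using x n by (intro AA.lift_eq[OF additive_on_comp[OF a(1) rassoc_additive] T3.abelian]) (simp_all add: a rassoc_tens_tens)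
qed

lemma amap_eq_triple:
  assumes \<tau>: "equivariant A M (diag_module M) \<tau>" and z: "z \<in> carrier (T M)"
  shows "pres_lift (T3 M) (\<lambda>(x, n). pres_lift (T3 M) (\<lambda>(u, v). te3 M x u v) (\<tau> n)) z =
    rassoc M (amap (diag_module M) \<tau> z)"
proof -
  note a = tmap_AM[OF M D equivariant_scalars(1)[OF \<tau>]]
  show ?thesis
    using equivariant_closed[OF \<tau>]
    by (intro TM.lift_eq[OF additive_on_comp[OF a(1) rassoc_additive] T3.abelian _ z])
      (simp add: a rassoc_tens)
qed

text \<open>The two sides of the axiom are the images under the injective \<open>rassoc\<close> of
  the two sides in the iterated tensor product. The case \<open>M = regular A\<close> translates the
  coassociativity of the bialgebroid as well.\<close>

lemma coassociative_iff:
  assumes \<tau>: "equivariant A M (diag_module M) \<tau>" and m: "m \<in> carrier M"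
  shows "pres_lift (T3 M) (\<lambda>(x, n). pres_lift (T3 M) (\<lambda>(u, v). te3 M u v n) (\<gamma> x)) (\<tau> m) =
      pres_lift (T3 M) (\<lambda>(x, n). pres_lift (T3 M) (\<lambda>(u, v). te3 M x u v) (\<tau> n)) (\<tau> m)
    \<longleftrightarrow> expand M (\<tau> m) = amap (diag_module M) \<tau> (\<tau> m)"
proof -
  have c: "\<tau> m \<in> carrier (T M)" using equivariant_closed[OF \<tau> m] by simp
  have "expand M (\<tau> m) \<in> carrier (T (diag_module M))"
    "amap (diag_module M) \<tau> (\<tau> m) \<in> carrier (T (diag_module M))"
    using additive_on_closed[OF expand_additive c]
      additive_on_closed[OF tmap_AM(1)[OF M D equivariant_scalars(1)[OF \<tau>]] c] by simp_all
  then show ?thesis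
    using lassoc_rassoc unfolding expand_eq_triple[OF c] amap_eq_triple[OF \<tau> c] by metis
qed

end

lemma left_hopf_module_iff: "left_hopf_module A L s t \<gamma> \<pi> M \<tau> \<longleftrightarrow> hopf_module M \<tau>"
proof
  assume "left_hopf_module A L s t \<gamma> \<pi> M \<tau>"
  then interpret H: left_hopf_module A L s t \<gamma> \<pi> M \<tau> .
  have e: "equivariant A M (diag_module M) \<tau>"
    using H.coaction_additive H.compatible by (simp add: equivariant_def diag_def spread_def)
  then show "hopf_module M \<tau>"
    using H.module H.counital H.coassociative coassociative_iff[OF H.module e]
    by (simp add: hopf_module_def counit_def)
next
  assume "hopf_module M \<tau>"
  then have M: "left_module A M" and e: "equivariant A M (diag_module M) \<tau>"
    and "\<And>m. m \<in> carrier M \<Longrightarrow> counit M (\<tau> m) = m"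
    and "\<And>m. m \<in> carrier M \<Longrightarrow> expand M (\<tau> m) = amap (diag_module M) \<tau> (\<tau> m)"
    by (simp_all add: hopf_module_def)
  note h = this
  have lin: "pres_lift (T M) (\<lambda>(x, n). te M (s l \<otimes> x) n) z = diag M (s l) z"
    if "l \<in> carrier L" "z \<in> carrier (T M)" for l z
    by (rule tensor_product.lift_eq[OF tensor_AM[OF M] diag_additive[OF M] abelian_T[OF M] _ that(2)])
      (simp_all add: diag_s M that)
  show "left_hopf_module A L s t \<gamma> \<pi> M \<tau>"
  proof (rule left_hopf_module.intro)
    show "left_module A M" by (rule M)
    show "additive_on M (T M) \<tau>" using equivariant_additive[OF e] by simp
    show "\<tau> (s l \<odot>\<^bsub>M\<^esub> m) = pres_lift (T M) (\<lambda>(x, n). te M (s l \<otimes> x) n) (\<tau> m)"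
      if "l \<in> carrier L" "m \<in> carrier M" for l m
      using lin[OF that(1)] equivariant_act[OF e] equivariant_closed[OF e] that by simp
    show "pres_lift M (\<lambda>(x, n). s (\<pi> x) \<odot>\<^bsub>M\<^esub> n) (\<tau> m) = m" if "m \<in> carrier M" for m
      using h(3)[OF that] by (simp add: counit_def)
    show "\<tau> (a \<odot>\<^bsub>M\<^esub> m) = pres_lift (T M) (\<lambda>(u, n). pres_lift (T M)
             (\<lambda>(x, y). te M (x \<otimes> u) (y \<odot>\<^bsub>M\<^esub> n)) (\<gamma> a)) (\<tau> m)"
      if "a \<in> carrier A" "m \<in> carrier M" for a m
      using equivariant_act[OF e that] by (simp add: diag_def spread_def)
  qed (rule coassociative_iff[OF M e, THEN iffD2, OF _ h(4)])
qed

lemma hopf_module_regular: "hopf_module (regular A) \<gamma>"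
  unfolding hopf_module_def
  using left_module_regular_A equivariant_coproduct counital_left
    coassociative_iff[OF left_module_regular_A equivariant_coproduct] coassociative
  by (simp add: counit_def)

lemma amap_comp:
  assumes "left_module A M" "left_module A M'" "left_module A M''"
    and f: "equivariant L (restrict_scalars M s) (restrict_scalars M' s) f"
    and g: "equivariant L (restrict_scalars M' s) (restrict_scalars M'' s) g"
    and "z \<in> carrier (T M)"
  shows "amap M'' g (amap M' f z) = amap M'' (\<lambda>x. g (f x)) z"
  using assms by (intro tmap_comp[of L "lmul A t" "restrict_scalars M s"] tensor_AM)

lemma amap_cong:
  assumes "left_module A M" "left_module A M'"
    and "\<And>x. x \<in> carrier M \<Longrightarrow> f x \<in> carrier M'" "\<And>x. x \<in> carrier M \<Longrightarrow> g x = f x"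
    and "z \<in> carrier (T M)"
  shows "amap M' g z = amap M' f z"
  using assms by (intro tmap_cong[of L "lmul A t" "restrict_scalars M s"] tensor_AM) simp_all

lemma counit_amap:
  assumes M: "left_module A M" "left_module A M'" and f: "equivariant A M M' f" and z: "z \<in> carrier (T M)"
  shows "counit M' (amap M' f z) = f (counit M z)"
proof -
  note a = tmap_AM[OF M equivariant_scalars(1)[OF f]]
  show ?thesis
    by (intro tensor_product.ext[OF tensor_AM[OF M(1)] additive_on_comp[OF a(1) counit_additive_M[OF M(2)]]
        additive_on_comp[OF counit_additive_M[OF M(1)] equivariant_additive[OF f]] left_moduleD(2)[OF M(2)] _ z])
      (simp_all add: a counit_tens M equivariant_closed[OF f] equivariant_act[OF f])
qed

lemma expand_amap:
  assumes M: "left_module A M" "left_module A M'" and f: "equivariant A M M' f" and z: "z \<in> carrier (T M)"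
  shows "expand M' (amap M' f z) = amap (diag_module M') (amap M' f) (expand M z)"
proof -
  note a = tmap_AM[OF M equivariant_scalars(1)[OF f]]
  note D = left_module_diag[OF M(1)] left_module_diag[OF M(2)]
  note b = equivariant_amap[OF M f]
  show ?thesis
  proof (rule tensor_product.ext[OF tensor_AM[OF M(1)] additive_on_comp[OF a(1) expand_additive[OF M(2)]]
        additive_on_comp[OF expand_additive[OF M(1)] tmap_AM(1)[OF D equivariant_scalars(1)[OF b]]]
        abelian_T[OF D(2)] _ z])
    fix x n assume "x \<in> carrier (lmul A t)" "n \<in> carrier (restrict_scalars M s)"
    then have x: "x \<in> carrier A" and n: "n \<in> carrier M" by simp_all
    have "amap (diag_module M') (amap M' f) (amap (diag_module M) (\<lambda>v. te M v n) (\<gamma> x)) =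
        amap (diag_module M') (\<lambda>v. amap M' f (te M v n)) (\<gamma> x)"
      using x n
      by (intro amap_comp[OF left_module_regular_A D _ equivariant_scalars(1)[OF b]])
        (simp_all add: equivariant_te_left[OF M(1)])
    also have "\<dots> = amap (diag_module M') (\<lambda>v. te M' v (f n)) (\<gamma> x)"
      using x n by (intro amap_cong[OF left_module_regular_A D(2)]) (simp_all add: a M equivariant_closed[OF f])
    finally show "expand M' (amap M' f (te M x n)) = amap (diag_module M') (amap M' f) (expand M (te M x n))"
      using x n by (simp add: a expand_tens M equivariant_closed[OF f])
  qed
qed

text \<open>\<open>counit\<close> and \<open>expand\<close> are natural for \<open>A\<close>-linear
  maps, so the counit and coassociativity axioms pass from \<open>m\<close> to \<open>f m\<close>.
  Stating this elementwise lets one Hopf module be covered by the images of many maps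
  \<open>f\<close>; a renaming of the carrier is the case of a single bijective
  \<open>f\<close>.\<close>

lemma hopf_module_image:
  assumes H: "hopf_module M \<tau>" and M': "left_module A M'"
    and f: "equivariant A M M' f" and \<sigma>: "equivariant A M' (diag_module M') \<sigma>"
    and eq: "\<And>m. m \<in> carrier M \<Longrightarrow> \<sigma> (f m) = amap M' f (\<tau> m)" and m: "m \<in> carrier M"
  shows "counit M' (\<sigma> (f m)) = f m"
    and "expand M' (\<sigma> (f m)) = amap (diag_module M') \<sigma> (\<sigma> (f m))"
proof -
  have M: "left_module A M" and \<tau>: "equivariant A M (diag_module M) \<tau>"
    and c: "counit M (\<tau> m) = m" and e: "expand M (\<tau> m) = amap (diag_module M) \<tau> (\<tau> m)"
    using H m by (simp_all add: hopf_module_def)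
  note D = left_module_diag[OF M] left_module_diag[OF M']
  have \<tau>m: "\<tau> m \<in> carrier (T M)" using equivariant_closed[OF \<tau> m] by simp
  show "counit M' (\<sigma> (f m)) = f m"
    using counit_amap[OF M M' f \<tau>m] by (simp add: eq m c)
  have "expand M' (\<sigma> (f m)) = amap (diag_module M') (amap M' f) (amap (diag_module M) \<tau> (\<tau> m))"
    using expand_amap[OF M M' f \<tau>m] by (simp add: eq m e)
  also have "\<dots> = amap (diag_module M') (\<lambda>m. amap M' f (\<tau> m)) (\<tau> m)"
    by (rule amap_comp[OF M D equivariant_scalars(1)[OF \<tau>] equivariant_scalars(1)[OF equivariant_amap[OF M M' f]] \<tau>m])
  also have "\<dots> = amap (diag_module M') (\<lambda>m. \<sigma> (f m)) (\<tau> m)"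
    using equivariant_closed[OF \<sigma>] equivariant_closed[OF f]
    by (intro amap_cong[OF M D(2) _ _ \<tau>m]) (simp_all add: eq[symmetric])
  also have "\<dots> = amap (diag_module M') \<sigma> (amap M' f (\<tau> m))"
    by (rule amap_comp[OF M M' D(2) equivariant_scalars(1)[OF f] equivariant_scalars(1)[OF \<sigma>] \<tau>m, symmetric])
  finally show "expand M' (\<sigma> (f m)) = amap (diag_module M') \<sigma> (\<sigma> (f m))"
    by (simp add: eq m)
qed

text \<open>The coproduct of \<open>a\<close> is \<open>a\<close> applied to
  \<open>\<one> \<otimes> \<one>\<close>, and the \<open>A\<close>-linear map
  \<open>v \<mapsto> v \<cdot> n\<close> from the regular module induces an \<open>A\<close>-linear
  map of diagonal modules that sends \<open>\<one> \<otimes> \<one>\<close> to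
  \<open>\<one> \<otimes> n\<close>.\<close>

lemma diag_one:
  assumes M: "left_module A M" and a: "a \<in> carrier A" and n: "n \<in> carrier M"
  shows "diag M a (te M \<one> n) = amap M (\<lambda>v. v \<odot>\<^bsub>M\<^esub> n) (\<gamma> a)"
proof -
  note e = equivariant_act_on(2)[OF M n]
  have "amap M (\<lambda>v. v \<odot>\<^bsub>M\<^esub> n) (diag (regular A) a (te (regular A) \<one> \<one>)) = diag M a (amap M (\<lambda>v. v \<odot>\<^bsub>M\<^esub> n) (te (regular A) \<one> \<one>))"
    using equivariant_act[OF equivariant_amap[OF left_module_regular_A M e] a, where p = "te (regular A) \<one> \<one>"]
    by (simp add: left_module_regular_A del: restrict_scalars_regular)
  moreover have "diag (regular A) a (te (regular A) \<one> \<one>) = \<gamma> a"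
    using coproduct_mult_diag[OF a, of \<one>] a by (simp add: coproduct_one)
  moreover have "amap M (\<lambda>v. v \<odot>\<^bsub>M\<^esub> n) (te (regular A) \<one> \<one>) = te M \<one> n"
    using tmap_AM(2)[OF left_module_regular_A M equivariant_scalars(1)[OF e], where x = \<one> and n = \<one>] n
    by (simp add: left_module.act_one[OF M])
  ultimately show ?thesis by simp
qed

end

section \<open>Induced Hopf modules and coinvariants\<close>

lemma induced_map_eq_tmap: "induced_map A L t N f = tmap L (rmul A t) N f"
  by (simp add: induced_map_def tmap_def)

lemma tensor_cong:
  assumes "carrier Q = carrier Q'" "add Q = add Q'"
    and "\<And>b q. \<lbrakk>b \<in> carrier B; q \<in> carrier Q\<rbrakk> \<Longrightarrow> b \<odot>\<^bsub>Q\<^esub> q = b \<odot>\<^bsub>Q'\<^esub> q"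
  shows "tensor B P Q = tensor B P Q'" and "tens B P Q = tens B P Q'" and "tmap B P Q = tmap B P Q'"
proof -
  have r: "tensor_rels B P Q = tensor_rels B P Q'"
    using assms(3) unfolding tensor_rels_def assms(1,2)[symmetric] by (intro arg_cong2[of _ _ _ _ "(\<union>)"] refl) force
  then show T: "tensor B P Q = tensor B P Q'" "tens B P Q = tens B P Q'"
    by (simp_all add: tensor_def tens_def fun_eq_iff assms)
  show "tmap B P Q = tmap B P Q'"
    by (simp add: tmap_def T fun_eq_iff)
qed

lemma right_module_submodule:
  assumes N: "right_module L N" and H: "H \<subseteq> carrier N" "\<zero>\<^bsub>N\<^esub> \<in> H"
    and "\<And>x y. \<lbrakk>x \<in> H; y \<in> H\<rbrakk> \<Longrightarrow> x \<oplus>\<^bsub>N\<^esub> y \<in> H" and "\<And>x. x \<in> H \<Longrightarrow> \<ominus>\<^bsub>N\<^esub> x \<in> H"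
    and "\<And>l x. \<lbrakk>l \<in> carrier L; x \<in> H\<rbrakk> \<Longrightarrow> l \<odot>\<^bsub>N\<^esub> x \<in> H"
  shows "right_module L (N\<lparr>carrier := H\<rparr>)"
proof -
  interpret N: left_module "opp L" N using N by (simp add: right_module_def)
  have "subgroup H (add_monoid N)"
    using assms by (intro subgroup.intro) (auto simp: a_inv_def)
  then have "group ((add_monoid N)\<lparr>carrier := H\<rparr>)"
    using N.M.a_group group.subgroup_imp_group by blast
  then have "comm_group (add_monoid (N\<lparr>carrier := H\<rparr>))"
    using H N.M.a_comm by (intro group.group_comm_groupI) auto
  then have "abelian_group (N\<lparr>carrier := H\<rparr>)" by (simp add: abelian_group_iff)
  then show ?thesis
    unfolding right_module_def using assms H N.act_add_left N.act_add_right N.act_mult N.act_one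
    by (intro left_module.intro left_module_axioms.intro N.ring_axioms) (auto simp: opp_def subset_iff)
qed

context left_bialgebroid
begin

interpretation A: ring A by (rule ring_A)
interpretation L: ring L by (rule ring_L)
interpretation AA: tensor_product L "lmul A t" "lmul A s" by (rule tensor_AA)

abbreviation "IM N \<equiv> induced_module A L t N"
abbreviation "an' N \<equiv> an A L t N"
abbreviation "imap N f \<equiv> tmap L (rmul A t) N f"

lemma induced_module_simps [simp]:
  "carrier (IM N) = carrier (AN A L t N)" "add (IM N) = add (AN A L t N)" "\<zero>\<^bsub>IM N\<^esub> = \<zero>\<^bsub>AN A L t N\<^esub>"
  "additive_on (IM N) G f = additive_on (AN A L t N) G f"
  by (simp_all add: induced_module_def)

lemma additive_on_induced_module [simp]: "additive_on G (IM N) f = additive_on G (AN A L t N) f"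
  by (simp add: induced_module_def)

context
  fixes N :: "('b, 'n) module"
  assumes N: "right_module L N"
begin

interpretation TN: tensor_product L "rmul A t" N by (rule tensor_AN[OF N])

lemma an_closed [simp]: "\<lbrakk>x \<in> carrier A; n \<in> carrier N\<rbrakk> \<Longrightarrow> an' N x n \<in> carrier (AN A L t N)"
  by (rule TN.tens_closed) simp_all

lemma an_add_right:
  "\<lbrakk>x \<in> carrier A; n \<in> carrier N; n' \<in> carrier N\<rbrakk>
    \<Longrightarrow> an' N x (n \<oplus>\<^bsub>N\<^esub> n') = an' N x n \<oplus>\<^bsub>AN A L t N\<^esub> an' N x n'"
  using additive_on_add[OF balanced_right[OF TN.tens_balanced]] by simp

lemma an_add_left:
  "\<lbrakk>x \<in> carrier A; x' \<in> carrier A; n \<in> carrier N\<rbrakk>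
    \<Longrightarrow> an' N (x \<oplus> x') n = an' N x n \<oplus>\<^bsub>AN A L t N\<^esub> an' N x' n"
  using additive_on_add[OF balanced_left[OF TN.tens_balanced]] by simp

lemma an_mid:
  "\<lbrakk>l \<in> carrier L; x \<in> carrier A; n \<in> carrier N\<rbrakk> \<Longrightarrow> an' N (x \<otimes> t l) n = an' N x (l \<odot>\<^bsub>N\<^esub> n)"
  using balanced_mid[OF TN.tens_balanced] by simp

lemma an_one_t: "\<lbrakk>l \<in> carrier L; n \<in> carrier N\<rbrakk> \<Longrightarrow> an' N (t l) n = an' N \<one> (l \<odot>\<^bsub>N\<^esub> n)"
  using an_mid[of l \<one> n] by simp

lemma induced_act_balanced:
  "a \<in> carrier A \<Longrightarrow> balanced L (rmul A t) N (AN A L t N) (\<lambda>x n. an' N (a \<otimes> x) n)"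
  by (rule tens_map_balanced[OF _ equivariant_id tensor_AN[OF N]], rule equivariantI)
    (simp_all add: A.ring_simprules A.m_assoc)

lemma induced_act:
  "a \<in> carrier A \<Longrightarrow> additive_on (AN A L t N) (AN A L t N) (\<lambda>z. a \<odot>\<^bsub>IM N\<^esub> z)"
  "\<lbrakk>a \<in> carrier A; x \<in> carrier A; n \<in> carrier N\<rbrakk> \<Longrightarrow> a \<odot>\<^bsub>IM N\<^esub> an' N x n = an' N (a \<otimes> x) n"
  unfolding induced_module_def using TN.lift_additive[OF induced_act_balanced TN.abelian] by simp_all

lemma left_module_induced: "left_module A (IM N)"
proof -
  note c = additive_on_closed[OF induced_act(1)] and a = additive_on_add[OF induced_act(1)]
  have add: "(a \<oplus> b) \<odot>\<^bsub>IM N\<^esub> z = a \<odot>\<^bsub>IM N\<^esub> z \<oplus>\<^bsub>AN A L t N\<^esub> b \<odot>\<^bsub>IM N\<^esub> z"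
    if "a \<in> carrier A" "b \<in> carrier A" "z \<in> carrier (AN A L t N)" for a b z
    by (rule TN.ext[OF induced_act(1) _ TN.abelian _ that(3)])
      (use that in \<open>simp_all add: additive_on_def c a TN.T.a_ac induced_act(2) A.l_distr an_add_left\<close>)
  have mult: "(a \<otimes> b) \<odot>\<^bsub>IM N\<^esub> z = a \<odot>\<^bsub>IM N\<^esub> (b \<odot>\<^bsub>IM N\<^esub> z)"
    if "a \<in> carrier A" "b \<in> carrier A" "z \<in> carrier (AN A L t N)" for a b z
    by (rule TN.ext[OF induced_act(1) additive_on_comp[OF induced_act(1) induced_act(1)] TN.abelian _ that(3)])
      (use that in \<open>simp_all add: induced_act(2) A.m_assoc\<close>)
  have one: "\<one> \<odot>\<^bsub>IM N\<^esub> z = z" if "z \<in> carrier (AN A L t N)" for z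
    by (rule TN.ext[OF induced_act(1) _ TN.abelian _ that]) (simp_all add: additive_on_def induced_act(2))
  have "abelian_group (IM N)" by (simp add: induced_module_def TN.abelian)
  then show ?thesis
    by (intro left_module.intro left_module_axioms.intro ring_A) (simp_all add: c a add mult one)
qed

end

text \<open>Induction is left adjoint to the restriction of scalars along \<open>t\<close>; \<open>adj W g\<close> corresponds to the right
  \<open>L\<close>-linear map \<open>g : N \<rightarrow> W\<close>.\<close>

definition adj :: "('a, 'w) module \<Rightarrow> ('n \<Rightarrow> 'w) \<Rightarrow> ('a \<times> 'n \<Rightarrow>\<^sub>0 int) set \<Rightarrow> 'w" where
  "adj W g = pres_lift W (\<lambda>(a, n). a \<odot>\<^bsub>W\<^esub> g n)"

context
  fixes N :: "('b, 'n) module" and W :: "('a, 'w) module" and g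
  assumes N: "right_module L N" and W: "left_module A W"
    and g: "equivariant L N (restrict_scalars W t) g"
begin

interpretation TN: tensor_product L "rmul A t" N by (rule tensor_AN[OF N])
interpretation W: left_module A W by (rule W)

lemma adj_balanced: "balanced L (rmul A t) N W (\<lambda>a n. a \<odot>\<^bsub>W\<^esub> g n)"
  using equivariant_closed[OF g] equivariant_add[OF g] equivariant_act[OF g]
  by (intro balancedI additive_onI)
    (simp_all add: W.act_closed W.act_add_left W.act_add_right W.act_mult)

lemma adj_additive: "additive_on (AN A L t N) W (adj W g)"
  and adj_tens: "\<lbrakk>a \<in> carrier A; n \<in> carrier N\<rbrakk> \<Longrightarrow> adj W g (an' N a n) = a \<odot>\<^bsub>W\<^esub> g n"
  unfolding adj_def using TN.lift_additive[OF adj_balanced left_moduleD(2)[OF W]] by simp_all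

lemma equivariant_adj: "equivariant A (IM N) W (adj W g)"
proof -
  have "adj W g (a \<odot>\<^bsub>IM N\<^esub> z) = a \<odot>\<^bsub>W\<^esub> adj W g z" if "a \<in> carrier A" "z \<in> carrier (AN A L t N)" for a z
  proof (rule TN.ext[OF additive_on_comp[OF induced_act(1)[OF N that(1)] adj_additive]
        additive_on_comp[OF adj_additive, of W "\<lambda>w. a \<odot>\<^bsub>W\<^esub> w"] left_moduleD(2)[OF W] _ that(2)])
    show "additive_on W W (\<lambda>w. a \<odot>\<^bsub>W\<^esub> w)"
      using that by (intro additive_onI) (simp_all add: W.act_closed W.act_add_right)
  qed (use that equivariant_closed[OF g] in \<open>simp_all add: induced_act(2)[OF N] adj_tens W.act_mult\<close>)
  then show ?thesis using adj_additive by (simp add: equivariant_def)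
qed

end

definition induced_coaction :: "('b, 'n) module \<Rightarrow> ('a \<times> 'n \<Rightarrow>\<^sub>0 int) set
    \<Rightarrow> ('a \<times> ('a \<times> 'n \<Rightarrow>\<^sub>0 int) set \<Rightarrow>\<^sub>0 int) set" where
  "induced_coaction N = pres_lift (T (IM N)) (\<lambda>(x, n). amap (IM N) (\<lambda>v. an' N v n) (\<gamma> x))"

lemma induced_hopf_module_eq: "induced_hopf_module A L s t \<gamma> N = (IM N, induced_coaction N)"
  by (simp add: induced_hopf_module_def induced_coaction_def Let_def tmap_def)

context
  fixes N :: "('b, 'n) module"
  assumes N: "right_module L N"
begin

interpretation TN: tensor_product L "rmul A t" N by (rule tensor_AN[OF N])

lemma equivariant_an_one: "equivariant L N (restrict_scalars (IM N) t) (an' N \<one>)"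
  by (rule equivariantI) (simp_all add: N an_add_right induced_act(2)[OF N] an_one_t)

lemma equivariant_te_an:
  "equivariant L N (restrict_scalars (diag_module (IM N)) t) (\<lambda>n. te (IM N) \<one> (an' N \<one> n))"
  by (rule equivariant_comp[OF equivariant_an_one equivariant_te_one[OF left_module_induced[OF N]]])

lemma equivariant_an: "n \<in> carrier N \<Longrightarrow> equivariant A (regular A) (IM N) (\<lambda>v. an' N v n)"
  by (rule equivariantI) (simp_all add: N an_add_left induced_act(2)[OF N])

lemma diag_te_an:
  assumes x: "x \<in> carrier A" and n: "n \<in> carrier N"
  shows "diag (IM N) x (te (IM N) \<one> (an' N \<one> n)) = amap (IM N) (\<lambda>v. an' N v n) (\<gamma> x)"
proof -
  note I = left_module_induced[OF N]
  have "diag (IM N) x (te (IM N) \<one> (an' N \<one> n)) = amap (IM N) (\<lambda>v. v \<odot>\<^bsub>IM N\<^esub> an' N \<one> n) (\<gamma> x)"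
    using n by (intro diag_one[OF I x]) (simp add: N)
  also have "\<dots> = amap (IM N) (\<lambda>v. an' N v n) (\<gamma> x)"
    using x n by (intro amap_cong[OF left_module_regular_A I]) (simp_all add: N induced_act(2)[OF N])
  finally show ?thesis .
qed

text \<open>Exhibits the coaction as the adjunct of
  \<open>n \<mapsto> 1 \<otimes> (1 \<otimes> n)\<close>, so its \<open>A\<close>-linearity is that
  of adjuncts.\<close>

lemma induced_coaction_eq_adj:
  assumes z: "z \<in> carrier (AN A L t N)"
  shows "induced_coaction N z = adj (diag_module (IM N)) (\<lambda>n. te (IM N) \<one> (an' N \<one> n)) z"
proof -
  note I = left_module_induced[OF N]
  note h = adj_additive[OF N left_module_diag[OF I] equivariant_te_an] adj_tens[OF N left_module_diag[OF I] equivariant_te_an]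
  show ?thesis
    unfolding induced_coaction_def
    by (rule TN.lift_eq[OF _ abelian_T[OF I] _ z]) (use h in \<open>simp_all add: diag_te_an\<close>)
qed

lemma induced_coaction_tens:
  assumes x: "x \<in> carrier A" and n: "n \<in> carrier N"
  shows "induced_coaction N (an' N x n) = amap (IM N) (\<lambda>v. an' N v n) (\<gamma> x)"
    and "induced_coaction N (an' N x n) = diag (IM N) x (te (IM N) \<one> (an' N \<one> n))"
  using assms
  by (simp_all add: induced_coaction_eq_adj N
      adj_tens[OF N left_module_diag[OF left_module_induced[OF N]] equivariant_te_an] diag_te_an)

lemma equivariant_induced_coaction: "equivariant A (IM N) (diag_module (IM N)) (induced_coaction N)"
proof -
  note I = left_module_induced[OF N]
  note e = equivariant_adj[OF N left_module_diag[OF I] equivariant_te_an]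
  have "act_group A (IM N)"
    using left_module.act_closed[OF I] left_moduleD[OF I] by (simp add: act_group_def)
  then show ?thesis
    by (rule equivariant_cong[OF e]) (simp add: induced_coaction_eq_adj)
qed

text \<open>The induced module is generated by the images of the maps \<open>v \<mapsto> v \<otimes> n\<close> from the regular Hopf
  module, so it inherits the axioms from there.\<close>

lemma hopf_module_induced: "hopf_module (IM N) (induced_coaction N)"
proof -
  note I = left_module_induced[OF N]
  note e = equivariant_induced_coaction
  have a: "additive_on (AN A L t N) (T (IM N)) (induced_coaction N)"
    using equivariant_additive[OF e] by simp
  note im = hopf_module_image[OF hopf_module_regular I equivariant_an e]
  have counit: "counit (IM N) (induced_coaction N z) = z" if z: "z \<in> carrier (AN A L t N)" for z
  proof (rule TN.ext[OF additive_on_comp[OF a] _ TN.abelian _ z])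
    show "additive_on (T (IM N)) (AN A L t N) (counit (IM N))"
      using counit_additive_M[OF I] by simp
    fix x n assume "x \<in> carrier (rmul A t)" "n \<in> carrier N"
    then show "counit (IM N) (induced_coaction N (an' N x n)) = an' N x n"
      using im(1)[of n x] by (simp add: induced_coaction_tens(1))
  qed (simp_all add: additive_on_def)
  have "expand (IM N) (induced_coaction N z) =
      amap (diag_module (IM N)) (induced_coaction N) (induced_coaction N z)"
    if z: "z \<in> carrier (AN A L t N)" for z
  proof (rule TN.ext[OF additive_on_comp[OF a expand_additive[OF I]]
        additive_on_comp[OF a tmap_AM(1)[OF I left_module_diag[OF I] equivariant_scalars(1)[OF e]]] abelian_T[OF left_module_diag[OF I]] _ z])
    fix x n assume "x \<in> carrier (rmul A t)" "n \<in> carrier N"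
    then show "expand (IM N) (induced_coaction N (an' N x n)) =
        amap (diag_module (IM N)) (induced_coaction N) (induced_coaction N (an' N x n))"
      using im(2)[of n x] by (simp add: induced_coaction_tens(1))
  qed
  with counit show ?thesis
    using I e by (simp add: hopf_module_def)
qed

end

text \<open>The map \<open>\<^sup>LA \<otimes> M\<^sub>L \<rightarrow> A\<^sub>L \<otimes> \<^sub>LM\<close>, \<open>a \<otimes> m \<mapsto> a\<^sub>1 \<otimes> a\<^sub>2m\<close>.\<close>

definition galois :: "('a, 'm) module \<Rightarrow> ('a \<times> 'm \<Rightarrow>\<^sub>0 int) set \<Rightarrow> ('a \<times> 'm \<Rightarrow>\<^sub>0 int) set" where
  "galois M = adj (diag_module M) (te M \<one>)"

abbreviation "ANM M \<equiv> AN A L t (restrict_scalars M t)"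
abbreviation "anm M \<equiv> an A L t (restrict_scalars M t)"

lemma imap_additive:
  "\<lbrakk>right_module L N; right_module L N'; equivariant L N N' f\<rbrakk> \<Longrightarrow> additive_on (AN A L t N) (AN A L t N') (imap N' f)"
  and imap_tens:
  "\<lbrakk>right_module L N; right_module L N'; equivariant L N N' f; x \<in> carrier A; n \<in> carrier N\<rbrakk>
    \<Longrightarrow> imap N' f (an' N x n) = an' N' x (f n)"
  by (simp_all add: tmap_additive tmap_tens tensor_AN)

section \<open>The Galois map along the coaction and along \<open>1 \<otimes> -\<close>\<close>

context
  fixes M :: "('a, 'm) module"
  assumes M: "left_module A M"
begin

lemma galois_additive: "additive_on (ANM M) (T M) (galois M)"
  and galois_tens: "\<lbrakk>a \<in> carrier A; m \<in> carrier M\<rbrakk> \<Longrightarrow> galois M (anm M a m) = diag M a (te M \<one> m)"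
  unfolding galois_def
  using adj_additive[OF right_module_restrict_t[OF M] left_module_diag[OF M] equivariant_te_one[OF M]]
    adj_tens[OF right_module_restrict_t[OF M] left_module_diag[OF M] equivariant_te_one[OF M]]
  by simp_all

text \<open>Naturality of the Galois map for the \<open>A\<close>-linear map \<open>\<tau>\<close>:
  both sides send \<open>x \<otimes> m\<close> to \<open>x\<close> applied to
  \<open>1 \<otimes> \<tau> m\<close>.\<close>

lemma galois_imap:
  assumes \<tau>: "equivariant A M (diag_module M) \<tau>" and z: "z \<in> carrier (ANM M)"
  shows "galois (diag_module M) (imap (restrict_scalars (diag_module M) t) \<tau> z) = amap (diag_module M) \<tau> (galois M z)"
proof -
  note R = right_module_restrict_t[OF M] right_module_restrict_t[OF left_module_diag[OF M]]
  note i = imap_additive[OF R equivariant_scalars(2)[OF \<tau>]] imap_tens[OF R equivariant_scalars(2)[OF \<tau>]]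
  note a = tmap_AM[OF M left_module_diag[OF M] equivariant_scalars(1)[OF \<tau>]]
  show ?thesis
  proof (rule tensor_product.ext[OF tensor_AN[OF R(1)] additive_on_comp[OF i(1)] additive_on_comp[OF galois_additive a(1)]
        abelian_T[OF left_module_diag[OF M]] _ z])
    show "additive_on (ANM (diag_module M)) (T (diag_module M)) (galois (diag_module M))"
      using adj_additive[OF R(2) left_module_diag[OF left_module_diag[OF M]] equivariant_te_one[OF left_module_diag[OF M]]] by (simp add: galois_def)
    fix x m assume "x \<in> carrier (rmul A t)" "m \<in> carrier (restrict_scalars M t)"
    then have x: "x \<in> carrier A" and m: "m \<in> carrier M" by simp_all
    show "galois (diag_module M) (imap (restrict_scalars (diag_module M) t) \<tau> (anm M x m)) =
        amap (diag_module M) \<tau> (galois M (anm M x m))"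
      using adj_tens[OF R(2) left_module_diag[OF left_module_diag[OF M]] equivariant_te_one[OF left_module_diag[OF M]], of x "\<tau> m"]
        equivariant_act[OF equivariant_amap[OF M left_module_diag[OF M] \<tau>] x, where p = "te M \<one> m"] equivariant_closed[OF \<tau> m] x m
      by (simp add: galois_tens i a M galois_def[of "diag_module M"])
  qed
qed

lemma galois_imap_te:
  assumes z: "z \<in> carrier (ANM M)"
  shows "galois (diag_module M) (imap (restrict_scalars (diag_module M) t) (te M \<one>) z) = expand M (galois M z)"
proof -
  note R = right_module_restrict_t[OF M] right_module_restrict_t[OF left_module_diag[OF M]]
  note i = imap_additive[OF R equivariant_te_one[OF M]] imap_tens[OF R equivariant_te_one[OF M]]
  note H = hopf_module_regular
  show ?thesis
  proof (rule tensor_product.ext[OF tensor_AN[OF R(1)] additive_on_comp[OF i(1)]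
        additive_on_comp[OF galois_additive expand_additive[OF M]] abelian_T[OF left_module_diag[OF M]] _ z])
    show "additive_on (ANM (diag_module M)) (T (diag_module M)) (galois (diag_module M))"
      using adj_additive[OF R(2) left_module_diag[OF left_module_diag[OF M]] equivariant_te_one[OF left_module_diag[OF M]]] by (simp add: galois_def)
    fix x m assume "x \<in> carrier (rmul A t)" "m \<in> carrier (restrict_scalars M t)"
    then have x: "x \<in> carrier A" and m: "m \<in> carrier M" by simp_all
    \<comment> \<open>The map \<open>f\<close> is \<open>A\<close>-linear from the regular module;
      it carries the coassociativity of the coproduct over to \<open>M\<close>.\<close>
    define f where "f = (\<lambda>v. v \<odot>\<^bsub>M\<^esub> m)"
    have f: "equivariant A (regular A) M f" unfolding f_def by (rule equivariant_act_on(2)[OF M m]) simp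
    have fx: "diag M v (te M \<one> m) = amap M f (\<gamma> v)" if "v \<in> carrier A" for v
      unfolding f_def by (rule diag_one[OF M that m])
    have \<gamma>x: "\<gamma> x \<in> carrier (T (regular A))" using x by simp
    have "expand M (diag M x (te M \<one> m)) = amap (diag_module M) (amap M f) (expand (regular A) (\<gamma> x))"
      using expand_amap[OF left_module_regular_A M f \<gamma>x] by (simp add: fx x)
    also have "\<dots> = amap (diag_module M) (amap M f) (amap (diag_module (regular A)) \<gamma> (\<gamma> x))"
      using H x by (simp add: hopf_module_def)
    also have "\<dots> = amap (diag_module M) (\<lambda>v. amap M f (\<gamma> v)) (\<gamma> x)"
      by (rule amap_comp[OF left_module_regular_A left_module_diag[OF left_module_regular_A] left_module_diag[OF M]
          equivariant_scalars(1)[OF equivariant_coproduct]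
          equivariant_scalars(1)[OF equivariant_amap[OF left_module_regular_A M f]] \<gamma>x])
    also have "\<dots> = amap (diag_module M) (\<lambda>v. v \<odot>\<^bsub>diag_module M\<^esub> te M \<one> m) (\<gamma> x)"
      using m by (intro amap_cong[OF left_module_regular_A left_module_diag[OF M] _ _ \<gamma>x]) (simp_all add: fx[symmetric] M diag_closed)
    also have "\<dots> = diag (diag_module M) x (te (diag_module M) \<one> (te M \<one> m))"
      using m by (intro diag_one[OF left_module_diag[OF M] x, symmetric]) (simp add: M)
    finally show "galois (diag_module M) (imap (restrict_scalars (diag_module M) t) (te M \<one>) (anm M x m)) =
        expand M (galois M (anm M x m))"
      using adj_tens[OF R(2) left_module_diag[OF left_module_diag[OF M]] equivariant_te_one[OF left_module_diag[OF M]], of x "te M \<one> m"] x m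
      by (simp add: galois_tens i M galois_def[of "diag_module M"])
  qed
qed

end

section \<open>Coinvariants and the counit of the adjunction\<close>

lemma hopf_moduleD:
  assumes "hopf_module M \<tau>"
  shows "left_module A M" "equivariant A M (diag_module M) \<tau>"
    and "m \<in> carrier M \<Longrightarrow> counit M (\<tau> m) = m"
    and "m \<in> carrier M \<Longrightarrow> expand M (\<tau> m) = amap (diag_module M) \<tau> (\<tau> m)"
  using assms by (simp_all add: hopf_module_def)

text \<open>The two right \<open>L\<close>-actions agree on the carrier, where both act on the
  factor \<open>M\<close>, but as functions they may differ off it. Tensor products depend only on
  the values on carriers, so their equality still holds literally.\<close>

lemma AM_right_cong:
  assumes M: "left_module A M"
  shows "AN A L t (AM_right A L s t M) = ANM (diag_module M)"
    and "imap (AM_right A L s t M) = imap (restrict_scalars (diag_module M) t)"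
proof -
  have eq: "pres_lift (T M) (\<lambda>(x, m). te M x (t l \<odot>\<^bsub>M\<^esub> m)) z = diag M (t l) z"
    if "l \<in> carrier L" "z \<in> carrier (T M)" for l z
    by (rule tensor_product.lift_eq[OF tensor_AM[OF M] diag_additive[OF M] abelian_T[OF M] _ that(2)])
      (simp_all add: diag_t M that)
  show "AN A L t (AM_right A L s t M) = ANM (diag_module M)"
    "imap (AM_right A L s t M) = imap (restrict_scalars (diag_module M) t)"
    by (rule tensor_cong; simp add: AM_right_def eq)+
qed

lemma coinv_carrier: "carrier (coinv A L s t (M, \<tau>)) = {m \<in> carrier M. \<tau> m = te M \<one> m}"
  and coinv_simps [simp]: "add (coinv A L s t (M, \<tau>)) = add M" "\<zero>\<^bsub>coinv A L s t (M, \<tau>)\<^esub> = \<zero>\<^bsub>M\<^esub>"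
    "l \<odot>\<^bsub>coinv A L s t (M, \<tau>)\<^esub> m = t l \<odot>\<^bsub>M\<^esub> m"
  by (simp_all add: coinv_def)

context
  fixes M :: "('a, 'm) module" and \<tau>
  assumes H: "hopf_module M \<tau>"
begin

private lemmas M = hopf_moduleD(1)[OF H] and \<tau> = hopf_moduleD(2)[OF H]

interpretation M: left_module A M by (rule M)

abbreviation "Coinv \<equiv> coinv A L s t (M, \<tau>)"

text \<open>The coinvariants are the equaliser of two right \<open>L\<close>-linear maps,
  \<open>\<tau>\<close> and \<open>1 \<otimes> -\<close>, into the diagonal module.\<close>

lemma right_module_coinv: "right_module L Coinv"
proof -
  have t: "equivariant L (restrict_scalars M t) (restrict_scalars (diag_module M) t) \<tau>"
    by (rule equivariant_scalars(2)[OF \<tau>])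
  note e = equivariant_te_one[OF M]
  note ab = left_moduleD(2)[OF M] abelian_T[OF M]
  have z: "\<tau> \<zero>\<^bsub>M\<^esub> = te M \<one> \<zero>\<^bsub>M\<^esub>"
    using additive_on_zero[OF equivariant_additive[OF \<tau>]] additive_on_zero[of M "T M" "te M \<one>"]
      equivariant_additive[OF e] ab left_moduleD(2)[OF left_module_diag[OF M]]
    by (simp add: additive_on_def)
  have u: "\<tau> (\<ominus>\<^bsub>M\<^esub> m) = te M \<one> (\<ominus>\<^bsub>M\<^esub> m)" if "m \<in> carrier M" "\<tau> m = te M \<one> m" for m
    using additive_on_uminus[of M "T M" \<tau> m] additive_on_uminus[of M "T M" "te M \<one>" m]
      equivariant_additive[OF e] equivariant_additive[OF \<tau>] ab that
    by (simp add: additive_on_def)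
  have um: "\<ominus>\<^bsub>restrict_scalars M t\<^esub> m = \<ominus>\<^bsub>M\<^esub> m" for m
    by (simp add: restrict_scalars_def a_inv_def m_inv_def)
  show ?thesis
    unfolding coinv_def prod.case
    by (rule right_module_submodule[OF right_module_restrict_t[OF M]])
      (use equivariant_add[OF t] equivariant_act[OF t] equivariant_add[OF e] equivariant_act[OF e] M.act_closed
        in \<open>auto simp: z um u\<close>)
qed

lemma equivariant_coinv_incl: "equivariant L Coinv (restrict_scalars M t) (\<lambda>m. m)"
  by (rule equivariantI) (simp_all add: coinv_carrier)

lemma equivariant_coinv_difference:
  "equivariant L (restrict_scalars M t) (restrict_scalars (diag_module M) t) (\<lambda>m. \<tau> m \<ominus>\<^bsub>T M\<^esub> te M \<one> m)"
proof (rule equivariantI)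
  let ?D = "restrict_scalars (diag_module M) t"
  note e = equivariant_scalars(2)[OF \<tau>] equivariant_te_one[OF M]
  have ad: "abelian_group (T M)" by (rule abelian_T[OF M])
  interpret TM: abelian_group "T M" by (rule ad)
  note c = equivariant_closed[OF \<tau>] M
  show "\<tau> (b \<odot>\<^bsub>restrict_scalars M t\<^esub> p) \<ominus>\<^bsub>T M\<^esub> te M \<one> (b \<odot>\<^bsub>restrict_scalars M t\<^esub> p) =
      b \<odot>\<^bsub>?D\<^esub> (\<tau> p \<ominus>\<^bsub>T M\<^esub> te M \<one> p)"
    if b: "b \<in> carrier L" and p: "p \<in> carrier (restrict_scalars M t)" for b p
    using equivariant_act[OF e(1) b p] equivariant_act[OF e(2) b p] c p b
      additive_on_minus[OF diag_additive[OF M, of "t b"] ad ad, of "\<tau> p" "te M \<one> p"]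
    by simp
  show "\<tau> p \<ominus>\<^bsub>T M\<^esub> te M \<one> p \<in> carrier ?D" if "p \<in> carrier (restrict_scalars M t)" for p
    using c that by simp
  show "\<tau> (p \<oplus>\<^bsub>restrict_scalars M t\<^esub> p') \<ominus>\<^bsub>T M\<^esub> te M \<one> (p \<oplus>\<^bsub>restrict_scalars M t\<^esub> p') =
      \<tau> p \<ominus>\<^bsub>T M\<^esub> te M \<one> p \<oplus>\<^bsub>?D\<^esub> (\<tau> p' \<ominus>\<^bsub>T M\<^esub> te M \<one> p')"
    if "p \<in> carrier (restrict_scalars M t)" "p' \<in> carrier (restrict_scalars M t)" for p p'
    using equivariant_add[OF e(1) that] equivariant_add[OF e(2) that] c that
    by (simp add: a_minus_def[of "T M"] TM.minus_add TM.a_ac)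
qed

definition ev :: "('a \<times> 'm \<Rightarrow>\<^sub>0 int) set \<Rightarrow> 'm" where
  "ev = adj M (\<lambda>m. m)"

lemma ev_additive: "additive_on (AN A L t Coinv) M ev"
  and ev_tens: "\<lbrakk>a \<in> carrier A; m \<in> carrier Coinv\<rbrakk> \<Longrightarrow> ev (an' Coinv a m) = a \<odot>\<^bsub>M\<^esub> m"
  and equivariant_ev: "equivariant A (IM Coinv) M ev"
  unfolding ev_def
  using adj_additive[OF right_module_coinv M equivariant_coinv_incl]
    adj_tens[OF right_module_coinv M equivariant_coinv_incl]
    equivariant_adj[OF right_module_coinv M equivariant_coinv_incl] by simp_all

text \<open>For coinvariant \<open>m\<close>, \<open>A\<close>-linearity of the coaction gives
  \<open>\<tau> (x \<cdot> m)\<close> as \<open>x\<close> applied to \<open>1 \<otimes> m\<close>,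
  which is also the image of \<open>x \<otimes> m\<close> under the Galois map.\<close>

lemma galois_incl:
  assumes w: "w \<in> carrier (AN A L t Coinv)"
  shows "galois M (imap (restrict_scalars M t) (\<lambda>m. m) w) = \<tau> (ev w)"
proof -
  note R = right_module_coinv right_module_restrict_t[OF M]
  note i = imap_additive[OF R equivariant_coinv_incl] imap_tens[OF R equivariant_coinv_incl]
  have "additive_on M (T M) \<tau>" using equivariant_additive[OF \<tau>] by simp
  note \<tau>a = additive_on_comp[OF ev_additive this]
  show ?thesis
  proof (rule tensor_product.ext[OF tensor_AN[OF R(1)] additive_on_comp[OF i(1) galois_additive[OF M]] \<tau>a abelian_T[OF M] _ w])
    fix x m assume "x \<in> carrier (rmul A t)" "m \<in> carrier Coinv"
    then have x: "x \<in> carrier A" and m: "m \<in> carrier Coinv" "m \<in> carrier M" "\<tau> m = te M \<one> m"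
      by (simp_all add: coinv_carrier)
    show "galois M (imap (restrict_scalars M t) (\<lambda>m. m) (an' Coinv x m)) = \<tau> (ev (an' Coinv x m))"
      using x m equivariant_act[OF \<tau> x] by (simp add: i galois_tens[OF M] ev_tens)
  qed
qed

lemma bij_betw_ev:
  assumes gal: "bij_betw (galois M) (carrier (ANM M)) (carrier (T M))"
    and gal': "inj_on (galois (diag_module M)) (carrier (ANM (diag_module M)))"
    and pres: "coinv_kernel_preserved A L s t (M, \<tau>)"
  shows "bij_betw ev (carrier (AN A L t Coinv)) (carrier M)"
proof (rule bij_betw_imageI)
  note R = right_module_coinv right_module_restrict_t[OF M] right_module_restrict_t[OF left_module_diag[OF M]]
  let ?D = "restrict_scalars (diag_module M) t"
  let ?i = "imap (restrict_scalars M t) (\<lambda>m. m)"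
  let ?\<delta> = "\<lambda>m. \<tau> m \<ominus>\<^bsub>T M\<^esub> te M \<one> m"
  have pres': "bij_betw ?i (carrier (AN A L t Coinv))
      {z \<in> carrier (ANM M). imap ?D ?\<delta> z = \<zero>\<^bsub>ANM (diag_module M)\<^esub>}"
    using pres unfolding coinv_kernel_preserved_def prod.case induced_map_eq_tmap AM_right_cong[OF M] .
  have gi: "inj_on (galois M) (carrier (ANM M))" using gal by (rule bij_betw_imp_inj_on)
  show "inj_on ev (carrier (AN A L t Coinv))"
  proof (rule inj_onI)
    fix w w' assume w: "w \<in> carrier (AN A L t Coinv)" "w' \<in> carrier (AN A L t Coinv)" "ev w = ev w'"
    \<comment> \<open>By \<open>galois_incl\<close>, the composite of the canonical map with the
      Galois map factors through \<open>ev\<close>; both of these maps are injective, hence so is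
      \<open>ev\<close>.\<close>
    then have "galois M (?i w) = galois M (?i w')" by (simp add: galois_incl)
    moreover have "?i w \<in> carrier (ANM M)" "?i w' \<in> carrier (ANM M)"
      using w bij_betwE[OF pres'] by auto
    ultimately show "w = w'"
      using gi w bij_betw_imp_inj_on[OF pres'] by (metis inj_on_eq_iff)
  qed
  have "m \<in> ev ` carrier (AN A L t Coinv)" if m: "m \<in> carrier M" for m
  proof -
    have \<tau>m: "\<tau> m \<in> carrier (T M)" using equivariant_closed[OF \<tau> m] by simp
    then have "\<tau> m \<in> galois M ` carrier (ANM M)"
      using gal by (simp add: bij_betw_def)
    then obtain z where z: "z \<in> carrier (ANM M)" "galois M z = \<tau> m"
      by (elim imageE) simp
    note e = equivariant_scalars(2)[OF \<tau>] equivariant_te_one[OF M]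
    have em: "equivariant L (restrict_scalars M t) ?D (\<lambda>m. \<tau> m \<ominus>\<^bsub>?D\<^esub> te M \<one> m)"
      using equivariant_coinv_difference by simp
    have "imap ?D (\<lambda>m. \<tau> m \<ominus>\<^bsub>?D\<^esub> te M \<one> m) z = imap ?D \<tau> z \<ominus>\<^bsub>ANM (diag_module M)\<^esub> imap ?D (te M \<one>) z"
      by (rule tmap_minus[OF tensor_AN[OF R(2)] tensor_AN[OF R(3)] e em z(1)])
    moreover have "imap ?D \<tau> z = imap ?D (te M \<one>) z"
    proof (rule inj_onD[OF gal'])
      show "galois (diag_module M) (imap ?D \<tau> z) = galois (diag_module M) (imap ?D (te M \<one>) z)"
        using galois_imap[OF M \<tau> z(1)] galois_imap_te[OF M z(1)] z(2) hopf_moduleD(4)[OF H m] by simp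
    qed (use z(1) in \<open>auto intro: additive_on_closed[OF imap_additive[OF R(2,3) e(1)]]
        additive_on_closed[OF imap_additive[OF R(2,3) e(2)]]\<close>)
    moreover have "imap ?D (te M \<one>) z \<in> carrier (ANM (diag_module M))"
      using z(1) by (rule additive_on_closed[OF imap_additive[OF R(2,3) e(2)]])
    ultimately have "imap ?D ?\<delta> z = \<zero>\<^bsub>ANM (diag_module M)\<^esub>"
      using tensor_product.abelian[OF tensor_AN[OF R(3)]]
      by (simp add: a_minus_def[of "ANM (diag_module M)"] abelian_group.r_neg)
    then have "z \<in> ?i ` carrier (AN A L t Coinv)"
      using pres' z(1) by (simp add: bij_betw_def)
    then obtain w where w: "w \<in> carrier (AN A L t Coinv)" "?i w = z"
      by (elim imageE) simp
    \<comment> \<open>Injectivity of \<open>\<tau>\<close> enters in this form: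
      \<open>counit M\<close> is a left inverse of it.\<close>
    have "m = counit M (\<tau> m)" using hopf_moduleD(3)[OF H m] ..
    also have "\<tau> m = \<tau> (ev w)" using galois_incl[OF w(1)] unfolding w(2) z(2) .
    also have "counit M (\<tau> (ev w)) = ev w"
      by (rule hopf_moduleD(3)[OF H additive_on_closed[OF ev_additive w(1)]])
    finally show ?thesis using w(1) by (rule image_eqI)
  qed
  then show "ev ` carrier (AN A L t Coinv) = carrier M"
    using additive_on_closed[OF ev_additive] by blast
qed

end

text \<open>The map \<open>\<chi>\<close> below is \<open>\<pi>\<^sub>L \<circ> S\<close>; it induces the retraction \<open>a \<otimes> n \<mapsto> n \<cdot> \<chi> a\<close> of the unit
  \<open>n \<mapsto> 1 \<otimes> n\<close>.\<close>

lemma unit_bij_betw: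
  fixes N :: "('b, 'n) module"
  assumes N: "right_module L N"
    and \<chi>: "additive_on A L \<chi>" "\<And>a l. \<lbrakk>a \<in> carrier A; l \<in> carrier L\<rbrakk> \<Longrightarrow> \<chi> (a \<otimes> t l) = l \<otimes>\<^bsub>L\<^esub> \<chi> a"
      "\<chi> \<one> = \<one>\<^bsub>L\<^esub>"
    and gal: "inj_on (galois (IM N)) (carrier (ANM (IM N)))"
  shows "bij_betw (an' N \<one>) (carrier N) (carrier (coinv A L s t (IM N, induced_coaction N)))"
proof -
  note I = left_module_induced[OF N] and RI = right_module_restrict_t[OF left_module_induced[OF N]]
  have \<chi>c: "\<chi> a \<in> carrier L" if "a \<in> carrier A" for a using \<chi>(1) that by (rule additive_on_closed)
  \<comment> \<open>Stated for every right \<open>L\<close>-module, because the retraction is taken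
    both for \<open>N\<close> and for the induced module, whose carrier has another type.\<close>
  have lift: "additive_on (AN A L t Q) Q (pres_lift Q (\<lambda>(a, q). \<chi> a \<odot>\<^bsub>Q\<^esub> q))"
    "\<lbrakk>a \<in> carrier A; q \<in> carrier Q\<rbrakk> \<Longrightarrow> pres_lift Q (\<lambda>(a, q). \<chi> a \<odot>\<^bsub>Q\<^esub> q) (an' Q a q) = \<chi> a \<odot>\<^bsub>Q\<^esub> q"
    if Q: "right_module L Q" for Q :: "('b, 'q) module" and a q
  proof -
    have aQ: "act_group L Q" by (rule act_group_right_module[OF Q])
    have b: "balanced L (rmul A t) Q Q (\<lambda>a q. \<chi> a \<odot>\<^bsub>Q\<^esub> q)"
      using aQ by (intro balancedI additive_onI)
        (auto simp: act_group_def \<chi>c \<chi>(2) right_module_add[OF Q] right_module_mult[OF Q] additive_on_add[OF \<chi>(1)])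
    have "abelian_group Q" using aQ by (simp add: act_group_def)
    then show "additive_on (AN A L t Q) Q (pres_lift Q (\<lambda>(a, q). \<chi> a \<odot>\<^bsub>Q\<^esub> q))"
      "\<lbrakk>a \<in> carrier A; q \<in> carrier Q\<rbrakk> \<Longrightarrow> pres_lift Q (\<lambda>(a, q). \<chi> a \<odot>\<^bsub>Q\<^esub> q) (an' Q a q) = \<chi> a \<odot>\<^bsub>Q\<^esub> q"
      using tensor_product.lift_additive[OF tensor_AN[OF Q] b] by simp_all
  qed
  define \<epsilon> where "\<epsilon> = pres_lift N (\<lambda>(a, q). \<chi> a \<odot>\<^bsub>N\<^esub> q)"
  define \<epsilon>' where "\<epsilon>' = pres_lift (restrict_scalars (IM N) t) (\<lambda>(a, q). \<chi> a \<odot>\<^bsub>restrict_scalars (IM N) t\<^esub> q)"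
  note \<epsilon> = lift[OF N, folded \<epsilon>_def] and \<epsilon>' = lift[OF RI, folded \<epsilon>'_def]
  have \<epsilon>'a: "additive_on (ANM (IM N)) (AN A L t N) \<epsilon>'"
    using \<epsilon>'(1) by (simp add: additive_on_def)
  note e = equivariant_an_one[OF N]
  note i = imap_additive[OF N RI e] imap_tens[OF N RI e]
  note TN = tensor_AN[OF N]
  have ret: "\<epsilon> (an' N \<one> n) = n" if "n \<in> carrier N" for n
    using that by (simp add: \<epsilon>(2) \<chi>(3) right_module_one[OF N])
  have an1: "additive_on N (AN A L t N) (an' N \<one>)"
    using equivariant_additive[OF e] by (simp add: additive_on_def)
  have recover: "an' N \<one> (\<epsilon> z) = z"
    if z: "z \<in> carrier (AN A L t N)" and co: "induced_coaction N z = te (IM N) \<one> z" for z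
  proof -
    \<comment> \<open>For every \<open>z\<close>, coinvariant or not, the preimage of the coaction
      under the Galois map is explicit: it is the image of \<open>z\<close> under
      \<open>\<^sup>LA \<otimes> -\<close> applied to the unit. For coinvariant \<open>z\<close> it
      is also \<open>1 \<otimes> z\<close>, and injectivity identifies the two.\<close>
    have g: "galois (IM N) (imap (restrict_scalars (IM N) t) (an' N \<one>) z) = induced_coaction N z"
      using equivariant_additive[OF equivariant_induced_coaction[OF N]]
      by (intro tensor_product.ext[OF TN additive_on_comp[OF i(1) galois_additive[OF I]] _ abelian_T[OF I] _ z])
        (simp_all add: i(2) galois_tens[OF I] N induced_coaction_tens(2)[OF N])
    have "diag (IM N) \<one> (te (IM N) \<one> z) = te (IM N) \<one> z"
      using left_module.act_one[OF left_module_diag[OF I], of "te (IM N) \<one> z"] z I by simp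
    then have g': "galois (IM N) (anm (IM N) \<one> z) = te (IM N) \<one> z"
      using z by (simp add: galois_tens[OF I])
    have zi: "imap (restrict_scalars (IM N) t) (an' N \<one>) z = anm (IM N) \<one> z"
      using inj_onD[OF gal, of "imap (restrict_scalars (IM N) t) (an' N \<one>) z" "anm (IM N) \<one> z"] g g' co
        additive_on_closed[OF i(1) z] an_closed[OF RI, of \<one> z] z by simp
    have "\<epsilon>' (anm (IM N) \<one> z) = z"
      using \<epsilon>'(2)[of \<one> z] z left_module.act_one[OF I] by (simp add: \<chi>(3))
    \<comment> \<open>Naturality of the retraction with respect to the unit: \<open>\<chi> x\<close>
      acts on \<open>1 \<otimes> n\<close> through \<open>t\<close>, and
      \<open>t (\<chi> x) \<otimes> n\<close> equals
      \<open>1 \<otimes> n \<cdot> \<chi> x\<close>.\<close>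
    moreover have "\<epsilon>' (imap (restrict_scalars (IM N) t) (an' N \<one>) z) = an' N \<one> (\<epsilon> z)"
    proof (rule tensor_product.ext[OF TN additive_on_comp[OF i(1) \<epsilon>'a] additive_on_comp[OF \<epsilon>(1) an1]
          tensor_product.abelian[OF TN] _ z])
      fix x n assume "x \<in> carrier (rmul A t)" "n \<in> carrier N"
      then have x: "x \<in> carrier A" and n: "n \<in> carrier N" by simp_all
      show "\<epsilon>' (imap (restrict_scalars (IM N) t) (an' N \<one>) (an' N x n)) = an' N \<one> (\<epsilon> (an' N x n))"
        using x n \<epsilon>'(2)[of x "an' N \<one> n"] by (simp add: i(2) N \<epsilon>(2) induced_act(2)[OF N] \<chi>c an_one_t)
    qed
    ultimately show ?thesis using zi by simp
  qed
  have co: "induced_coaction N (an' N \<one> n) = te (IM N) \<one> (an' N \<one> n)" if n: "n \<in> carrier N" for n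
    using left_module.act_one[OF left_module_diag[OF I], of "te (IM N) \<one> (an' N \<one> n)"] n I
    by (simp add: induced_coaction_tens(2)[OF N] N)
  have \<epsilon>c: "\<epsilon> z \<in> carrier N" if "z \<in> carrier (AN A L t N)" for z
    using \<epsilon>(1) that by (rule additive_on_closed)
  show ?thesis
  proof (rule bij_betwI[where g = \<epsilon>])
    show "an' N \<one> \<in> carrier N \<rightarrow> carrier (coinv A L s t (IM N, induced_coaction N))"
      by (simp add: coinv_carrier co N)
    show "\<epsilon> \<in> carrier (coinv A L s t (IM N, induced_coaction N)) \<rightarrow> carrier N"
      by (simp add: coinv_carrier \<epsilon>c)
  qed (simp_all add: ret recover coinv_carrier)
qed

end

section \<open>The Galois map of a Hopf algebroid\<close>

lemma opp_simps [simp]: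
  "carrier (opp A) = carrier A" "x \<otimes>\<^bsub>opp A\<^esub> y = y \<otimes>\<^bsub>A\<^esub> x" "\<one>\<^bsub>opp A\<^esub> = \<one>\<^bsub>A\<^esub>"
  by (simp_all add: opp_def)

lemma opp_ring_simps [simp]:
  fixes A :: "('k, 'a) module"
  shows "add (opp A) = add A" "\<zero>\<^bsub>opp A\<^esub> = \<zero>\<^bsub>A\<^esub>"
  by (simp_all add: opp_def)

lemma lmul_opp: "lmul (opp (A :: ('k, 'a) module)) f = rmul A f"
  by (simp add: lmul_def rmul_def with_action_def)

lemma pres_lift_opp: "pres_lift (opp (A :: ('k, 'a) module)) f = pres_lift A f"
  by (rule pres_lift_group_cong) simp_all

lemma balanced_flip: "balanced B P Q G f \<Longrightarrow> balanced B Q P G (\<lambda>q p. f p q)"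
  by (auto simp: balanced_def biadditive_def)

lemma balanced3_fix:
  assumes "balanced3 B C P Q Q' U G f"
  shows "u \<in> carrier U \<Longrightarrow> balanced B P Q G (\<lambda>p q. f p q u)"
    and "\<lbrakk>p \<in> carrier P; carrier Q' = carrier Q; add Q' = add Q\<rbrakk> \<Longrightarrow> balanced C Q' U G (f p)"
  using assms by (auto simp: balanced3_def balanced_def biadditive_def additive_on_def)

text \<open>The functions \<open>f\<close> and \<open>g\<close> describe the action on \<open>\<gamma> a = a\<^sub>1 \<otimes> a\<^sub>2\<close>: \<open>\<gamma> (c \<cdot> a) = f\<^sub>c a\<^sub>1 \<otimes> g\<^sub>c a\<^sub>2\<close>.\<close>

lemma sweedler_balanced:
  assumes T: "tensor_product B P Q" and G: "abelian_group G" and \<gamma>: "additive_on P' (tensor B P Q) \<gamma>"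
    and F: "\<And>u. u \<in> carrier U \<Longrightarrow> balanced B P Q G (\<lambda>x y. F x y u)"
    and Fu: "\<And>x y. \<lbrakk>x \<in> carrier P; y \<in> carrier Q\<rbrakk> \<Longrightarrow> additive_on U G (F x y)"
    and act: "\<And>c a. \<lbrakk>c \<in> carrier C; a \<in> carrier P'\<rbrakk> \<Longrightarrow> \<gamma> (c \<odot>\<^bsub>P'\<^esub> a) =
        pres_lift (tensor B P Q) (\<lambda>(x, y). tens B P Q (f c x) (g c y)) (\<gamma> a)"
    and fg: "\<And>c. c \<in> carrier C \<Longrightarrow> equivariant B P P (f c)" "\<And>c. c \<in> carrier C \<Longrightarrow> equivariant B Q Q (g c)"
    and mid: "\<And>c x y u. \<lbrakk>c \<in> carrier C; x \<in> carrier P; y \<in> carrier Q; u \<in> carrier U\<rbrakk>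
        \<Longrightarrow> F (f c x) (g c y) u = F x y (c \<odot>\<^bsub>U\<^esub> u)"
    and U: "act_group C U"
  shows "balanced C P' U G (\<lambda>a u. pres_lift G (\<lambda>(x, y). F x y u) (\<gamma> a))"
proof (rule balancedI)
  interpret T: tensor_product B P Q by (rule T)
  interpret U: abelian_group U using U by (simp add: act_group_def)
  note \<gamma>c = additive_on_closed[OF \<gamma>]
  fix a assume a: "a \<in> carrier P'"
  show "additive_on U G (\<lambda>u. pres_lift G (\<lambda>(x, y). F x y u) (\<gamma> a))"
    using a
    by (intro additive_onI T.lift_closed[OF F G] T.lift_add[OF F F G])
      (simp_all add: \<gamma>c additive_on_add[OF Fu])
next
  interpret T: tensor_product B P Q by (rule T)
  fix u assume "u \<in> carrier U"
  then show "additive_on P' G (\<lambda>a. pres_lift G (\<lambda>(x, y). F x y u) (\<gamma> a))"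
    by (rule additive_on_comp[OF \<gamma> T.lift_additive(1)[OF F G]])
next
  interpret T: tensor_product B P Q by (rule T)
  fix c a u assume c: "c \<in> carrier C" and a: "a \<in> carrier P'" and u: "u \<in> carrier U"
  note l = T.lift_additive[OF F[OF u] G]
  have cu: "c \<odot>\<^bsub>U\<^esub> u \<in> carrier U" using U c u by (simp add: act_group_def)
  have "pres_lift G (\<lambda>(x, y). F x y u) (\<gamma> (c \<odot>\<^bsub>P'\<^esub> a)) =
      pres_lift G (\<lambda>(x, y). pres_lift G (\<lambda>(x, y). F x y u) (tens B P Q (f c x) (g c y))) (\<gamma> a)"
    unfolding act[OF c a]
    by (rule T.lift_hom[OF tens_map_balanced[OF fg(1)[OF c] fg(2)[OF c] T] l(1) T.abelian G additive_on_closed[OF \<gamma> a]])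
  also have "\<dots> = pres_lift G (\<lambda>(x, y). F x y (c \<odot>\<^bsub>U\<^esub> u)) (\<gamma> a)"
    using c u cu
    by (intro T.lift_cong G additive_on_closed[OF \<gamma> a])
      (simp_all add: l(2) equivariant_closed[OF fg(1)] equivariant_closed[OF fg(2)] mid additive_on_closed[OF Fu])
  finally show "pres_lift G (\<lambda>(x, y). F x y u) (\<gamma> (c \<odot>\<^bsub>P'\<^esub> a)) = pres_lift G (\<lambda>(x, y). F x y (c \<odot>\<^bsub>U\<^esub> u)) (\<gamma> a)" .
qed

text \<open>Moves an additive map inside a twofold Sweedler sum. The two sides of mixed
  coassociativity expand different legs of the outer coproduct; this version serves the left leg,
  the next one the right leg.\<close>

lemma sweedler_lift_hom:
  assumes T: "tensor_product B P Q" "tensor_product C P' U" and GH: "abelian_group G" "abelian_group H"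
    and \<gamma>: "\<And>a. a \<in> carrier P' \<Longrightarrow> \<gamma> a \<in> carrier (tensor B P Q)"
    and F: "\<And>u. u \<in> carrier U \<Longrightarrow> balanced B P Q G (\<lambda>x y. F x y u)"
    and b: "balanced C P' U G (\<lambda>a u. pres_lift G (\<lambda>(x, y). F x y u) (\<gamma> a))"
    and h: "additive_on G H h" and z: "z \<in> carrier (tensor C P' U)"
  shows "h (pres_lift G (\<lambda>(a, u). pres_lift G (\<lambda>(x, y). F x y u) (\<gamma> a)) z) =
    pres_lift H (\<lambda>(a, u). pres_lift H (\<lambda>(x, y). h (F x y u)) (\<gamma> a)) z"
proof -
  interpret T: tensor_product B P Q by (rule T)
  interpret T': tensor_product C P' U by (rule T)
  have "h (pres_lift G (\<lambda>(a, u). pres_lift G (\<lambda>(x, y). F x y u) (\<gamma> a)) z) =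
      pres_lift H (\<lambda>(a, u). h (pres_lift G (\<lambda>(x, y). F x y u) (\<gamma> a))) z"
    by (rule T'.lift_hom[OF b h GH z])
  also have "\<dots> = pres_lift H (\<lambda>(a, u). pres_lift H (\<lambda>(x, y). h (F x y u)) (\<gamma> a)) z"
    by (intro T'.lift_cong T.lift_hom[OF F h GH] T.lift_closed[OF balanced_comp[OF F h] GH(2)] GH \<gamma> z)
  finally show ?thesis .
qed

lemma sweedler_lift_hom':
  assumes T: "tensor_product B P Q" "tensor_product C U P'" and GH: "abelian_group G" "abelian_group H"
    and \<gamma>: "\<And>a. a \<in> carrier P' \<Longrightarrow> \<gamma> a \<in> carrier (tensor B P Q)"
    and F: "\<And>u. u \<in> carrier U \<Longrightarrow> balanced B P Q G (F u)"
    and b: "balanced C U P' G (\<lambda>u a. pres_lift G (\<lambda>(x, y). F u x y) (\<gamma> a))"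
    and h: "additive_on G H h" and z: "z \<in> carrier (tensor C U P')"
  shows "h (pres_lift G (\<lambda>(u, a). pres_lift G (\<lambda>(x, y). F u x y) (\<gamma> a)) z) =
    pres_lift H (\<lambda>(u, a). pres_lift H (\<lambda>(x, y). h (F u x y)) (\<gamma> a)) z"
proof -
  interpret T: tensor_product B P Q by (rule T)
  interpret T': tensor_product C U P' by (rule T)
  have "h (pres_lift G (\<lambda>(u, a). pres_lift G (\<lambda>(x, y). F u x y) (\<gamma> a)) z) =
      pres_lift H (\<lambda>(u, a). h (pres_lift G (\<lambda>(x, y). F u x y) (\<gamma> a))) z"
    by (rule T'.lift_hom[OF b h GH z])
  also have "\<dots> = pres_lift H (\<lambda>(u, a). pres_lift H (\<lambda>(x, y). h (F u x y)) (\<gamma> a)) z"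
    by (intro T'.lift_cong T.lift_hom[OF F h GH] T.lift_closed[OF balanced_comp[OF F h] GH(2)] GH \<gamma> z)
  finally show ?thesis .
qed

text \<open>The bimodule axiom concerns multiplication from the left; multiplication from the right
  follows from multiplicativity and the value of the coproduct at \<open>s l\<close>. Read in the
  opposite algebra, it describes how the right coproduct reacts to multiplication from the
  left.\<close>

lemma (in left_bialgebroid) coproduct_mult_s:
  assumes a: "a \<in> carrier A" and l: "l \<in> carrier L"
  shows "\<gamma> (a \<otimes> s l) = pres_lift (AA A L s t) (\<lambda>(u, v). aa A L s t (u \<otimes> s l) v) (\<gamma> a)"
proof -
  interpret A: ring A by (rule ring_A)
  interpret AA: tensor_product L "lmul A t" "lmul A s" by (rule tensor_AA)
  note R = left_module_regular_A
  have "\<gamma> (a \<otimes> s l) = spread (regular A) (s l) \<one> (\<gamma> a)"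
    using a l coproduct_mult_diag[of a "s l"] diag_tens[OF R a, of "s l" \<one>] by (simp add: coproduct_s)
  also have "\<dots> = pres_lift (AA A L s t) (\<lambda>(u, v). aa A L s t (u \<otimes> s l) v) (\<gamma> a)"
    unfolding spread_def restrict_scalars_regular
    using a l by (intro AA.lift_cong AA.abelian) (simp_all add: AA.tens_closed)
  finally show ?thesis .
qed

lemma (in left_bialgebroid) coproduct_mult_t:
  assumes a: "a \<in> carrier A" and l: "l \<in> carrier L"
  shows "\<gamma> (a \<otimes> t l) = pres_lift (AA A L s t) (\<lambda>(u, v). aa A L s t u (v \<otimes> t l)) (\<gamma> a)"
proof -
  interpret A: ring A by (rule ring_A)
  interpret AA: tensor_product L "lmul A t" "lmul A s" by (rule tensor_AA)
  note R = left_module_regular_A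
  have "\<gamma> (a \<otimes> t l) = spread (regular A) \<one> (t l) (\<gamma> a)"
    using a l coproduct_mult_diag[of a "t l"] diag_tens[OF R a, of \<one> "t l"] by (simp add: coproduct_t)
  also have "\<dots> = pres_lift (AA A L s t) (\<lambda>(u, v). aa A L s t u (v \<otimes> t l)) (\<gamma> a)"
    unfolding spread_def restrict_scalars_regular
    using a l by (intro AA.lift_cong AA.abelian) (simp_all add: AA.tens_closed)
  finally show ?thesis .
qed

section \<open>Both coproducts and the antipode in Sweedler notation\<close>

context hopf_algebroid
begin

interpretation l: left_bialgebroid K A L sL tL \<gamma>L \<pi>L by (rule left)
text \<open>Opens all facts on left bialgebroids to the right bialgebroid, on the opposite algebra
  with source \<open>tR\<close> and target \<open>sR\<close>; \<open>lmul_opp\<close> translates the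
  module structures back.\<close>

interpretation r: left_bialgebroid K "opp A" R tR sR \<gamma>R \<pi>R
  using right by (simp add: right_bialgebroid_def)
interpretation A: ring A by (rule l.ring_A)

lemma sR_closed [simp]: "x \<in> carrier R \<Longrightarrow> sR x \<in> carrier A"
  and tR_closed [simp]: "x \<in> carrier R \<Longrightarrow> tR x \<in> carrier A"
  and \<pi>R_closed [simp]: "a \<in> carrier A \<Longrightarrow> \<pi>R a \<in> carrier R"
  using r.t_closed[of x] r.s_closed[of x] r.\<pi>_closed[of a] by simp_all

lemma tR_one: "tR \<one>\<^bsub>R\<^esub> = \<one>"
  using r.s_one by simp

abbreviation "TR \<equiv> tensor R (rmul A sR) (rmul A tR)"
abbreviation "tr \<equiv> tens R (rmul A sR) (rmul A tR)"

lemma tensor_R: "tensor_product R (rmul A sR) (rmul A tR)"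
  using r.tensor_AA by (simp add: lmul_opp)

abbreviation "TL \<equiv> AA A L sL tL"
abbreviation "taL \<equiv> aa A L sL tL"
abbreviation "balL \<equiv> balanced L (lmul A tL) (lmul A sL)"
abbreviation "balR \<equiv> balanced R (rmul A sR) (rmul A tR)"
abbreviation "balLR \<equiv> balanced3 L R (lmul A tL) (lmul A sL) (rmul A sR) (rmul A tR)"
abbreviation "balRL \<equiv> balanced3 R L (rmul A sR) (rmul A tR) (lmul A tL) (lmul A sL)"

interpretation TR: tensor_product R "rmul A sR" "rmul A tR" by (rule tensor_R)

lemma \<gamma>R_closed [simp]: "a \<in> carrier A \<Longrightarrow> \<gamma>R a \<in> carrier TR"
  using r.\<gamma>_closed[of a] by (simp add: lmul_opp)

lemma \<gamma>R_add: "\<lbrakk>a \<in> carrier A; b \<in> carrier A\<rbrakk> \<Longrightarrow> \<gamma>R (a \<oplus> b) = \<gamma>R a \<oplus>\<^bsub>TR\<^esub> \<gamma>R b"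
  using additive_on_add[OF r.coproduct_additive, of a b] by (simp add: lmul_opp)

lemma \<gamma>R_mult_sR:
  "\<lbrakk>a \<in> carrier A; x \<in> carrier R\<rbrakk> \<Longrightarrow> \<gamma>R (sR x \<otimes> a) = pres_lift TR (\<lambda>(u, v). tr u (sR x \<otimes> v)) (\<gamma>R a)"
  using r.coproduct_mult_t[of a x] by (simp add: lmul_opp)

lemma \<gamma>R_mult_tR:
  "\<lbrakk>a \<in> carrier A; x \<in> carrier R\<rbrakk> \<Longrightarrow> \<gamma>R (tR x \<otimes> a) = pres_lift TR (\<lambda>(u, v). tr (tR x \<otimes> u) v) (\<gamma>R a)"
  using r.coproduct_mult_s[of a x] by (simp add: lmul_opp)

lemma \<gamma>R_counit: "a \<in> carrier A \<Longrightarrow> pres_lift A (\<lambda>(x, y). x \<otimes> sR (\<pi>R y)) (\<gamma>R a) = a"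
  using r.counital_right[of a] by (simp add: pres_lift_opp)

lemma S_closed [simp]: "a \<in> carrier A \<Longrightarrow> S a \<in> carrier A"
  by (rule additive_on_closed[OF antipode_additive])

lemma S_add: "\<lbrakk>a \<in> carrier A; b \<in> carrier A\<rbrakk> \<Longrightarrow> S (a \<oplus> b) = S a \<oplus> S b"
  by (rule additive_on_add[OF antipode_additive])

lemma S_tL_left: "\<lbrakk>l \<in> carrier L; a \<in> carrier A\<rbrakk> \<Longrightarrow> S (tL l \<otimes> a) = S a \<otimes> sL l"
  and S_tL_right: "\<lbrakk>l \<in> carrier L; a \<in> carrier A\<rbrakk> \<Longrightarrow> S (a \<otimes> tL l) = sL l \<otimes> S a"
  using antipode_L[of "\<one>\<^bsub>L\<^esub>" l a] antipode_L[of l "\<one>\<^bsub>L\<^esub>" a] l.ring_L[THEN ring.is_monoid, THEN monoid.one_closed]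
  by simp_all

lemma S_tR_right: "\<lbrakk>x \<in> carrier R; a \<in> carrier A\<rbrakk> \<Longrightarrow> S (a \<otimes> tR x) = sR x \<otimes> S a"
  using antipode_R[of x "\<one>\<^bsub>R\<^esub>" a] r.ring_L[THEN ring.is_monoid, THEN monoid.one_closed]
  by (simp add: tR_one)

text \<open>This and the next three facts express the equality of the ranges of \<open>sR\<close>
  and \<open>tL\<close>, and of \<open>tR\<close> and \<open>sL\<close>. The conversions between
  tensors over \<open>R\<close> and tensors over \<open>L\<close> rest on them.\<close>

lemma sR_eq_tL: "x \<in> carrier R \<Longrightarrow> sR x = tL (\<pi>L (sR x))"
  using ranges_R by simp

lemma tL_eq_sR: "y \<in> carrier L \<Longrightarrow> tL y = sR (\<pi>R (tL y))"
  using ranges_L by simp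

lemma tR_eq_sL: "x \<in> carrier R \<Longrightarrow> tR x = sL (\<pi>L (tR x))"
  using ranges_R by simp

lemma sL_eq_tR: "y \<in> carrier L \<Longrightarrow> sL y = tR (\<pi>R (sL y))"
  using ranges_L by simp

lemma \<gamma>R_additive: "additive_on A TR \<gamma>R"
  by (simp add: additive_on_def \<gamma>R_add)

text \<open>Here and in the next three lemmas one leg of a tensor over one base ring is expanded by
  the coproduct over the other. The result is balanced because each coproduct is also linear over
  the foreign base, for instance \<open>\<gamma>\<^sub>R(t\<^sub>L(c)a) = a\<^sup>1 \<otimes>
  t\<^sub>L(c)a\<^sup>2\<close>: by the range identities \<open>t\<^sub>L(c)\<close> is a value of
  \<open>sR\<close>.\<close>

lemma \<gamma>R_sweedler_left:
  assumes "balanced3 R L (rmul A sR) (rmul A tR) (lmul A tL) U G F" "abelian_group G" "act_group L U"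
  shows "balanced L (lmul A tL) U G (\<lambda>a u. pres_lift G (\<lambda>(x, y). F x y u) (\<gamma>R a))"
proof (rule sweedler_balanced[OF tensor_R assms(2), where f = "\<lambda>c x. x" and g = "\<lambda>c y. tL c \<otimes> y"])
  show "additive_on (lmul A tL) TR \<gamma>R" using \<gamma>R_additive by (simp add: additive_on_def)
  show "equivariant R (rmul A tR) (rmul A tR) (\<lambda>y. tL c \<otimes> y)" if "c \<in> carrier L" for c
    using that by (intro equivariantI) (simp_all add: A.r_distr A.m_assoc)
  show "\<gamma>R (c \<odot>\<^bsub>lmul A tL\<^esub> a) = pres_lift TR (\<lambda>(x, y). tr x (tL c \<otimes> y)) (\<gamma>R a)"
    if "c \<in> carrier L" "a \<in> carrier (lmul A tL)" for c a
    using that \<gamma>R_mult_sR[of a "\<pi>R (tL c)"] tL_eq_sR[of c] by simp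
qed (use assms in \<open>auto simp: balanced3_def balanced_def biadditive_def equivariant_id\<close>)

lemma \<gamma>R_sweedler_right:
  assumes "balLR G F" "abelian_group G"
  shows "balL G (\<lambda>u a. pres_lift G (\<lambda>(x, y). F u x y) (\<gamma>R a))"
proof (rule balanced_flip, rule sweedler_balanced[OF tensor_R assms(2), where f = "\<lambda>c x. sL c \<otimes> x" and g = "\<lambda>c y. y"])
  show "additive_on (lmul A sL) TR \<gamma>R" using \<gamma>R_additive by (simp add: additive_on_def)
  show "equivariant R (rmul A sR) (rmul A sR) (\<lambda>y. sL c \<otimes> y)" if "c \<in> carrier L" for c
    using that by (intro equivariantI) (simp_all add: A.r_distr A.m_assoc)
  show "\<gamma>R (c \<odot>\<^bsub>lmul A sL\<^esub> a) = pres_lift TR (\<lambda>(x, y). tr (sL c \<otimes> x) y) (\<gamma>R a)"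
    if "c \<in> carrier L" "a \<in> carrier (lmul A sL)" for c a
    using that \<gamma>R_mult_tR[of a "\<pi>R (sL c)"] sL_eq_tR[of c] by simp
  show "act_group L (lmul A tL)" by (rule l.act_t)
qed (use assms in \<open>auto simp: balanced3_def balanced_def biadditive_def equivariant_id additive_on_def\<close>)

lemma \<gamma>L_sweedler_left:
  assumes "balLR G F" "abelian_group G"
  shows "balR G (\<lambda>a u. pres_lift G (\<lambda>(x, y). F x y u) (\<gamma>L a))"
proof (rule sweedler_balanced[OF l.tensor_AA assms(2), where f = "\<lambda>c x. x" and g = "\<lambda>c y. y \<otimes> sR c"])
  show "additive_on (rmul A sR) TL \<gamma>L" using l.coproduct_additive by (simp add: additive_on_def)
  show "equivariant L (lmul A sL) (lmul A sL) (\<lambda>y. y \<otimes> sR c)" if "c \<in> carrier R" for c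
    using that by (intro equivariantI) (simp_all add: A.l_distr A.m_assoc)
  show "\<gamma>L (c \<odot>\<^bsub>rmul A sR\<^esub> a) = pres_lift TL (\<lambda>(x, y). taL x (y \<otimes> sR c)) (\<gamma>L a)"
    if "c \<in> carrier R" "a \<in> carrier (rmul A sR)" for c a
    using that l.coproduct_mult_t[of a "\<pi>L (sR c)"] sR_eq_tL[of c] by simp
  show "act_group R (rmul A tR)" using tensor_R by (simp add: tensor_product_def)
qed (use assms in \<open>auto simp: balanced3_def balanced_def biadditive_def equivariant_id additive_on_def\<close>)

lemma \<gamma>L_sweedler_right:
  assumes "balRL G F" "abelian_group G"
  shows "balR G (\<lambda>u a. pres_lift G (\<lambda>(x, y). F u x y) (\<gamma>L a))"
proof (rule balanced_flip, rule sweedler_balanced[OF l.tensor_AA assms(2), where f = "\<lambda>c x. x \<otimes> tR c" and g = "\<lambda>c y. y"])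
  show "additive_on (rmul A tR) TL \<gamma>L" using l.coproduct_additive by (simp add: additive_on_def)
  show "equivariant L (lmul A tL) (lmul A tL) (\<lambda>y. y \<otimes> tR c)" if "c \<in> carrier R" for c
    using that by (intro equivariantI) (simp_all add: A.l_distr A.m_assoc)
  show "\<gamma>L (c \<odot>\<^bsub>rmul A tR\<^esub> a) = pres_lift TL (\<lambda>(x, y). taL (x \<otimes> tR c) y) (\<gamma>L a)"
    if "c \<in> carrier R" "a \<in> carrier (rmul A tR)" for c a
    using that l.coproduct_mult_s[of a "\<pi>L (tR c)"] tR_eq_sL[of c] by simp
  show "act_group R (rmul A sR)" using tensor_R by (simp add: tensor_product_def)
qed (use assms in \<open>auto simp: balanced3_def balanced_def biadditive_def equivariant_id additive_on_def\<close>)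

text \<open>By axiom (iii), \<open>S(t\<^sub>L(l)x)y = S(x)s\<^sub>L(l)y\<close>. This gives the
  expression \<open>S(a\<^sub>1)a\<^sub>2\<close> of axiom (iv) its meaning.\<close>

lemma antipode_left_balanced: "balL A (\<lambda>x y. S x \<otimes> y)"
  by (intro balancedI additive_onI) (simp_all add: S_add A.l_distr A.r_distr S_tL_left A.m_assoc)

lemma antipode_right_balanced: "balR A (\<lambda>x y. x \<otimes> S y)"
  by (intro balancedI additive_onI) (simp_all add: S_add A.l_distr A.r_distr S_tR_right A.m_assoc)

lemma \<gamma>R_counit_balanced: "balR A (\<lambda>x y. x \<otimes> sR (\<pi>R y))"
proof -
  have "\<pi>R (x \<oplus> y) = \<pi>R x \<oplus>\<^bsub>R\<^esub> \<pi>R y" if "x \<in> carrier A" "y \<in> carrier A" for x y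
    using additive_on_add[OF r.counit_additive, of x y] that by simp
  moreover have "sR (\<pi>R (y \<otimes> tR c)) = sR c \<otimes> sR (\<pi>R y)" if "y \<in> carrier A" "c \<in> carrier R" for c y
    using r.\<pi>_s[of c y] r.t_mult[of c "\<pi>R y"] that by simp
  moreover have "sR (c \<oplus>\<^bsub>R\<^esub> d) = sR c \<oplus> sR d" if "c \<in> carrier R" "d \<in> carrier R" for c d
    using r.t_add that by simp
  ultimately show ?thesis
    by (intro balancedI additive_onI) (simp_all add: A.l_distr A.r_distr A.m_assoc)
qed

lemma \<gamma>L_counit_balanced: "balL A (\<lambda>x y. tL (\<pi>L y) \<otimes> x)"
  by (intro balancedI additive_onI)
    (simp_all add: additive_on_add[OF l.counit_additive] l.t_add A.l_distr A.r_distr A.m_assoc l.\<pi>_s l.t_mult)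

lemma S_one: "S \<one> = \<one>"
proof -
  interpret AA: tensor_product L "lmul A tL" "lmul A sL" by (rule l.tensor_AA)
  have "S \<one> \<otimes> \<one> = sR (\<pi>R \<one>)"
    using antipode_left[of \<one>] AA.lift_additive(2)[OF antipode_left_balanced A.is_abelian_group, of \<one> \<one>] by (simp add: l.coproduct_one)
  then show ?thesis using r.counit_one by simp
qed

section \<open>The inverse of the Galois map\<close>

context
  fixes M :: "('a, 'm) module"
  assumes M: "left_module A M"
begin

interpretation M: left_module A M by (rule M)

lemma RM: "right_module L (restrict_scalars M tL)" by (rule l.right_module_restrict_t[OF M])

interpretation TN: tensor_product L "rmul A tL" "restrict_scalars M tL" by (rule l.tensor_AN[OF RM])
interpretation TM: tensor_product L "lmul A tL" "restrict_scalars M sL" by (rule l.tensor_AM[OF M])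
interpretation AA: tensor_product L "lmul A tL" "lmul A sL" by (rule l.tensor_AA)

abbreviation "G \<equiv> AN A L tL (restrict_scalars M tL)"
abbreviation "gn \<equiv> an A L tL (restrict_scalars M tL)"

private lemma gn:
  "\<lbrakk>x \<in> carrier A; m \<in> carrier M\<rbrakk> \<Longrightarrow> gn x m \<in> carrier G"
  "\<lbrakk>x \<in> carrier A; m \<in> carrier M; m' \<in> carrier M\<rbrakk> \<Longrightarrow> gn x (m \<oplus>\<^bsub>M\<^esub> m') = gn x m \<oplus>\<^bsub>G\<^esub> gn x m'"
  "\<lbrakk>x \<in> carrier A; x' \<in> carrier A; m \<in> carrier M\<rbrakk> \<Longrightarrow> gn (x \<oplus> x') m = gn x m \<oplus>\<^bsub>G\<^esub> gn x' m"
  using l.an_closed[OF RM, of x m] l.an_add_right[OF RM, of x m m'] l.an_add_left[OF RM, of x x' m] by simp_all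

lemma gn_mid: "\<lbrakk>y \<in> carrier L; x \<in> carrier A; m \<in> carrier M\<rbrakk> \<Longrightarrow> gn (x \<otimes> tL y) m = gn x (tL y \<odot>\<^bsub>M\<^esub> m)"
  using l.an_mid[OF RM, of y x m] by simp

lemma gn_mid_sR: "\<lbrakk>y \<in> carrier R; x \<in> carrier A; m \<in> carrier M\<rbrakk> \<Longrightarrow> gn (x \<otimes> sR y) m = gn x (sR y \<odot>\<^bsub>M\<^esub> m)"
  using gn_mid[of "\<pi>L (sR y)" x m] sR_eq_tL[of y] by simp

definition cogalois :: "('a \<times> 'm \<Rightarrow>\<^sub>0 int) set \<Rightarrow> ('a \<times> 'm \<Rightarrow>\<^sub>0 int) set" where
  "cogalois = pres_lift G (\<lambda>(a, m). pres_lift G (\<lambda>(x, y). gn x (S y \<odot>\<^bsub>M\<^esub> m)) (\<gamma>R a))"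

text \<open>The antipode turns \<open>y t\<^sub>R(r)\<close> into \<open>s\<^sub>R(r)S(y)\<close>,
  and \<open>s\<^sub>R(r)\<close> crosses the tensor sign over \<open>L\<close> because it is a
  value of \<open>tL\<close>.\<close>

lemma cogalois_inner_balanced:
  "m \<in> carrier M \<Longrightarrow> balR G (\<lambda>x y. gn x (S y \<odot>\<^bsub>M\<^esub> m))"
  by (intro balancedI additive_onI)
    (simp_all add: gn S_add M.act_add_left M.act_closed S_tR_right M.act_mult gn_mid_sR)

text \<open>Replacing \<open>a\<close> by \<open>t\<^sub>L(l)a\<close> multiplies the second leg of
  its right coproduct by \<open>t\<^sub>L(l)\<close> from the left, and
  \<open>S(t\<^sub>L(l)y) = S(y)s\<^sub>L(l)\<close> hands \<open>s\<^sub>L(l)\<close> on to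
  \<open>m\<close>.\<close>

lemma cogalois_balanced:
  "balanced L (lmul A tL) (restrict_scalars M sL) G
     (\<lambda>a m. pres_lift G (\<lambda>(x, y). gn x (S y \<odot>\<^bsub>M\<^esub> m)) (\<gamma>R a))"
proof (rule \<gamma>R_sweedler_left[OF _ TN.abelian])
  show "act_group L (restrict_scalars M sL)" by (rule act_group_restrict_scalars[OF M]) simp
  show "balanced3 R L (rmul A sR) (rmul A tR) (lmul A tL) (restrict_scalars M sL) G (\<lambda>x y m. gn x (S y \<odot>\<^bsub>M\<^esub> m))"
    unfolding balanced3_def
    by (intro conjI ballI additive_onI)
      (simp_all add: gn S_add M.act_add_left M.act_add_right M.act_closed S_tR_right S_tL_left M.act_mult gn_mid_sR)
qed

lemma cogalois_additive: "additive_on (l.T M) G cogalois"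
  and cogalois_tens: "\<lbrakk>a \<in> carrier A; m \<in> carrier M\<rbrakk>
    \<Longrightarrow> cogalois (l.te M a m) = pres_lift G (\<lambda>(x, y). gn x (S y \<odot>\<^bsub>M\<^esub> m)) (\<gamma>R a)"
  unfolding cogalois_def using TM.lift_additive[OF cogalois_balanced TN.abelian] by simp_all

lemma galois_te: "\<lbrakk>a \<in> carrier A; m \<in> carrier M\<rbrakk> \<Longrightarrow> l.galois M (gn a m) = l.amap M (\<lambda>v. v \<odot>\<^bsub>M\<^esub> m) (\<gamma>L a)"
  using l.galois_tens[OF M] l.diag_one[OF M] by simp

lemma act_linear: "m \<in> carrier M \<Longrightarrow> equivariant L (lmul A sL) (restrict_scalars M sL) (\<lambda>v. v \<odot>\<^bsub>M\<^esub> m)"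
  by (rule equivariant_act_on(1)[OF M]) simp_all

lemma amap_act:
  assumes "m \<in> carrier M"
  shows "additive_on TL (l.T M) (l.amap M (\<lambda>v. v \<odot>\<^bsub>M\<^esub> m))"
    and "\<lbrakk>x \<in> carrier A; y \<in> carrier A\<rbrakk> \<Longrightarrow> l.amap M (\<lambda>v. v \<odot>\<^bsub>M\<^esub> m) (taL x y) = l.te M x (y \<odot>\<^bsub>M\<^esub> m)"
  using l.tmap_AM[OF l.left_module_regular_A M, simplified, OF act_linear[OF assms]] by simp_all

text \<open>In Sweedler notation, with lower indices for the left and upper ones for the right
  coproduct: \<open>a\<^sub>1\<^sup>1 \<otimes> S(a\<^sub>1\<^sup>2)a\<^sub>2m = a\<^sup>1 \<otimes>
  S(a\<^sup>2\<^sub>1)a\<^sup>2\<^sub>2m = a\<^sup>1 \<otimes> s\<^sub>R(\<pi>\<^sub>R(a\<^sup>2))m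
  = a\<^sup>1s\<^sub>R(\<pi>\<^sub>R(a\<^sup>2)) \<otimes> m = a \<otimes> m\<close>, by mixed
  coassociativity, the antipode axiom, balancing and the right counit.\<close>

lemma cogalois_galois:
  assumes z: "z \<in> carrier G"
  shows "cogalois (l.galois M z) = z"
proof (rule TN.ext[OF additive_on_comp[OF l.galois_additive[OF M] cogalois_additive] _ TN.abelian _ z])
  interpret T3: tensor_product3 R L "rmul A sR" "rmul A tR" "lmul A tL" "lmul A sL"
    using tensor_R l.tensor_AA by (simp add: tensor_product3_def tensor_product_def)
  let ?T3 = "tensor3 R L (rmul A sR) (rmul A tR) (lmul A tL) (lmul A sL)"
  let ?t3 = "tens3 R L (rmul A sR) (rmul A tR) (lmul A tL) (lmul A sL)"
  fix a m assume "a \<in> carrier (rmul A tL)" "m \<in> carrier (restrict_scalars M tL)"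
  then have a: "a \<in> carrier A" and m: "m \<in> carrier M" by simp_all
  \<comment> \<open>The part of the expression after both coproducts, as a map on the triple tensor
    product; mixed coassociativity is then applied to its argument.\<close>
  define \<Psi> where "\<Psi> = pres_lift G (\<lambda>(x, y, w). gn x ((S y \<otimes> w) \<odot>\<^bsub>M\<^esub> m))"
  have bal: "balRL G
      (\<lambda>x y w. gn x ((S y \<otimes> w) \<odot>\<^bsub>M\<^esub> m))"
    unfolding balanced3_def using m
    by (intro conjI ballI additive_onI)
      (simp_all add: gn S_add A.l_distr A.r_distr M.act_add_left M.act_closed S_tR_right S_tL_left A.m_assoc
        gn_mid_sR M.act_mult)
  note \<Psi> = T3.lift_additive[OF bal TN.abelian, folded \<Psi>_def]
  note t3 = T3.tens3_balanced
  have \<gamma>La: "\<gamma>L a \<in> carrier TL" using a by simp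
  have "cogalois (l.galois M (gn a m)) = cogalois (l.amap M (\<lambda>v. v \<odot>\<^bsub>M\<^esub> m) (\<gamma>L a))"
    using a m by (simp add: galois_te)
  also have "\<dots> = pres_lift G (\<lambda>(x, y). cogalois (l.te M x (y \<odot>\<^bsub>M\<^esub> m))) (\<gamma>L a)"
    using a m by (intro AA.lift_eq[OF additive_on_comp[OF amap_act(1) cogalois_additive] TN.abelian, symmetric])
      (simp_all add: amap_act)
  also have "\<dots> = pres_lift G (\<lambda>(x, y). pres_lift G (\<lambda>(u, v). \<Psi> (?t3 u v y)) (\<gamma>R x)) (\<gamma>L a)"
  proof (rule AA.lift_cong[OF _ _ TN.abelian \<gamma>La])
    fix x y assume "x \<in> carrier (lmul A tL)" "y \<in> carrier (lmul A sL)"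
    then have xy: "x \<in> carrier A" "y \<in> carrier A" by simp_all
    have b: "balR G (\<lambda>u v. \<Psi> (?t3 u v y))"
      using xy by (intro balanced_comp[OF balanced3_fix(1)[OF t3] \<Psi>(1)]) simp
    then show "pres_lift G (\<lambda>(u, v). \<Psi> (?t3 u v y)) (\<gamma>R x) \<in> carrier G"
      using xy by (intro TR.lift_closed TN.abelian) simp_all
    show "cogalois (l.te M x (y \<odot>\<^bsub>M\<^esub> m)) = pres_lift G (\<lambda>(u, v). \<Psi> (?t3 u v y)) (\<gamma>R x)"
      using xy m
      by (simp add: cogalois_tens M.act_closed)
        (intro TR.lift_cong TN.abelian, simp_all add: \<Psi>(2) M.act_mult gn M.act_closed)
  qed
  also have "\<dots> = \<Psi> (pres_lift ?T3 (\<lambda>(x, y). pres_lift ?T3 (\<lambda>(u, v). ?t3 u v y) (\<gamma>R x)) (\<gamma>L a))"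
    using balanced3_fix(1)[OF t3]
    by (intro sweedler_lift_hom[OF tensor_R l.tensor_AA T3.abelian TN.abelian _ _
          \<gamma>R_sweedler_left[OF t3 T3.abelian l.act_s] \<Psi>(1) \<gamma>La, symmetric]) simp_all
  also have "\<dots> = \<Psi> (pres_lift ?T3 (\<lambda>(x, y). pres_lift ?T3 (\<lambda>(u, v). ?t3 x u v) (\<gamma>L y)) (\<gamma>R a))"
    by (simp only: mixed_coassociative_RL[OF a])
  also have "\<dots> = pres_lift G (\<lambda>(x, y). pres_lift G (\<lambda>(u, v). \<Psi> (?t3 x u v)) (\<gamma>L y)) (\<gamma>R a)"
    using balanced3_fix(2)[OF t3] a
    by (intro sweedler_lift_hom'[OF l.tensor_AA tensor_R T3.abelian TN.abelian _ _
          \<gamma>L_sweedler_right[OF t3 T3.abelian] \<Psi>(1)]) simp_all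
  also have "\<dots> = pres_lift G (\<lambda>(x, y). gn (x \<otimes> sR (\<pi>R y)) m) (\<gamma>R a)"
  proof (rule TR.lift_cong[OF _ _ TN.abelian])
    fix x y assume "x \<in> carrier (rmul A sR)" "y \<in> carrier (rmul A tR)"
    then have xy: "x \<in> carrier A" "y \<in> carrier A" by simp_all
    show "gn (x \<otimes> sR (\<pi>R y)) m \<in> carrier G" using xy m by (simp add: gn)
    \<comment> \<open>As an additive map on \<open>A\<close>, this can be pulled out of the inner
      sum, which leaves the left side of the antipode axiom.\<close>
    have h: "additive_on A G (\<lambda>w. gn x (w \<odot>\<^bsub>M\<^esub> m))"
      using xy m by (intro additive_onI) (simp_all add: gn M.act_closed M.act_add_left)
    have "pres_lift G (\<lambda>(u, v). \<Psi> (?t3 x u v)) (\<gamma>L y) = pres_lift G (\<lambda>(u, v). gn x ((S u \<otimes> v) \<odot>\<^bsub>M\<^esub> m)) (\<gamma>L y)"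
      using xy m by (intro AA.lift_cong TN.abelian) (simp_all add: \<Psi>(2) gn M.act_closed)
    also have "\<dots> = gn x (pres_lift A (\<lambda>(u, v). S u \<otimes> v) (\<gamma>L y) \<odot>\<^bsub>M\<^esub> m)"
      using xy by (intro AA.lift_hom[OF antipode_left_balanced h A.is_abelian_group TN.abelian, symmetric]) simp
    also have "\<dots> = gn (x \<otimes> sR (\<pi>R y)) m"
      using xy m by (simp add: antipode_left gn_mid_sR)
    finally show "pres_lift G (\<lambda>(u, v). \<Psi> (?t3 x u v)) (\<gamma>L y) = gn (x \<otimes> sR (\<pi>R y)) m" .
  qed (simp add: a)
  also have "\<dots> = gn (pres_lift A (\<lambda>(x, y). x \<otimes> sR (\<pi>R y)) (\<gamma>R a)) m"
  proof (rule TR.lift_hom[OF \<gamma>R_counit_balanced _ A.is_abelian_group TN.abelian, symmetric])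
    show "additive_on A G (\<lambda>x. gn x m)" using m by (intro additive_onI) (simp_all add: gn)
  qed (simp add: a)
  also have "\<dots> = gn a m" by (simp add: \<gamma>R_counit a)
  finally show "cogalois (l.galois M (gn a m)) = gn a m" .
qed (simp add: additive_on_def)

text \<open>The mirror computation: \<open>a\<^sup>1\<^sub>1 \<otimes>
  a\<^sup>1\<^sub>2S(a\<^sup>2)m = a\<^sub>1 \<otimes> a\<^sub>2\<^sup>1S(a\<^sub>2\<^sup>2)m =
  a\<^sub>1 \<otimes> s\<^sub>L(\<pi>\<^sub>L(a\<^sub>2))m =
  t\<^sub>L(\<pi>\<^sub>L(a\<^sub>2))a\<^sub>1 \<otimes> m = a \<otimes> m\<close>, with the other
  mixed coassociativity, the other antipode axiom and the left counit.\<close>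

lemma galois_cogalois:
  assumes z: "z \<in> carrier (l.T M)"
  shows "l.galois M (cogalois z) = z"
proof (rule TM.ext[OF additive_on_comp[OF cogalois_additive l.galois_additive[OF M]] _ TM.abelian _ z])
  interpret T3: tensor_product3 L R "lmul A tL" "lmul A sL" "rmul A sR" "rmul A tR"
    using tensor_R l.tensor_AA by (simp add: tensor_product3_def tensor_product_def)
  let ?T3 = "tensor3 L R (lmul A tL) (lmul A sL) (rmul A sR) (rmul A tR)"
  let ?t3 = "tens3 L R (lmul A tL) (lmul A sL) (rmul A sR) (rmul A tR)"
  fix a m assume "a \<in> carrier (lmul A tL)" "m \<in> carrier (restrict_scalars M sL)"
  then have a: "a \<in> carrier A" and m: "m \<in> carrier M" by simp_all
  define \<Phi> where "\<Phi> = pres_lift (l.T M) (\<lambda>(x, y, w). l.te M x ((y \<otimes> S w) \<odot>\<^bsub>M\<^esub> m))"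
  have bal: "balLR (l.T M)
      (\<lambda>x y w. l.te M x ((y \<otimes> S w) \<odot>\<^bsub>M\<^esub> m))"
    unfolding balanced3_def using m
    by (intro conjI ballI additive_onI)
      (simp_all add: M l.te_add_left l.te_add_right l.te_mid S_add A.l_distr A.r_distr M.act_add_left
        M.act_closed S_tR_right A.m_assoc M.act_mult)
  note \<Phi> = T3.lift_additive[OF bal TM.abelian, folded \<Phi>_def]
  note t3 = T3.tens3_balanced
  have \<gamma>Ra: "\<gamma>R a \<in> carrier TR" using a by simp
  have "l.galois M (cogalois (l.te M a m)) = pres_lift (l.T M) (\<lambda>(x, y). l.galois M (gn x (S y \<odot>\<^bsub>M\<^esub> m))) (\<gamma>R a)"
    using a m TR.lift_hom[OF cogalois_inner_balanced l.galois_additive[OF M] TN.abelian TM.abelian \<gamma>Ra]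
    by (simp add: cogalois_tens)
  also have "\<dots> = pres_lift (l.T M) (\<lambda>(x, y). pres_lift (l.T M) (\<lambda>(u, v). \<Phi> (?t3 u v y)) (\<gamma>L x)) (\<gamma>R a)"
  proof (rule TR.lift_cong[OF _ _ TM.abelian \<gamma>Ra])
    fix x y assume "x \<in> carrier (rmul A sR)" "y \<in> carrier (rmul A tR)"
    then have xy: "x \<in> carrier A" "y \<in> carrier A" by simp_all
    have b: "balL (l.T M) (\<lambda>u v. \<Phi> (?t3 u v y))"
      using xy by (intro balanced_comp[OF balanced3_fix(1)[OF t3] \<Phi>(1)]) simp
    then show "pres_lift (l.T M) (\<lambda>(u, v). \<Phi> (?t3 u v y)) (\<gamma>L x) \<in> carrier (l.T M)"
      using xy by (intro AA.lift_closed TM.abelian) simp_all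
    have Sm: "S y \<odot>\<^bsub>M\<^esub> m \<in> carrier M" using xy m by (simp add: M.act_closed)
    have "l.galois M (gn x (S y \<odot>\<^bsub>M\<^esub> m)) = l.amap M (\<lambda>v. v \<odot>\<^bsub>M\<^esub> (S y \<odot>\<^bsub>M\<^esub> m)) (\<gamma>L x)"
      by (rule galois_te[OF xy(1) Sm])
    also have "\<dots> = pres_lift (l.T M) (\<lambda>(u, v). \<Phi> (?t3 u v y)) (\<gamma>L x)"
      using xy m Sm by (intro AA.lift_eq[OF amap_act(1)[OF Sm] TM.abelian, symmetric])
        (simp_all add: amap_act(2) \<Phi>(2) M.act_mult)
    finally show "l.galois M (gn x (S y \<odot>\<^bsub>M\<^esub> m)) = pres_lift (l.T M) (\<lambda>(u, v). \<Phi> (?t3 u v y)) (\<gamma>L x)" .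
  qed
  also have "\<dots> = \<Phi> (pres_lift ?T3 (\<lambda>(x, y). pres_lift ?T3 (\<lambda>(u, v). ?t3 u v y) (\<gamma>L x)) (\<gamma>R a))"
    using balanced3_fix(1)[OF t3]
    by (intro sweedler_lift_hom[OF l.tensor_AA tensor_R T3.abelian TM.abelian _ _
          \<gamma>L_sweedler_left[OF t3 T3.abelian] \<Phi>(1) \<gamma>Ra, symmetric]) simp_all
  also have "\<dots> = \<Phi> (pres_lift ?T3 (\<lambda>(x, y). pres_lift ?T3 (\<lambda>(u, v). ?t3 x u v) (\<gamma>R y)) (\<gamma>L a))"
    by (simp only: mixed_coassociative_LR[OF a])
  also have "\<dots> = pres_lift (l.T M) (\<lambda>(x, y). pres_lift (l.T M) (\<lambda>(u, v). \<Phi> (?t3 x u v)) (\<gamma>R y)) (\<gamma>L a)"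
    using balanced3_fix(2)[OF t3] a
    by (intro sweedler_lift_hom'[OF tensor_R l.tensor_AA T3.abelian TM.abelian _ _
          \<gamma>R_sweedler_right[OF t3 T3.abelian] \<Phi>(1)]) simp_all
  also have "\<dots> = pres_lift (l.T M) (\<lambda>(x, y). l.te M (tL (\<pi>L y) \<otimes> x) m) (\<gamma>L a)"
  proof (rule AA.lift_cong[OF _ _ TM.abelian])
    fix x y assume "x \<in> carrier (lmul A tL)" "y \<in> carrier (lmul A sL)"
    then have xy: "x \<in> carrier A" "y \<in> carrier A" by simp_all
    show "l.te M (tL (\<pi>L y) \<otimes> x) m \<in> carrier (l.T M)" using xy m M by simp
    have h: "additive_on A (l.T M) (\<lambda>w. l.te M x (w \<odot>\<^bsub>M\<^esub> m))"
      using xy m M by (intro additive_onI) (simp_all add: l.te_add_right M.act_closed M.act_add_left)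
    have "pres_lift (l.T M) (\<lambda>(u, v). \<Phi> (?t3 x u v)) (\<gamma>R y) =
        pres_lift (l.T M) (\<lambda>(u, v). l.te M x ((u \<otimes> S v) \<odot>\<^bsub>M\<^esub> m)) (\<gamma>R y)"
      using xy m M by (intro TR.lift_cong TM.abelian) (simp_all add: \<Phi>(2) M.act_closed)
    also have "\<dots> = l.te M x (pres_lift A (\<lambda>(u, v). u \<otimes> S v) (\<gamma>R y) \<odot>\<^bsub>M\<^esub> m)"
      using xy by (intro TR.lift_hom[OF antipode_right_balanced h A.is_abelian_group TM.abelian, symmetric]) simp
    also have "\<dots> = l.te M (tL (\<pi>L y) \<otimes> x) m"
      using xy m M by (simp add: antipode_right l.te_mid)
    finally show "pres_lift (l.T M) (\<lambda>(u, v). \<Phi> (?t3 x u v)) (\<gamma>R y) = l.te M (tL (\<pi>L y) \<otimes> x) m" .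
  qed (simp add: a)
  also have "\<dots> = l.te M (pres_lift A (\<lambda>(x, y). tL (\<pi>L y) \<otimes> x) (\<gamma>L a)) m"
  proof (rule AA.lift_hom[OF \<gamma>L_counit_balanced _ A.is_abelian_group TM.abelian, symmetric])
    show "additive_on A (l.T M) (\<lambda>x. l.te M x m)" using m M by (intro additive_onI) (simp_all add: l.te_add_left)
  qed (simp add: a)
  also have "\<dots> = l.te M a m" by (simp add: l.counital_right a)
  finally show "l.galois M (cogalois (l.te M a m)) = l.te M a m" .
qed (simp add: additive_on_def)

lemma bij_betw_galois: "bij_betw (l.galois M) (carrier G) (carrier (l.T M))"
  by (rule bij_betwI[where g = cogalois])
    (auto simp: cogalois_galois galois_cogalois additive_on_closed[OF l.galois_additive[OF M]]
      additive_on_closed[OF cogalois_additive])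

end

text \<open>The three conditions on \<open>\<chi>\<close> in \<open>unit_bij_betw\<close>. The
  second holds because the antipode turns right multiplication by \<open>tL y\<close> into left
  multiplication by \<open>sL y\<close>, and \<open>\<pi>L\<close> is left
  \<open>L\<close>-linear.\<close>

lemma \<pi>L_S:
  "additive_on A L (\<lambda>a. \<pi>L (S a))"
  "\<lbrakk>a \<in> carrier A; y \<in> carrier L\<rbrakk> \<Longrightarrow> \<pi>L (S (a \<otimes> tL y)) = y \<otimes>\<^bsub>L\<^esub> \<pi>L (S a)"
  "\<pi>L (S \<one>) = \<one>\<^bsub>L\<^esub>"
  using additive_on_comp[OF antipode_additive l.counit_additive]
  by (simp_all add: S_tL_right l.\<pi>_s S_one l.counit_one)

end

section \<open>Transport of modules and cardinalities\<close>

context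
  fixes M :: "('a, 'x) module" and e :: "'x \<Rightarrow> 'u"
  assumes inj: "inj_on e (carrier M)"
begin

lemma transport_simps:
  "carrier (transport_module e M) = e ` carrier M" "\<zero>\<^bsub>transport_module e M\<^esub> = e \<zero>\<^bsub>M\<^esub>"
  "\<lbrakk>x \<in> carrier M; y \<in> carrier M\<rbrakk> \<Longrightarrow> e x \<oplus>\<^bsub>transport_module e M\<^esub> e y = e (x \<oplus>\<^bsub>M\<^esub> y)"
  "x \<in> carrier M \<Longrightarrow> a \<odot>\<^bsub>transport_module e M\<^esub> e x = e (a \<odot>\<^bsub>M\<^esub> x)"
  using inj by (simp_all add: transport_module_def Let_def)

lemma abelian_group_transport:
  assumes "abelian_group M" shows "abelian_group (transport_module e M)"
proof -
  interpret M: abelian_group M by fact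
  show ?thesis
  proof (rule abelian_groupI)
    fix x assume "x \<in> carrier (transport_module e M)"
    then obtain y where y: "y \<in> carrier M" "x = e y" by (auto simp: transport_simps)
    then show "\<exists>y\<in>carrier (transport_module e M). y \<oplus>\<^bsub>transport_module e M\<^esub> x = \<zero>\<^bsub>transport_module e M\<^esub>"
      by (intro bexI[of _ "e (\<ominus>\<^bsub>M\<^esub> y)"]) (auto simp: transport_simps M.l_neg)
  qed (auto simp: transport_simps M.a_ac)
qed

lemma left_module_transport:
  assumes "left_module A M" shows "left_module A (transport_module e M)"
proof -
  interpret M: left_module A M by fact
  show ?thesis
    by (intro left_module.intro left_module_axioms.intro abelian_group_transport left_moduleD[OF assms])
      (auto simp: transport_simps M.act_closed M.act_add_left M.act_add_right M.act_mult M.act_one)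
qed

lemma equivariant_transport: "equivariant B M (transport_module e M) e"
  by (rule equivariantI) (simp_all add: transport_simps)

lemma equivariant_transport_inv:
  assumes "act_group B M"
  shows "equivariant B (transport_module e M) M (inv_into (carrier M) e)"
proof -
  interpret M: abelian_group M using assms by (simp add: act_group_def)
  show ?thesis
    using assms inj by (intro equivariantI) (auto simp: transport_simps act_group_def)
qed

end

lemma right_module_transport:
  "\<lbrakk>right_module L N; inj_on e (carrier N)\<rbrakk> \<Longrightarrow> right_module L (transport_module e N)"
  by (simp add: right_module_def left_module_transport)

text \<open>A cardinality count: the tensor product is a quotient of a free abelian group on pairs,
  an infinite set of generators gives a free abelian group of the same cardinality, and an infinite
  type absorbs its square.\<close>

lemma tensor_embedding:
  fixes Q :: "('b, 'u) module"
  assumes T: "tensor_product B P Q" and inf: "infinite (UNIV :: 'u set)"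
    and P: "carrier P \<lesssim> (UNIV :: 'u set)"
  shows "\<exists>e :: _ \<Rightarrow> 'u. inj_on e (carrier (tensor B P Q))"
proof -
  interpret T: tensor_product B P Q by (rule T)
  interpret P: abelian_group P using T.P by (simp add: act_group_def)
  let ?X = "carrier P \<times> carrier Q" and ?Y = "carrier P \<times> (UNIV :: 'u set)"
  have "carrier (tensor B P Q) \<lesssim> carrier (free_Abelian_group ?X)"
    unfolding tensor_def presentation.carrier_pres[OF T.presentation]
    by (rule lepoll_trans[OF image_lepoll]) (simp add: subset_imp_lepoll subset_iff)
  \<comment> \<open>The set \<open>?X\<close> of generators may be finite; enlarging it to the
    infinite set \<open>?Y\<close> makes the cardinality of the free group known.\<close>
  also have "\<dots> \<lesssim> carrier (free_Abelian_group ?Y)"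
    by (rule subset_imp_lepoll) auto
  also have "\<dots> \<lesssim> ?Y"
  proof (rule eqpoll_imp_lepoll[OF eqpoll_free_Abelian_group_infinite])
    show "infinite ?Y" using inf P.zero_closed by (auto simp: finite_cartesian_product_iff)
  qed
  also have "\<dots> \<lesssim> (UNIV :: 'u set) \<times> (UNIV :: 'u set)"
    by (rule times_lepoll_mono[OF P lepoll_refl])
  also have "\<dots> \<lesssim> (UNIV :: 'u set)"
    using card_of_Times_same_infinite[OF inf] unfolding lepoll_def
    by (metis card_of_ordLeq ordIso_imp_ordLeq)
  finally show ?thesis by (auto simp: lepoll_def)
qed

section \<open>Right exactness and flatness\<close>

lemma a_minus_eq_zero_iff:
  assumes "abelian_group G" "x \<in> carrier G" "y \<in> carrier G"
  shows "x \<ominus>\<^bsub>G\<^esub> y = \<zero>\<^bsub>G\<^esub> \<longleftrightarrow> x = y"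
proof -
  interpret abelian_group G by fact
  show ?thesis
    using assms minus_equality[of x "\<ominus>\<^bsub>G\<^esub> y"] by (auto simp: a_minus_def r_neg minus_minus)
qed

text \<open>A quotient group in the form of a ring record, so that it can be the target of
  \<open>pres_lift\<close>.\<close>

definition quotient_group :: "('g, 'e) ring_scheme \<Rightarrow> 'g set \<Rightarrow> 'g set ring" where
  "quotient_group G J = \<lparr>carrier = carrier (add_monoid G Mod J), monoid.mult = undefined,
     monoid.one = undefined, ring.zero = J, add = monoid.mult (add_monoid G Mod J)\<rparr>"

lemma
  assumes G: "abelian_group G" and J: "subgroup J (add_monoid G)"
  shows abelian_quotient_group: "abelian_group (quotient_group G J)"
    and additive_quotient_group: "additive_on G (quotient_group G J) (\<lambda>x. J #>\<^bsub>add_monoid G\<^esub> x)"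
    and quotient_group_zero: "\<lbrakk>x \<in> carrier G; J #>\<^bsub>add_monoid G\<^esub> x = \<zero>\<^bsub>quotient_group G J\<^esub>\<rbrakk> \<Longrightarrow> x \<in> J"
proof -
  interpret G: abelian_group G by (rule G)
  interpret N: normal J "add_monoid G" by (rule comm_group.subgroup_imp_normal[OF G.a_comm_group J])
  have "add_monoid (quotient_group G J) = add_monoid G Mod J"
    by (simp add: quotient_group_def FactGroup_def)
  then show "abelian_group (quotient_group G J)"
    unfolding abelian_group_iff using comm_group.abelian_FactGroup[OF G.a_comm_group J] by simp
  show "additive_on G (quotient_group G J) (\<lambda>x. J #>\<^bsub>add_monoid G\<^esub> x)"
    using N.rcos_sum
    by (intro additive_onI) (auto simp: quotient_group_def FactGroup_def RCOSETS_def)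
  show "x \<in> J" if "x \<in> carrier G" "J #>\<^bsub>add_monoid G\<^esub> x = \<zero>\<^bsub>quotient_group G J\<^esub>"
    using group.rcos_self[OF G.a_group, of x J] that J by (simp add: quotient_group_def)
qed

context left_bialgebroid
begin

interpretation A: ring A by (rule ring_A)

text \<open>With \<open>J\<close> the image of \<open>\<^sup>LA \<otimes> C\<close>, the map
  \<open>a \<otimes> q \<mapsto> [a \<otimes> \<sigma> q]\<close> into the quotient by
  \<open>J\<close>, where \<open>\<sigma>\<close> is any set-theoretic section of \<open>g\<close>,
  turns \<open>\<^sup>LA \<otimes> g\<close> into the projection modulo \<open>J\<close>. Hence an
  element killed by \<open>\<^sup>LA \<otimes> g\<close> lies in \<open>J\<close>.\<close>

lemma tensor_right_exact:
  fixes N :: "('b, 'n) module" and Q :: "('b, 'q) module"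
  assumes N: "right_module L N" and Q: "right_module L Q" and g: "equivariant L N Q g"
    and surj: "g ` carrier N = carrier Q"
    and C: "C = N\<lparr>carrier := {n \<in> carrier N. g n = \<zero>\<^bsub>Q\<^esub>}\<rparr>" "right_module L C"
    and z: "z \<in> carrier (AN A L t N)" "imap Q g z = \<zero>\<^bsub>AN A L t Q\<^esub>"
  shows "z \<in> imap N (\<lambda>n. n) ` carrier (AN A L t C)"
proof -
  interpret TN: tensor_product L "rmul A t" N by (rule tensor_AN[OF N])
  interpret TQ: tensor_product L "rmul A t" Q by (rule tensor_AN[OF Q])
  interpret TC: tensor_product L "rmul A t" C by (rule tensor_AN[OF C(2)])
  have gN: "abelian_group N" and gQ: "abelian_group Q"
    using act_group_right_module[OF N] act_group_right_module[OF Q] by (auto simp: act_group_def)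
  interpret N: abelian_group N by (rule gN)
  interpret Q: abelian_group Q by (rule gQ)
  have incl: "equivariant L C N (\<lambda>n. n)"
    by (rule equivariantI) (simp_all add: C(1))
  note i = imap_additive[OF C(2) N incl] imap_tens[OF C(2) N incl]
  define J where "J = imap N (\<lambda>n. n) ` carrier (AN A L t C)"
  interpret ih: group_hom "add_monoid (AN A L t C)" "add_monoid (AN A L t N)" "imap N (\<lambda>n. n)"
    by (rule additive_on_hom[OF i(1) TC.abelian TN.abelian])
  have J: "subgroup J (add_monoid (AN A L t N))"
    using ih.img_is_subgroup by (simp add: J_def)
  let ?V = "quotient_group (AN A L t N) J" and ?p = "\<lambda>x. J #>\<^bsub>add_monoid (AN A L t N)\<^esub> x"
  note V = abelian_quotient_group[OF TN.abelian J] and p = additive_quotient_group[OF TN.abelian J]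
    and V0 = quotient_group_zero[OF TN.abelian J]
  interpret V: abelian_group ?V by (rule V)
  define \<sigma> where "\<sigma> = inv_into (carrier N) g"
  have \<sigma>: "\<sigma> q \<in> carrier N" "g (\<sigma> q) = q" if "q \<in> carrier Q" for q
    using that surj by (auto simp: \<sigma>_def f_inv_into_f inv_into_into)
  have pan: "additive_on N ?V (\<lambda>n. ?p (an' N a n))" if "a \<in> carrier A" for a
    using that additive_on_comp[OF balanced_right[OF TN.tens_balanced] p] by simp
  \<comment> \<open>Modulo \<open>J\<close> the class of \<open>a \<otimes> n\<close> depends on
    \<open>g n\<close> alone. This compensates for the failure of the section to be additive or
    \<open>L\<close>-linear.\<close>
  have eq: "?p (an' N a n) = ?p (an' N a n')"
    if a: "a \<in> carrier A" and n: "n \<in> carrier N" "n' \<in> carrier N" and gn: "g n = g n'" for a n n'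
  proof -
    have "g (n \<ominus>\<^bsub>N\<^esub> n') = \<zero>\<^bsub>Q\<^esub>"
      using additive_on_minus[OF equivariant_additive[OF g] gN gQ n] gn equivariant_closed[OF g] n
      by (simp add: a_minus_def Q.r_neg)
    then have c: "n \<ominus>\<^bsub>N\<^esub> n' \<in> carrier C" using n by (simp add: C(1))
    then have "an' N a (n \<ominus>\<^bsub>N\<^esub> n') \<in> J"
      unfolding J_def using a by (intro image_eqI[of _ _ "an' C a (n \<ominus>\<^bsub>N\<^esub> n')"]) (simp_all add: i C(2))
    then have "?p (an' N a (n \<ominus>\<^bsub>N\<^esub> n')) = \<zero>\<^bsub>?V\<^esub>"
      using subgroup.rcos_const[OF J] TN.T.a_group by (simp add: quotient_group_def)
    then have "?p (an' N a n) \<ominus>\<^bsub>?V\<^esub> ?p (an' N a n') = \<zero>\<^bsub>?V\<^esub>"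
      using additive_on_minus[OF pan[OF a] gN V n] by simp
    then show ?thesis
      using additive_on_closed[OF pan[OF a]] n by (simp add: a_minus_eq_zero_iff[OF V])
  qed
  let ?f = "\<lambda>a q. ?p (an' N a (\<sigma> q))"
  have b: "balanced L (rmul A t) Q ?V ?f"
  proof (rule balancedI)
    fix a assume "a \<in> carrier (rmul A t)"
    then have a: "a \<in> carrier A" by simp
    show "additive_on Q ?V (?f a)"
    proof (rule additive_onI)
      fix x y assume xy: "x \<in> carrier Q" "y \<in> carrier Q"
      have "?f a (x \<oplus>\<^bsub>Q\<^esub> y) = ?p (an' N a (\<sigma> x \<oplus>\<^bsub>N\<^esub> \<sigma> y))"
        using xy a by (intro eq) (simp_all add: \<sigma> equivariant_add[OF g])
      then show "?f a (x \<oplus>\<^bsub>Q\<^esub> y) = ?f a x \<oplus>\<^bsub>?V\<^esub> ?f a y"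
        using additive_on_add[OF pan[OF a]] xy by (simp add: \<sigma>)
    qed (use additive_on_closed[OF pan[OF a]] \<sigma> in simp)
  next
    fix q assume "q \<in> carrier Q"
    then show "additive_on (rmul A t) ?V (\<lambda>a. ?f a q)"
      using additive_on_comp[OF balanced_left[OF TN.tens_balanced] p] \<sigma> by simp
  next
    fix l a q assume lq: "l \<in> carrier L" "a \<in> carrier (rmul A t)" "q \<in> carrier Q"
    have lN: "l \<odot>\<^bsub>N\<^esub> \<sigma> q \<in> carrier N" "l \<odot>\<^bsub>Q\<^esub> q \<in> carrier Q"
      using lq \<sigma> act_group_right_module[OF N] act_group_right_module[OF Q] by (auto simp: act_group_def)
    have "?p (an' N a (l \<odot>\<^bsub>N\<^esub> \<sigma> q)) = ?f a (l \<odot>\<^bsub>Q\<^esub> q)"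
      using lq lN by (intro eq) (simp_all add: \<sigma> equivariant_act[OF g])
    then show "?f (l \<odot>\<^bsub>rmul A t\<^esub> a) q = ?f a (l \<odot>\<^bsub>Q\<^esub> q)"
      using lq \<sigma> by (simp add: an_mid[OF N])
  qed
  define \<psi> where "\<psi> = pres_lift ?V (\<lambda>(a, q). ?f a q)"
  note \<psi> = TQ.lift_additive[OF b V, folded \<psi>_def]
  note ig = imap_additive[OF N Q g] imap_tens[OF N Q g]
  have "\<psi> (imap Q g z) = ?p z"
  proof (rule TN.ext[OF additive_on_comp[OF ig(1) \<psi>(1)] p V _ z(1)])
    fix a n assume "a \<in> carrier (rmul A t)" "n \<in> carrier N"
    then show "\<psi> (imap Q g (an' N a n)) = ?p (an' N a n)"
      using eq[of a "\<sigma> (g n)" n] equivariant_closed[OF g, of n] \<sigma>[of "g n"]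
      by (simp add: ig(2) \<psi>(2))
  qed
  then have "?p z = \<zero>\<^bsub>?V\<^esub>"
    using z(2) additive_on_zero[OF \<psi>(1) TQ.abelian V] by simp
  then show ?thesis using V0[OF z(1)] by (simp add: J_def)
qed

text \<open>\<open>flat\<close> speaks of extensional maps, so the inclusion is restricted before
  the definition is applied; the induced map stays the same.\<close>

lemma flat_inj:
  fixes N :: "('b, 'u) module"
  assumes "flat TYPE('u) A L t" and N: "right_module L N" and H: "right_module L (N\<lparr>carrier := H\<rparr>)" "H \<subseteq> carrier N"
  shows "inj_on (imap N (\<lambda>n. n)) (carrier (AN A L t (N\<lparr>carrier := H\<rparr>)))"
proof -
  let ?r = "restrict (\<lambda>n. n) H"
  have aH: "act_group L (N\<lparr>carrier := H\<rparr>)" by (rule act_group_right_module[OF H(1)])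
  have e: "equivariant L (N\<lparr>carrier := H\<rparr>) N (\<lambda>n. n)"
    using H(2) by (intro equivariantI) auto
  have "?r \<in> linear_maps L (N\<lparr>carrier := H\<rparr>) N"
    using equivariant_cong[OF e aH, of ?r] by (simp add: linear_maps_iff)
  then have "inj_on (imap N ?r) (carrier (AN A L t (N\<lparr>carrier := H\<rparr>)))"
    using assms(1) N H(1) unfolding flat_def induced_map_eq_tmap by (auto simp: inj_on_def)
  moreover have "imap N ?r z = imap N (\<lambda>n. n) z" if "z \<in> carrier (AN A L t (N\<lparr>carrier := H\<rparr>))" for z
    using that H(2) by (intro tmap_cong[OF tensor_AN[OF H(1)] tensor_AN[OF N]]) auto
  ultimately show ?thesis by (simp add: inj_on_def)
qed

text \<open>Flatness, applied to the inclusion of the coinvariants, gives injectivity of the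
  canonical map. For its image, the difference \<open>\<tau> - 1 \<otimes> -\<close> is factored as
  a surjection onto its image followed by an inclusion: flatness removes the inclusion, and right
  exactness handles the surjection, whose kernel is the module of coinvariants.\<close>

lemma flat_kernel_preserved:
  fixes M :: "('a, 'u) module" and e :: "_ \<Rightarrow> 'u"
  assumes fl: "flat TYPE('u) A L t" and H: "hopf_module M \<tau>" and e: "inj_on e (carrier (T M))"
  shows "coinv_kernel_preserved A L s t (M, \<tau>)"
proof -
  note M = hopf_moduleD(1)[OF H]
  let ?N = "restrict_scalars M t" and ?C = "coinv A L s t (M, \<tau>)"
  let ?Q = "restrict_scalars (diag_module M) t"
  \<comment> \<open>\<open>flat\<close> tests only modules with carrier in \<open>'u\<close>, while
    \<open>?Q\<close> consists of elements of a tensor product; \<open>?Q'\<close> is a copy of it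
    inside \<open>'u\<close>.\<close>
  let ?Q' = "transport_module e ?Q"
  let ?\<delta> = "\<lambda>m. \<tau> m \<ominus>\<^bsub>T M\<^esub> te M \<one> m"
  have eQ: "inj_on e (carrier ?Q)" using e by simp
  note RN = right_module_restrict_t[OF M] and RQ = right_module_restrict_t[OF left_module_diag[OF M]]
  note RQ' = right_module_transport[OF RQ eQ] and RC = right_module_coinv[OF H]
  note \<delta> = equivariant_coinv_difference[OF H]
  note ee = equivariant_transport[OF eQ, of L]
  note g = equivariant_comp[OF \<delta> ee]
  interpret TM: abelian_group "T M" by (rule abelian_T[OF M])
  have aN: "abelian_group ?N" and aQ': "abelian_group ?Q'"
    using act_group_right_module[OF RN] act_group_right_module[OF RQ'] by (auto simp: act_group_def)
  interpret N: abelian_group ?N by (rule aN)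
  let ?g = "\<lambda>m. e (?\<delta> m)"
  let ?H = "?g ` carrier M"
  let ?I = "?Q'\<lparr>carrier := ?H\<rparr>"
  have HQ: "?H \<subseteq> carrier ?Q'" using equivariant_closed[OF g] by auto
  have RI: "right_module L ?I"
  proof (rule right_module_submodule[OF RQ' HQ])
    show "\<zero>\<^bsub>?Q'\<^esub> \<in> ?H"
      using additive_on_zero[OF equivariant_additive[OF g] aN aQ'] N.zero_closed
      by (intro image_eqI[of _ _ "\<zero>\<^bsub>M\<^esub>"]) simp_all
    show "\<ominus>\<^bsub>?Q'\<^esub> x \<in> ?H" if x: "x \<in> ?H" for x
    proof -
      obtain m where m: "m \<in> carrier ?N" "x = ?g m" using x by auto
      show ?thesis
        using additive_on_uminus[OF equivariant_additive[OF g] aN aQ' m(1)] m N.a_inv_closed[OF m(1)]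
        by (intro image_eqI[of _ _ "\<ominus>\<^bsub>?N\<^esub> m"]) simp_all
    qed
    show "x \<oplus>\<^bsub>?Q'\<^esub> y \<in> ?H" if xy: "x \<in> ?H" "y \<in> ?H" for x y
    proof -
      obtain m m' where m: "m \<in> carrier ?N" "x = ?g m" "m' \<in> carrier ?N" "y = ?g m'" using xy by auto
      show ?thesis
        using equivariant_add[OF g m(1,3)] m N.a_closed[OF m(1,3)]
        by (intro image_eqI[of _ _ "m \<oplus>\<^bsub>?N\<^esub> m'"]) simp_all
    qed
    show "l \<odot>\<^bsub>?Q'\<^esub> x \<in> ?H" if l: "l \<in> carrier L" and x: "x \<in> ?H" for l x
    proof -
      obtain m where m: "m \<in> carrier ?N" "x = ?g m" using x by auto
      show ?thesis
        using equivariant_act[OF g l m(1)] m l left_module.act_closed[OF M]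
        by (intro image_eqI[of _ _ "l \<odot>\<^bsub>?N\<^esub> m"]) simp_all
    qed
  qed
  have gI: "equivariant L ?N ?I ?g"
    using g by (intro equivariantI) (auto simp: equivariant_add[OF g, simplified] equivariant_act[OF g, simplified])
  have inclI: "equivariant L ?I ?Q' (\<lambda>x. x)" using HQ by (intro equivariantI) auto
  have z0: "?g m = \<zero>\<^bsub>?I\<^esub> \<longleftrightarrow> \<tau> m = te M \<one> m" if m: "m \<in> carrier M" for m
  proof -
    have c: "\<tau> m \<in> carrier (T M)" "te M \<one> m \<in> carrier (T M)"
      using equivariant_closed[OF hopf_moduleD(2)[OF H] m] M m by simp_all
    have "?g m = \<zero>\<^bsub>?I\<^esub> \<longleftrightarrow> ?\<delta> m = \<zero>\<^bsub>T M\<^esub>"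
      using inj_on_eq_iff[OF e, of "?\<delta> m" "\<zero>\<^bsub>T M\<^esub>"] c by (simp add: transport_simps(2)[OF eQ])
    also have "\<dots> \<longleftrightarrow> \<tau> m = te M \<one> m"
      using c by (simp add: a_minus_eq_zero_iff[OF TM.abelian_group_axioms])
    finally show ?thesis .
  qed
  have C: "?C = ?N\<lparr>carrier := {n \<in> carrier ?N. ?g n = \<zero>\<^bsub>?I\<^esub>}\<rparr>"
    unfolding coinv_def prod.case using z0
    by (intro arg_cong[where f = "\<lambda>H. ?N\<lparr>carrier := H\<rparr>"]) auto
  let ?K = "{z \<in> carrier (ANM M). imap ?Q ?\<delta> z = \<zero>\<^bsub>ANM (diag_module M)\<^esub>}"
  note i = imap_additive[OF RC RN equivariant_coinv_incl[OF H]] imap_tens[OF RC RN equivariant_coinv_incl[OF H]]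
  have "bij_betw (imap ?N (\<lambda>m. m)) (carrier (AN A L t ?C)) ?K"
  proof (rule bij_betw_imageI)
    show "inj_on (imap ?N (\<lambda>m. m)) (carrier (AN A L t ?C))"
      using flat_inj[OF fl RN] RC unfolding C by auto
    have 1: "imap ?N (\<lambda>m. m) w \<in> ?K" if w: "w \<in> carrier (AN A L t ?C)" for w
    proof -
      have "imap ?Q ?\<delta> (imap ?N (\<lambda>m. m) w) = \<zero>\<^bsub>ANM (diag_module M)\<^esub>"
      proof (rule tensor_product.ext[OF tensor_AN[OF RC] additive_on_comp[OF i(1) imap_additive[OF RN RQ \<delta>]] _
            tensor_product.abelian[OF tensor_AN[OF RQ]] _ w])
        interpret TQ: abelian_group "ANM (diag_module M)" by (rule tensor_product.abelian[OF tensor_AN[OF RQ]])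
        show "additive_on (AN A L t ?C) (ANM (diag_module M)) (\<lambda>_. \<zero>\<^bsub>ANM (diag_module M)\<^esub>)"
          by (simp add: additive_on_def)
        fix x m assume "x \<in> carrier (rmul A t)" "m \<in> carrier ?C"
        then have x: "x \<in> carrier A" and m: "m \<in> carrier ?C" "m \<in> carrier M" "\<tau> m = te M \<one> m"
          by (simp_all add: coinv_carrier)
        have "additive_on ?Q (ANM (diag_module M)) (anm (diag_module M) x)"
          using balanced_right[OF tensor_product.tens_balanced[OF tensor_AN[OF RQ]]] x by simp
        then have "anm (diag_module M) x \<zero>\<^bsub>?Q\<^esub> = \<zero>\<^bsub>ANM (diag_module M)\<^esub>"
          by (rule additive_on_zero) (use act_group_right_module[OF RQ] TQ.abelian_group_axioms in \<open>auto simp: act_group_def\<close>)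
        moreover have "?\<delta> m = \<zero>\<^bsub>?Q\<^esub>"
          using m M by (simp add: a_minus_def TM.r_neg)
        ultimately show "imap ?Q ?\<delta> (imap ?N (\<lambda>m. m) (an' ?C x m)) = \<zero>\<^bsub>ANM (diag_module M)\<^esub>"
          using x m by (simp add: i(2) imap_tens[OF RN RQ \<delta>])
      qed
      then show ?thesis using additive_on_closed[OF i(1) w] by simp
    qed
    have 2: "z \<in> imap ?N (\<lambda>m. m) ` carrier (AN A L t ?C)" if z: "z \<in> ?K" for z
    proof -
      have zN: "z \<in> carrier (AN A L t ?N)" and z0: "imap ?Q ?\<delta> z = \<zero>\<^bsub>AN A L t ?Q\<^esub>" using z by simp_all
      note ab = tensor_product.abelian[OF tensor_AN]
      \<comment> \<open>After the inclusion \<open>?I \<subseteq> ?Q'\<close> the image of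
        \<open>z\<close> is the renamed copy of its image under the difference map, hence zero;
        flatness then gives that it already vanishes over \<open>?I\<close>.\<close>
      have "imap ?Q' (\<lambda>x. x) (imap ?I ?g z) = imap ?Q' ?g z"
        by (rule tmap_comp[OF tensor_AN[OF RN] tensor_AN[OF RI] tensor_AN[OF RQ'] gI inclI zN])
      also have "\<dots> = imap ?Q' e (imap ?Q ?\<delta> z)"
        by (rule tmap_comp[OF tensor_AN[OF RN] tensor_AN[OF RQ] tensor_AN[OF RQ'] \<delta> ee zN, symmetric])
      also have "\<dots> = \<zero>\<^bsub>AN A L t ?Q'\<^esub>"
        unfolding z0 by (rule additive_on_zero[OF imap_additive[OF RQ RQ' ee] ab[OF RQ] ab[OF RQ']])
      also have "\<dots> = imap ?Q' (\<lambda>x. x) \<zero>\<^bsub>AN A L t ?I\<^esub>"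
        by (rule additive_on_zero[OF imap_additive[OF RI RQ' inclI] ab[OF RI] ab[OF RQ'], symmetric])
      finally have eq: "imap ?Q' (\<lambda>x. x) (imap ?I ?g z) = imap ?Q' (\<lambda>x. x) \<zero>\<^bsub>AN A L t ?I\<^esub>" .
      interpret TI: abelian_group "AN A L t ?I" by (rule ab[OF RI])
      have "imap ?I ?g z = \<zero>\<^bsub>AN A L t ?I\<^esub>"
        using inj_onD[OF flat_inj[OF fl RQ' RI HQ] eq] additive_on_closed[OF imap_additive[OF RN RI gI] zN] by simp
      then show ?thesis
        by (intro tensor_right_exact[OF RN RI gI _ C RC zN]) simp_all
    qed
    show "imap ?N (\<lambda>m. m) ` carrier (AN A L t ?C) = ?K" using 1 2 by blast
  qed
  then show ?thesis
    unfolding coinv_kernel_preserved_def prod.case induced_map_eq_tmap AM_right_cong[OF M] .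
qed

end

section \<open>The equivalence of categories\<close>

context left_bialgebroid
begin

interpretation A: ring A by (rule ring_A)

section \<open>Morphisms of Hopf modules and transport along a renaming\<close>

definition hopf_hom :: "('a, 'm) module \<Rightarrow> ('m \<Rightarrow> ('a \<times> 'm \<Rightarrow>\<^sub>0 int) set) \<Rightarrow> ('a, 'n) module
    \<Rightarrow> ('n \<Rightarrow> ('a \<times> 'n \<Rightarrow>\<^sub>0 int) set) \<Rightarrow> ('m \<Rightarrow> 'n) \<Rightarrow> bool" where
  "hopf_hom M \<tau> M' \<tau>' f \<longleftrightarrow> equivariant A M M' f \<and> (\<forall>m\<in>carrier M. \<tau>' (f m) = amap M' f (\<tau> m))"

lemma hopf_homD:
  assumes "hopf_hom M \<tau> M' \<tau>' f"
  shows "equivariant A M M' f" "m \<in> carrier M \<Longrightarrow> \<tau>' (f m) = amap M' f (\<tau> m)"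
    "m \<in> carrier M \<Longrightarrow> f m \<in> carrier M'"
  using assms equivariant_closed by (auto simp: hopf_hom_def)

lemma hopf_module_closed: "\<lbrakk>hopf_module M \<tau>; m \<in> carrier M\<rbrakk> \<Longrightarrow> \<tau> m \<in> carrier (T M)"
  using equivariant_closed[OF hopf_moduleD(2)] by fastforce

lemma act_group_left_module: "left_module A M \<Longrightarrow> act_group A M"
  by (simp add: act_group_def left_moduleD left_module.act_closed)

lemma hopf_hom_cong:
  assumes f: "hopf_hom M \<tau> M' \<tau>' f" and M: "hopf_module M \<tau>" "left_module A M'"
    and eq: "\<And>m. m \<in> carrier M \<Longrightarrow> g m = f m"
  shows "hopf_hom M \<tau> M' \<tau>' g"
  unfolding hopf_hom_def
proof (intro conjI ballI)
  note M0 = hopf_moduleD(1)[OF M(1)]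
  show "equivariant A M M' g"
    by (rule equivariant_cong[OF hopf_homD(1)[OF f] act_group_left_module[OF M0] eq])
  fix m assume m: "m \<in> carrier M"
  have "amap M' g (\<tau> m) = amap M' f (\<tau> m)"
    by (rule amap_cong[OF M0 M(2) hopf_homD(3)[OF f] eq hopf_module_closed[OF M(1) m]])
  then show "\<tau>' (g m) = amap M' g (\<tau> m)" using hopf_homD(2)[OF f m] m by (simp add: eq)
qed

lemma hopf_hom_id: "hopf_module M \<tau> \<Longrightarrow> hopf_hom M \<tau> M \<tau> (\<lambda>m. m)"
  unfolding hopf_hom_def
  by (simp add: equivariant_id tmap_id[OF tensor_AM[OF hopf_moduleD(1)]] hopf_module_closed)

lemma hopf_hom_comp:
  assumes f: "hopf_hom M \<tau> M' \<tau>' f" and g: "hopf_hom M' \<tau>' M'' \<tau>'' g"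
    and M: "hopf_module M \<tau>" "left_module A M'" "left_module A M''"
  shows "hopf_hom M \<tau> M'' \<tau>'' (\<lambda>x. g (f x))"
  using hopf_homD[OF f] hopf_homD[OF g] hopf_moduleD(1)[OF M(1)] M(2,3)
  by (simp add: hopf_hom_def equivariant_comp[of A M M' f M'' g] hopf_module_closed[OF M(1)]
      amap_comp[of M M' M''] equivariant_scalars)

lemma hopf_hom_inv:
  assumes f: "hopf_hom M \<tau> M' \<tau>' f" and b: "bij_betw f (carrier M) (carrier M')"
    and M: "hopf_module M \<tau>" "hopf_module M' \<tau>'"
  shows "hopf_hom M' \<tau>' M \<tau> (inv_into (carrier M) f)"
proof -
  note M0 = hopf_moduleD(1)[OF M(1)] hopf_moduleD(1)[OF M(2)]
  interpret M: left_module A M by (rule M0)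
  let ?d = "inv_into (carrier M) f"
  have d: "?d (f m) = m" if "m \<in> carrier M" for m using bij_betw_inv_into_left[OF b that] .
  have s: "carrier M' = f ` carrier M" using b by (simp add: bij_betw_def)
  have e: "equivariant A M' M ?d"
    using hopf_homD(1)[OF f] unfolding s equivariant_def additive_on_def Pi_iff
    by (auto simp: d M.act_closed simp flip: equivariant_add[OF hopf_homD(1)[OF f]] equivariant_act[OF hopf_homD(1)[OF f]])
  have "\<tau> (?d (f m)) = amap M ?d (\<tau>' (f m))" if m: "m \<in> carrier M" for m
  proof -
    have \<tau>m: "\<tau> m \<in> carrier (T M)" by (rule hopf_module_closed[OF M(1) m])
    have "amap M ?d (\<tau>' (f m)) = amap M (\<lambda>x. ?d (f x)) (\<tau> m)"
      unfolding hopf_homD(2)[OF f m]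
      by (rule amap_comp[OF M0 M0(1) equivariant_scalars(1)[OF hopf_homD(1)[OF f]] equivariant_scalars(1)[OF e] \<tau>m])
    also have "\<dots> = amap M (\<lambda>x. x) (\<tau> m)"
      by (rule amap_cong[OF M0(1) M0(1) _ _ \<tau>m]) (simp_all add: d)
    also have "\<dots> = \<tau> m" by (rule tmap_id[OF tensor_AM[OF M0(1)] \<tau>m])
    finally show ?thesis by (simp add: d m)
  qed
  then show ?thesis using e by (auto simp: hopf_hom_def s)
qed

lemma hopf_hom_coinv:
  assumes f: "hopf_hom M \<tau> M' \<tau>' f" and M: "hopf_module M \<tau>" "hopf_module M' \<tau>'"
  shows "equivariant L (coinv A L s t (M, \<tau>)) (coinv A L s t (M', \<tau>')) f"
proof -
  note M0 = hopf_moduleD(1)[OF M(1)] hopf_moduleD(1)[OF M(2)]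
  note e = hopf_homD(1)[OF f] and a = tmap_AM(2)[OF M0 equivariant_scalars(1)[OF hopf_homD(1)[OF f]]]
  show ?thesis
    by (rule equivariantI)
      (auto simp: coinv_carrier hopf_homD[OF f] a equivariant_add[OF e] equivariant_act[OF e])
qed

definition transport_coaction :: "('m \<Rightarrow> 'u) \<Rightarrow> ('a, 'm) module \<Rightarrow> ('m \<Rightarrow> ('a \<times> 'm \<Rightarrow>\<^sub>0 int) set)
    \<Rightarrow> 'u \<Rightarrow> ('a \<times> 'u \<Rightarrow>\<^sub>0 int) set" where
  "transport_coaction e M \<tau> x = amap (transport_module e M) e (\<tau> (inv_into (carrier M) e x))"

lemma transport_hopf_module_eq:
  "transport_hopf_module A L s t e (M, \<tau>) = (transport_module e M, transport_coaction e M \<tau>)"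
  by (simp add: transport_hopf_module_def transport_coaction_def[abs_def] tmap_def Let_def)

context
  fixes M :: "('a, 'm) module" and \<tau> and e :: "'m \<Rightarrow> 'u"
  assumes H: "hopf_module M \<tau>" and inj: "inj_on e (carrier M)"
begin

lemma transport_hopf: "hopf_module (transport_module e M) (transport_coaction e M \<tau>)"
  and hopf_hom_transport: "hopf_hom M \<tau> (transport_module e M) (transport_coaction e M \<tau>) e"
proof -
  let ?M' = "transport_module e M" and ?\<sigma> = "transport_coaction e M \<tau>"
  note M = hopf_moduleD(1)[OF H]
  note M' = left_module_transport[OF inj M] and e = equivariant_transport[OF inj, of A]
  have eq: "?\<sigma> (e m) = amap ?M' e (\<tau> m)" if "m \<in> carrier M" for m
    using that inj by (simp add: transport_coaction_def)
  have d: "equivariant A ?M' M (inv_into (carrier M) e)"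
    by (rule equivariant_transport_inv[OF inj act_group_left_module[OF M]])
  have \<sigma>: "equivariant A ?M' (diag_module ?M') ?\<sigma>"
    unfolding transport_coaction_def[abs_def]
    by (rule equivariant_comp[OF d equivariant_comp[OF hopf_moduleD(2)[OF H] equivariant_amap[OF M M' e]]])
  note im = hopf_module_image[OF H M' e \<sigma> eq]
  show "hopf_module ?M' ?\<sigma>"
    using M' \<sigma> im by (auto simp: hopf_module_def transport_simps[OF inj])
  show "hopf_hom M \<tau> ?M' ?\<sigma> e" using e eq by (simp add: hopf_hom_def)
qed

lemma bij_betw_transport: "bij_betw e (carrier M) (carrier (transport_module e M))"
  using inj by (simp add: bij_betw_def transport_simps[OF inj])

text \<open>Both \<open>e\<close> and its inverse are morphisms of Hopf modules, and morphisms send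
  coinvariants to coinvariants.\<close>

lemma bij_betw_coinv_transport:
  "bij_betw e (carrier (coinv A L s t (M, \<tau>)))
     (carrier (coinv A L s t (transport_module e M, transport_coaction e M \<tau>)))"
proof (rule bij_betwI[where g = "inv_into (carrier M) e"])
  note h = hopf_hom_transport and h' = hopf_hom_inv[OF hopf_hom_transport bij_betw_transport H transport_hopf]
  show "e \<in> carrier (coinv A L s t (M, \<tau>)) \<rightarrow> carrier (coinv A L s t (transport_module e M, transport_coaction e M \<tau>))"
    using equivariant_closed[OF hopf_hom_coinv[OF h H transport_hopf]] by blast
  show "inv_into (carrier M) e \<in> carrier (coinv A L s t (transport_module e M, transport_coaction e M \<tau>))
      \<rightarrow> carrier (coinv A L s t (M, \<tau>))"
    using equivariant_closed[OF hopf_hom_coinv[OF h' transport_hopf H]] by blast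
qed (use inj in \<open>auto simp: coinv_carrier transport_simps[OF inj]\<close>)

end

lemma hopf_hom_imap:
  assumes N: "right_module L N" "right_module L N'" and g: "equivariant L N N' g"
  shows "hopf_hom (IM N) (induced_coaction N) (IM N') (induced_coaction N') (imap N' g)"
  unfolding hopf_hom_def
proof (intro conjI ballI)
  note i = imap_additive[OF N g] imap_tens[OF N g]
  note I = left_module_induced[OF N(1)] left_module_induced[OF N(2)]
  interpret TN: tensor_product L "rmul A t" N by (rule tensor_AN[OF N(1)])
  interpret TN': tensor_product L "rmul A t" N' by (rule tensor_AN[OF N(2)])
  have "imap N' g (a \<odot>\<^bsub>IM N\<^esub> z) = a \<odot>\<^bsub>IM N'\<^esub> imap N' g z"
    if a: "a \<in> carrier A" and z: "z \<in> carrier (AN A L t N)" for a z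
    by (rule TN.ext[OF additive_on_comp[OF induced_act(1)[OF N(1) a] i(1)]
          additive_on_comp[OF i(1) induced_act(1)[OF N(2) a]] TN'.abelian _ z])
      (simp add: a i(2) induced_act(2)[OF N(1)] induced_act(2)[OF N(2)] equivariant_closed[OF g])
  then show e: "equivariant A (IM N) (IM N') (imap N' g)"
    using i(1) by (simp add: equivariant_def)
  note \<tau> = equivariant_additive[OF equivariant_induced_coaction[OF N(1)], simplified]
    and \<tau>' = equivariant_additive[OF equivariant_induced_coaction[OF N(2)], simplified]
  note a = tmap_AM[OF I equivariant_scalars(1)[OF e]]
  fix z assume "z \<in> carrier (IM N)"
  then have z: "z \<in> carrier (AN A L t N)" by simp
  show "induced_coaction N' (imap N' g z) = amap (IM N') (imap N' g) (induced_coaction N z)"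
  proof (rule TN.ext[OF additive_on_comp[OF i(1) \<tau>'] additive_on_comp[OF \<tau> a(1)] abelian_T[OF I(2)] _ z])
    fix x n assume "x \<in> carrier (rmul A t)" "n \<in> carrier N"
    then have x: "x \<in> carrier A" and n: "n \<in> carrier N" by simp_all
    have \<gamma>x: "\<gamma> x \<in> carrier (T (regular A))" using x by simp
    have "amap (IM N') (imap N' g) (amap (IM N) (\<lambda>v. an' N v n) (\<gamma> x)) =
        amap (IM N') (\<lambda>v. imap N' g (an' N v n)) (\<gamma> x)"
      by (rule amap_comp[OF left_module_regular_A I equivariant_scalars(1)[OF equivariant_an[OF N(1) n]]
            equivariant_scalars(1)[OF e] \<gamma>x])
    also have "\<dots> = amap (IM N') (\<lambda>v. an' N' v (g n)) (\<gamma> x)"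
      using equivariant_closed[OF g n] n
      by (intro amap_cong[OF left_module_regular_A I(2) _ _ \<gamma>x]) (simp_all add: i(2) N)
    finally show "induced_coaction N' (imap N' g (an' N x n)) =
        amap (IM N') (imap N' g) (induced_coaction N (an' N x n))"
      using x n equivariant_closed[OF g n] by (simp add: i(2) induced_coaction_tens(1) N)
  qed
qed

text \<open>On \<open>x \<otimes> m\<close> with \<open>m\<close> coinvariant, both ways around give
  \<open>x\<close> applied to \<open>1 \<otimes> m\<close>, by \<open>A\<close>-linearity of the
  maps involved.\<close>

lemma hopf_hom_ev:
  assumes H: "hopf_module M \<tau>"
  shows "hopf_hom (IM (coinv A L s t (M, \<tau>))) (induced_coaction (coinv A L s t (M, \<tau>))) M \<tau> (ev M)"
  unfolding hopf_hom_def
proof (intro conjI ballI)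
  let ?C = "coinv A L s t (M, \<tau>)"
  note M = hopf_moduleD(1)[OF H] and RC = right_module_coinv[OF H]
  note I = left_module_induced[OF RC]
  show e: "equivariant A (IM ?C) M (ev M)" by (rule equivariant_ev[OF H])
  note a = tmap_AM[OF I M equivariant_scalars(1)[OF e]]
  note \<tau>C = equivariant_additive[OF equivariant_induced_coaction[OF RC], simplified]
    and \<tau> = equivariant_additive[OF hopf_moduleD(2)[OF H], simplified]
  fix z assume "z \<in> carrier (IM ?C)"
  then have z: "z \<in> carrier (AN A L t ?C)" by simp
  show "\<tau> (ev M z) = amap M (ev M) (induced_coaction ?C z)"
  proof (rule tensor_product.ext[OF tensor_AN[OF RC] additive_on_comp[OF ev_additive[OF H] \<tau>]
        additive_on_comp[OF \<tau>C a(1)] abelian_T[OF M] _ z])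
    fix x m assume "x \<in> carrier (rmul A t)" and m: "m \<in> carrier ?C"
    then have x: "x \<in> carrier A" and m': "m \<in> carrier M" "\<tau> m = te M \<one> m"
      by (simp_all add: coinv_carrier)
    have "amap M (ev M) (diag (IM ?C) x (te (IM ?C) \<one> (an' ?C \<one> m))) = diag M x (te M \<one> (ev M (an' ?C \<one> m)))"
      using equivariant_act[OF equivariant_amap[OF I M e] x, where p = "te (IM ?C) \<one> (an' ?C \<one> m)"] I RC m
      by (simp add: a(2))
    then show "\<tau> (ev M (an' ?C x m)) = amap M (ev M) (induced_coaction ?C (an' ?C x m))"
      using x m m' equivariant_act[OF hopf_moduleD(2)[OF H] x m'(1)] left_module.act_one[OF M m'(1)]
      by (simp add: induced_coaction_tens(2)[OF RC] ev_tens[OF H])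
  qed
qed

lemma ev_natural:
  assumes f: "hopf_hom M \<tau> M' \<tau>' f" and H: "hopf_module M \<tau>" "hopf_module M' \<tau>'"
    and z: "z \<in> carrier (AN A L t (coinv A L s t (M, \<tau>)))"
  shows "ev M' (imap (coinv A L s t (M', \<tau>')) f z) = f (ev M z)"
proof -
  note R = right_module_coinv[OF H(1)] right_module_coinv[OF H(2)]
  note c = hopf_hom_coinv[OF f H]
  note i = imap_additive[OF R c] imap_tens[OF R c]
  show ?thesis
  proof (rule tensor_product.ext[OF tensor_AN[OF R(1)] additive_on_comp[OF i(1) ev_additive[OF H(2)]]
        additive_on_comp[OF ev_additive[OF H(1)] equivariant_additive[OF hopf_homD(1)[OF f]]]
        left_moduleD(2)[OF hopf_moduleD(1)[OF H(2)]] _ z])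
    fix x m assume "x \<in> carrier (rmul A t)" and m: "m \<in> carrier (coinv A L s t (M, \<tau>))"
    then have x: "x \<in> carrier A" and m': "m \<in> carrier M" by (simp_all add: coinv_carrier)
    show "ev M' (imap (coinv A L s t (M', \<tau>')) f (an' (coinv A L s t (M, \<tau>)) x m)) =
        f (ev M (an' (coinv A L s t (M, \<tau>)) x m))"
      using ev_tens[OF H(2) x equivariant_closed[OF c m]] ev_tens[OF H(1) x m]
        equivariant_act[OF hopf_homD(1)[OF f] x m'] x m
      by (simp add: i(2))
  qed
qed

end

section \<open>The two categories and the coinvariants functor\<close>

lemma linear_maps_restrict:
  "\<lbrakk>equivariant B P Q f; act_group B P\<rbrakk> \<Longrightarrow> restrict f (carrier P) \<in> linear_maps B P Q"
  by (simp add: linear_maps_iff equivariant_cong[of B P Q f])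

lemma compose_id: "f \<in> extensional A \<Longrightarrow> compose A f (restrict id A) = f"
  by (rule extensionalityI[of _ A]) (auto simp: compose_def)

lemma id_compose: "\<lbrakk>f \<in> extensional A; \<And>x. x \<in> A \<Longrightarrow> f x \<in> B\<rbrakk> \<Longrightarrow> compose A (restrict id B) f = f"
  by (rule extensionalityI[of _ A]) (auto simp: compose_def)

lemma inverse_equivalencesI:
  assumes "is_category C" "is_category D" "is_functor C D G" "is_functor D C F"
    "naturally_isomorphic D D (comp_functor G F) id_functor"
    "naturally_isomorphic C C (comp_functor F G) id_functor"
  shows "inverse_equivalences C D G F"
  using assms by (simp add: inverse_equivalences_def)

lemma right_module_cat_simps:
  "obj (right_module_cat L) = {N. right_module L N}" "arr (right_module_cat L) = linear_maps L"
  "ident (right_module_cat L) N = restrict id (carrier N)"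
  "comp (right_module_cat L) N Y Z g f = compose (carrier N) g f"
  by (simp_all add: right_module_cat_def)

lemma linear_maps_closed: "\<lbrakk>f \<in> linear_maps B P Q; p \<in> carrier P\<rbrakk> \<Longrightarrow> f p \<in> carrier Q"
  by (auto simp: linear_maps_iff equivariant_closed)

lemma compose_linear_maps:
  assumes "f \<in> linear_maps B P Q" "g \<in> linear_maps B Q U" "act_group B P"
  shows "compose (carrier P) g f \<in> linear_maps B P U"
  unfolding compose_def using assms
  by (intro linear_maps_restrict) (auto simp: linear_maps_iff intro: equivariant_comp)

lemma is_category_right_modules: "is_category (right_module_cat L)"
  unfolding is_category_def right_module_cat_simps
proof (intro conjI ballI)
  fix X assume "X \<in> {N. right_module L N}"
  then show "restrict id (carrier X) \<in> linear_maps L X X"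
    by (intro linear_maps_restrict act_group_right_module) (simp_all add: id_def equivariant_id)
next
  fix X Y f assume "X \<in> {N. right_module L N}" and f: "f \<in> linear_maps L X Y"
  show "compose (carrier X) f (restrict id (carrier X)) = f" "compose (carrier X) (restrict id (carrier Y)) f = f"
    using f linear_maps_closed[OF f] by (auto simp: linear_maps_iff intro!: compose_id id_compose)
next
  fix X Y Z f g assume "X \<in> {N. right_module L N}" "f \<in> linear_maps L X Y" "g \<in> linear_maps L Y Z"
  then show "compose (carrier X) g f \<in> linear_maps L X Z"
    by (intro compose_linear_maps act_group_right_module) simp_all
next
  fix W X Y Z f g h assume f: "f \<in> linear_maps L W X" and "g \<in> linear_maps L X Y" "h \<in> linear_maps L Y Z"
  show "compose (carrier W) h (compose (carrier W) g f) = compose (carrier W) (compose (carrier X) h g) f"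
    by (rule compose_assoc) (use linear_maps_closed[OF f] in auto)
qed

context left_bialgebroid
begin

interpretation A: ring A by (rule ring_A)

lemma hopf_arr_iff:
  "f \<in> hopf_module_homs A L s t (M, \<tau>) (M', \<tau>') \<longleftrightarrow> f \<in> extensional (carrier M) \<and> hopf_hom M \<tau> M' \<tau>' f"
  by (auto simp: hopf_module_homs_def hopf_hom_def linear_maps_iff tmap_def)

lemma hopf_module_cat_simps:
  "obj (hopf_module_cat A L s t \<gamma> \<pi>) = {(M, \<tau>). hopf_module M \<tau>}"
  "arr (hopf_module_cat A L s t \<gamma> \<pi>) = hopf_module_homs A L s t"
  "ident (hopf_module_cat A L s t \<gamma> \<pi>) (M, \<tau>) = restrict id (carrier M)"
  "comp (hopf_module_cat A L s t \<gamma> \<pi>) (M, \<tau>) Y Z g f = compose (carrier M) g f"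
  by (simp_all add: hopf_module_cat_def left_hopf_module_iff)

lemma hopf_hom_restrict:
  assumes "hopf_hom M \<tau> M' \<tau>' f" "hopf_module M \<tau>" "hopf_module M' \<tau>'"
  shows "restrict f (carrier M) \<in> hopf_module_homs A L s t (M, \<tau>) (M', \<tau>')"
  unfolding hopf_arr_iff using hopf_hom_cong[OF assms(1,2) hopf_moduleD(1)[OF assms(3)]] by simp

lemma compose_hopf_homs:
  assumes "f \<in> hopf_module_homs A L s t (M, \<tau>) (M', \<tau>')" "g \<in> hopf_module_homs A L s t (M', \<tau>') (M'', \<tau>'')"
    and H: "hopf_module M \<tau>" "hopf_module M' \<tau>'" "hopf_module M'' \<tau>''"
  shows "compose (carrier M) g f \<in> hopf_module_homs A L s t (M, \<tau>) (M'', \<tau>'')"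
  unfolding compose_def using assms(1,2) H hopf_moduleD(1)[OF H(2)] hopf_moduleD(1)[OF H(3)]
  by (intro hopf_hom_restrict) (auto simp: hopf_arr_iff intro: hopf_hom_comp)

lemma is_category_hopf_modules: "is_category (hopf_module_cat A L s t \<gamma> \<pi>)"
  unfolding is_category_def hopf_module_cat_simps(1,2)
proof (intro conjI ballI)
  fix X :: "('a, 'x) module \<times> ('x \<Rightarrow> ('a \<times> 'x \<Rightarrow>\<^sub>0 int) set)" assume "X \<in> {(M, \<tau>). hopf_module M \<tau>}"
  then obtain M \<tau> where "X = (M, \<tau>)" "hopf_module M \<tau>" by auto
  then show "ident (hopf_module_cat A L s t \<gamma> \<pi>) X \<in> hopf_module_homs A L s t X X"
    using hopf_hom_restrict[OF hopf_hom_id] by (simp add: hopf_module_cat_simps id_def)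
next
  fix X Y :: "('a, 'x) module \<times> ('x \<Rightarrow> ('a \<times> 'x \<Rightarrow>\<^sub>0 int) set)" and f
  assume "X \<in> {(M, \<tau>). hopf_module M \<tau>}" "Y \<in> {(M, \<tau>). hopf_module M \<tau>}"
    and f: "f \<in> hopf_module_homs A L s t X Y"
  then obtain M \<tau> M' \<tau>' where X: "X = (M, \<tau>)" "Y = (M', \<tau>')" by auto
  show "comp (hopf_module_cat A L s t \<gamma> \<pi>) X X Y f (ident (hopf_module_cat A L s t \<gamma> \<pi>) X) = f"
    "comp (hopf_module_cat A L s t \<gamma> \<pi>) X Y Y (ident (hopf_module_cat A L s t \<gamma> \<pi>) Y) f = f"
    using f compose_id[of f "carrier M"] id_compose[of f "carrier M" "carrier M'"] hopf_homD(3)[of M \<tau> M' \<tau>' f]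
    unfolding X hopf_module_cat_simps hopf_arr_iff by blast+
next
  fix X Y Z :: "('a, 'x) module \<times> ('x \<Rightarrow> ('a \<times> 'x \<Rightarrow>\<^sub>0 int) set)" and f g
  assume "X \<in> {(M, \<tau>). hopf_module M \<tau>}" "Y \<in> {(M, \<tau>). hopf_module M \<tau>}" "Z \<in> {(M, \<tau>). hopf_module M \<tau>}"
    and "f \<in> hopf_module_homs A L s t X Y" "g \<in> hopf_module_homs A L s t Y Z"
  then show "comp (hopf_module_cat A L s t \<gamma> \<pi>) X Y Z g f \<in> hopf_module_homs A L s t X Z"
    by (auto simp: hopf_module_cat_simps intro: compose_hopf_homs)
next
  fix W X Y Z :: "('a, 'x) module \<times> ('x \<Rightarrow> ('a \<times> 'x \<Rightarrow>\<^sub>0 int) set)" and f g h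
  assume f: "f \<in> hopf_module_homs A L s t W X"
  obtain M \<tau> M' \<tau>' where X: "W = (M, \<tau>)" "X = (M', \<tau>')" by (metis surj_pair)
  then have fc: "f \<in> carrier M \<rightarrow> carrier M'" using f by (auto simp: hopf_arr_iff hopf_homD(3))
  show "comp (hopf_module_cat A L s t \<gamma> \<pi>) W Y Z h (comp (hopf_module_cat A L s t \<gamma> \<pi>) W X Y g f) =
    comp (hopf_module_cat A L s t \<gamma> \<pi>) W X Z (comp (hopf_module_cat A L s t \<gamma> \<pi>) X Y Z h g) f"
    unfolding X hopf_module_cat_simps by (rule compose_assoc[OF fc])
qed

lemma coinv_functor_simps:
  "on_obj (coinv_functor A L s t) = coinv A L s t"
  "on_arr (coinv_functor A L s t) X Y f = restrict f (carrier (coinv A L s t X))"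
  by (simp_all add: coinv_functor_def)

lemma coinv_subset: "carrier (coinv A L s t (M, \<tau>)) \<subseteq> carrier M"
  by (auto simp: coinv_carrier)

lemma is_functor_coinv:
  "is_functor (hopf_module_cat A L s t \<gamma> \<pi>) (right_module_cat L) (coinv_functor A L s t)"
  unfolding is_functor_def hopf_module_cat_simps(1,2) right_module_cat_simps coinv_functor_simps
proof (intro conjI ballI)
  fix X :: "('a, 'x) module \<times> ('x \<Rightarrow> ('a \<times> 'x \<Rightarrow>\<^sub>0 int) set)" assume "X \<in> {(M, \<tau>). hopf_module M \<tau>}"
  then obtain M \<tau> where X: "X = (M, \<tau>)" "hopf_module M \<tau>" by auto
  show "coinv A L s t X \<in> {N. right_module L N}" using right_module_coinv X by simp
  show "restrict (ident (hopf_module_cat A L s t \<gamma> \<pi>) X) (carrier (coinv A L s t X)) =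
      restrict id (carrier (coinv A L s t X))"
    unfolding X hopf_module_cat_simps using coinv_subset[of M \<tau>] by (auto simp: fun_eq_iff restrict_def)
next
  fix X Y :: "('a, 'x) module \<times> ('x \<Rightarrow> ('a \<times> 'x \<Rightarrow>\<^sub>0 int) set)" and f
  assume "X \<in> {(M, \<tau>). hopf_module M \<tau>}" "Y \<in> {(M, \<tau>). hopf_module M \<tau>}"
    and f: "f \<in> hopf_module_homs A L s t X Y"
  then obtain M \<tau> M' \<tau>' where X: "X = (M, \<tau>)" "Y = (M', \<tau>')" "hopf_module M \<tau>" "hopf_module M' \<tau>'" by auto
  show "restrict f (carrier (coinv A L s t X)) \<in> linear_maps L (coinv A L s t X) (coinv A L s t Y)"
    using f hopf_hom_coinv X act_group_right_module[OF right_module_coinv] unfolding X(1,2) hopf_arr_iff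
    by (intro linear_maps_restrict) auto
next
  fix X Y Z :: "('a, 'x) module \<times> ('x \<Rightarrow> ('a \<times> 'x \<Rightarrow>\<^sub>0 int) set)" and f g
  assume "X \<in> {(M, \<tau>). hopf_module M \<tau>}" "Y \<in> {(M, \<tau>). hopf_module M \<tau>}"
    and f: "f \<in> hopf_module_homs A L s t X Y"
  then obtain M \<tau> M' \<tau>' where X: "X = (M, \<tau>)" "Y = (M', \<tau>')" "hopf_module M \<tau>" "hopf_module M' \<tau>'" by auto
  have "f m \<in> carrier (coinv A L s t Y)" if "m \<in> carrier (coinv A L s t X)" for m
    using f equivariant_closed[OF hopf_hom_coinv[OF _ X(3,4)]] that unfolding X(1,2) hopf_arr_iff by blast
  then show "restrict (comp (hopf_module_cat A L s t \<gamma> \<pi>) X Y Z g f) (carrier (coinv A L s t X)) =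
      compose (carrier (coinv A L s t X)) (restrict g (carrier (coinv A L s t Y))) (restrict f (carrier (coinv A L s t X)))"
    using coinv_subset[of M \<tau>] unfolding X(1,2) hopf_module_cat_simps
    by (auto simp: fun_eq_iff restrict_def compose_def)
qed

section \<open>The induction functor and the two natural isomorphisms\<close>

context
  assumes embedding: "\<And>N :: ('b, 'u) module. right_module L N \<Longrightarrow> \<exists>e :: _ \<Rightarrow> 'u. inj_on e (carrier (AN A L t N))"
begin

abbreviation "ren \<equiv> (\<lambda>N :: ('b, 'u) module. renaming (carrier (AN A L t N)) :: _ \<Rightarrow> 'u)"
abbreviation "FM \<equiv> (\<lambda>N. transport_module (ren N) (IM N))"
abbreviation "F\<tau> \<equiv> (\<lambda>N. transport_coaction (ren N) (IM N) (induced_coaction N))"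
abbreviation "Farr \<equiv> (\<lambda>N N' g. \<lambda>x\<in>carrier (FM N). ren N' (imap N' g (inv_into (carrier (AN A L t N)) (ren N) x)))"

text \<open>\<open>renaming\<close> is an arbitrary choice; only the existence of an embedding into
  \<open>'u\<close> guarantees that it is injective.\<close>

lemma inj_ren: "right_module L N \<Longrightarrow> inj_on (ren N) (carrier (IM N))"
  using someI_ex[OF embedding, of N] by (simp add: renaming_def)

lemma carrier_FM: "carrier (FM N) = ren N ` carrier (AN A L t N)"
  by (simp add: transport_module_def Let_def)

lemma induction_functor_simps:
  "on_obj (induction_functor A L s t \<gamma>) N = (FM N, F\<tau> N)"
  "on_arr (induction_functor A L s t \<gamma>) N N' g = Farr N N' g"
  unfolding carrier_FM
  by (simp_all add: induction_functor_def induced_hopf_module_eq transport_hopf_module_eq induced_map_eq_tmap)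

context
  fixes N :: "('b, 'u) module"
  assumes N: "right_module L N"
begin

lemma hopf_module_F: "hopf_module (FM N) (F\<tau> N)"
  by (rule transport_hopf[OF hopf_module_induced[OF N] inj_ren[OF N]])

lemma hopf_hom_ren: "hopf_hom (IM N) (induced_coaction N) (FM N) (F\<tau> N) (ren N)"
  by (rule hopf_hom_transport[OF hopf_module_induced[OF N] inj_ren[OF N]])

lemma hopf_hom_ren_inv:
  "hopf_hom (FM N) (F\<tau> N) (IM N) (induced_coaction N) (inv_into (carrier (AN A L t N)) (ren N))"
  using hopf_hom_inv[OF hopf_hom_ren bij_betw_transport[OF hopf_module_induced[OF N] inj_ren[OF N]]
      hopf_module_induced[OF N] hopf_module_F] by simp

lemma ren_inv: "z \<in> carrier (AN A L t N) \<Longrightarrow> inv_into (carrier (AN A L t N)) (ren N) (ren N z) = z"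
  using inj_ren[OF N] by simp

end

lemma Farr_ren:
  "\<lbrakk>right_module L N; z \<in> carrier (AN A L t N)\<rbrakk> \<Longrightarrow> Farr N N' g (ren N z) = ren N' (imap N' g z)"
  by (simp add: carrier_FM ren_inv)

lemma Farr_hom:
  assumes N: "right_module L N" "right_module L N'" and g: "equivariant L N N' g"
  shows "Farr N N' g \<in> hopf_module_homs A L s t (FM N, F\<tau> N) (FM N', F\<tau> N')"
proof (rule hopf_hom_restrict[OF _ hopf_module_F[OF N(1)] hopf_module_F[OF N(2)]])
  note I = left_module_induced[OF N(1)] left_module_induced[OF N(2)]
    hopf_moduleD(1)[OF hopf_module_F[OF N(1)]] hopf_moduleD(1)[OF hopf_module_F[OF N(2)]]
  show "hopf_hom (FM N) (F\<tau> N) (FM N') (F\<tau> N') (\<lambda>x. ren N' (imap N' g (inv_into (carrier (AN A L t N)) (ren N) x)))"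
    by (rule hopf_hom_comp[OF hopf_hom_comp[OF hopf_hom_ren_inv[OF N(1)] hopf_hom_imap[OF N g]
          hopf_module_F[OF N(1)] I(1,2)] hopf_hom_ren[OF N(2)] hopf_module_F[OF N(1)] I(2,4)])
qed

lemma is_functor_induction:
  "is_functor (right_module_cat L) (hopf_module_cat A L s t \<gamma> \<pi> :: (('a, 'u) hopf_mod, 'u \<Rightarrow> 'u) cat)
     (induction_functor A L s t \<gamma>)"
  unfolding is_functor_def hopf_module_cat_simps right_module_cat_simps induction_functor_simps
proof (intro conjI ballI)
  fix N :: "('b, 'u) module" assume "N \<in> {N. right_module L N}"
  then have N: "right_module L N" by simp
  show "(FM N, F\<tau> N) \<in> {(M, \<tau>). hopf_module M \<tau>}" using hopf_module_F[OF N] by simp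
  have "imap N (restrict id (carrier N)) z = z" if z: "z \<in> carrier (AN A L t N)" for z
    using tmap_cong[OF tensor_AN[OF N] tensor_AN[OF N], of "\<lambda>x. x" "restrict id (carrier N)" z]
      tmap_id[OF tensor_AN[OF N] z] z by simp
  then show "Farr N N (restrict id (carrier N)) = restrict id (carrier (FM N))"
    by (intro ext) (auto simp: carrier_FM ren_inv[OF N])
next
  fix N N' :: "('b, 'u) module" and g
  assume "N \<in> {N. right_module L N}" "N' \<in> {N. right_module L N}" "g \<in> linear_maps L N N'"
  then show "Farr N N' g \<in> hopf_module_homs A L s t (FM N, F\<tau> N) (FM N', F\<tau> N')"
    by (intro Farr_hom) (simp_all add: linear_maps_iff)
next
  fix N N' N'' :: "('b, 'u) module" and g h
  assume "N \<in> {N. right_module L N}" "N' \<in> {N. right_module L N}" "N'' \<in> {N. right_module L N}"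
    and "g \<in> linear_maps L N N'" "h \<in> linear_maps L N' N''"
  then have N: "right_module L N" "right_module L N'" "right_module L N''"
    and g: "equivariant L N N' g" and h: "equivariant L N' N'' h" by (simp_all add: linear_maps_iff)
  have eq: "imap N'' (compose (carrier N) h g) z = imap N'' h (imap N' g z)" if z: "z \<in> carrier (AN A L t N)" for z
  proof -
    have "imap N'' (compose (carrier N) h g) z = imap N'' (\<lambda>x. h (g x)) z"
      using equivariant_closed[OF equivariant_comp[OF g h]]
      by (intro tmap_cong[OF tensor_AN[OF N(1)] tensor_AN[OF N(3)] _ _ z]) (simp_all add: compose_def)
    then show ?thesis using tmap_comp[OF tensor_AN[OF N(1)] tensor_AN[OF N(2)] tensor_AN[OF N(3)] g h z] by simp
  qed
  have c: "imap N' g z \<in> carrier (AN A L t N')" if "z \<in> carrier (AN A L t N)" for z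
    using additive_on_closed[OF imap_additive[OF N(1,2) g] that] .
  show "Farr N N'' (compose (carrier N) h g) = compose (carrier (FM N)) (Farr N' N'' h) (Farr N N' g)"
  proof (rule extensionalityI[of _ "carrier (FM N)"])
    fix x assume "x \<in> carrier (FM N)"
    then obtain z where "z \<in> carrier (AN A L t N)" "x = ren N z" by (auto simp: carrier_FM)
    then show "Farr N N'' (compose (carrier N) h g) x = compose (carrier (FM N)) (Farr N' N'' h) (Farr N N' g) x"
      by (simp add: carrier_FM compose_eq eq c ren_inv[OF N(1)] ren_inv[OF N(2)])
  qed (simp_all add: compose_extensional)
qed

lemma unit_natural_iso:
  assumes \<chi>: "additive_on A L \<chi>" "\<And>a l. \<lbrakk>a \<in> carrier A; l \<in> carrier L\<rbrakk> \<Longrightarrow> \<chi> (a \<otimes> t l) = l \<otimes>\<^bsub>L\<^esub> \<chi> a"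
      "\<chi> \<one> = \<one>\<^bsub>L\<^esub>"
    and gal: "\<And>N :: ('b, 'u) module. right_module L N \<Longrightarrow> inj_on (galois (IM N)) (carrier (ANM (IM N)))"
  shows "naturally_isomorphic (right_module_cat L) (right_module_cat L)
    (comp_functor (coinv_functor A L s t) (induction_functor A L s t \<gamma>))
    (id_functor :: (('b, 'u) module, 'u \<Rightarrow> 'u, _, _) fctr)"
proof -
  let ?C = "\<lambda>N. coinv A L s t (FM N, F\<tau> N)"
  define u where "u N n = ren N (an' N \<one> n)" for N n
  \<comment> \<open>The unit \<open>u\<close> runs from \<open>N\<close> to its image under both
    functors, whereas the isomorphism is wanted in the opposite direction; hence the
    inverse.\<close>
  define \<eta> where "\<eta> N = restrict (inv_into (carrier N) (u N)) (carrier (?C N))" for N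
  have RC: "right_module L (?C N)" if "right_module L N" for N
    by (rule right_module_coinv[OF hopf_module_F[OF that]])
  have bij: "bij_betw (u N) (carrier N) (carrier (?C N))" if N: "right_module L N" for N
    unfolding u_def
    using bij_betw_trans[OF unit_bij_betw[OF N \<chi> gal[OF N]]
        bij_betw_coinv_transport[OF hopf_module_induced[OF N] inj_ren[OF N]]]
    by (simp add: o_def)
  have e: "equivariant L N (?C N) (u N)" if N: "right_module L N" for N
  proof (rule equivariantI)
    note h = equivariant_comp[OF equivariant_an_one[OF N] equivariant_scalars(2)[OF hopf_homD(1)[OF hopf_hom_ren[OF N]]]]
    show "u N p \<in> carrier (?C N)" if "p \<in> carrier N" for p using bij_betwE[OF bij[OF N]] that by blast
    show "u N (p \<oplus>\<^bsub>N\<^esub> p') = u N p \<oplus>\<^bsub>?C N\<^esub> u N p'" if "p \<in> carrier N" "p' \<in> carrier N" for p p'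
      using equivariant_add[OF h that] by (simp add: u_def)
    show "u N (l \<odot>\<^bsub>N\<^esub> p) = l \<odot>\<^bsub>?C N\<^esub> u N p" if "l \<in> carrier L" "p \<in> carrier N" for l p
      using equivariant_act[OF h that] by (simp add: u_def)
  qed
  have inv: "inv_into (carrier N) (u N) (u N n) = n" if "right_module L N" "n \<in> carrier N" for N n
    using bij_betw_inv_into_left[OF bij] that by blast
  have C: "carrier (?C N) = u N ` carrier N" if "right_module L N" for N
    using bij[OF that] by (simp add: bij_betw_def)
  have \<eta>: "\<eta> N \<in> linear_maps L (?C N) N" if N: "right_module L N" for N
    unfolding \<eta>_def
  proof (rule linear_maps_restrict[OF equivariantI act_group_right_module[OF RC[OF N]]])
    note aN = act_group_right_module[OF N]
    then interpret N: abelian_group N by (simp add: act_group_def)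
    fix p assume "p \<in> carrier (?C N)"
    then obtain n where n: "n \<in> carrier N" "p = u N n" using C[OF N] by auto
    then show "inv_into (carrier N) (u N) p \<in> carrier N" by (simp add: inv N)
    show "inv_into (carrier N) (u N) (l \<odot>\<^bsub>?C N\<^esub> p) = l \<odot>\<^bsub>N\<^esub> inv_into (carrier N) (u N) p" if "l \<in> carrier L" for l
      using equivariant_act[OF e[OF N] that n(1)] inv[OF N, of "l \<odot>\<^bsub>N\<^esub> n"] n aN that
      by (simp add: inv N act_group_def)
    fix p' assume "p' \<in> carrier (?C N)"
    then obtain n' where n': "n' \<in> carrier N" "p' = u N n'" using C[OF N] by auto
    show "inv_into (carrier N) (u N) (p \<oplus>\<^bsub>?C N\<^esub> p') = inv_into (carrier N) (u N) p \<oplus>\<^bsub>N\<^esub> inv_into (carrier N) (u N) p'"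
      using equivariant_add[OF e[OF N] n(1) n'(1)] inv[OF N, of "n \<oplus>\<^bsub>N\<^esub> n'"] n n' by (simp add: inv N)
  qed
  have iso: "is_iso_arr (right_module_cat L) (?C N) N (\<eta> N)" if N: "right_module L N" for N
    unfolding is_iso_arr_def right_module_cat_simps
  proof (intro conjI bexI[of _ "restrict (u N) (carrier N)"])
    show "\<eta> N \<in> linear_maps L (?C N) N" by (rule \<eta>[OF N])
    show "restrict (u N) (carrier N) \<in> linear_maps L N (?C N)"
      by (rule linear_maps_restrict[OF e[OF N] act_group_right_module[OF N]])
    show "compose (carrier (?C N)) (restrict (u N) (carrier N)) (\<eta> N) = restrict id (carrier (?C N))"
      by (intro ext) (auto simp: compose_def \<eta>_def C[OF N] inv[OF N])
    show "compose (carrier N) (\<eta> N) (restrict (u N) (carrier N)) = restrict id (carrier N)"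
      by (intro ext) (auto simp: compose_def \<eta>_def C[OF N] inv[OF N])
  qed
  have nat: "compose (carrier (?C N)) (\<eta> N') (restrict (Farr N N' g) (carrier (?C N))) =
      compose (carrier (?C N)) g (\<eta> N)"
    if N: "right_module L N" "right_module L N'" and g: "g \<in> linear_maps L N N'" for N N' g
  proof -
    have ge: "equivariant L N N' g" using g by (simp add: linear_maps_iff)
    have eq: "Farr N N' g (u N n) = u N' (g n)" if n: "n \<in> carrier N" for n
      unfolding u_def using n
      by (subst Farr_ren[OF N(1)]) (simp_all add: N imap_tens[OF N ge])
    show ?thesis
    proof (rule extensionalityI[of _ "carrier (?C N)"])
      fix x assume x: "x \<in> carrier (?C N)"
      then obtain n where n: "n \<in> carrier N" "x = u N n" using C[OF N(1)] by auto
      have "\<eta> N' (u N' (g n)) = g n" "\<eta> N (u N n) = n"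
        using n equivariant_closed[OF ge n(1)] by (simp_all add: \<eta>_def C N inv)
      then show "compose (carrier (?C N)) (\<eta> N') (restrict (Farr N N' g) (carrier (?C N))) x =
          compose (carrier (?C N)) g (\<eta> N) x"
        unfolding compose_eq[OF x] restrict_apply'[OF x] unfolding n(2) eq[OF n(1)] by simp
    qed (simp_all add: compose_extensional)
  qed
  show ?thesis
    unfolding naturally_isomorphic_def comp_functor_def id_functor_def
    by (intro exI[of _ \<eta>])
      (simp add: coinv_functor_simps induction_functor_simps right_module_cat_simps iso nat del: restrict_restrict)
qed

lemma counit_natural_iso:
  assumes bij: "\<And>(M :: ('a, 'u) module) \<tau>. hopf_module M \<tau> \<Longrightarrow>
      bij_betw (ev M) (carrier (AN A L t (coinv A L s t (M, \<tau>)))) (carrier M)"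
  shows "naturally_isomorphic (hopf_module_cat A L s t \<gamma> \<pi>) (hopf_module_cat A L s t \<gamma> \<pi>)
    (comp_functor (induction_functor A L s t \<gamma>) (coinv_functor A L s t))
    (id_functor :: (('a, 'u) hopf_mod, 'u \<Rightarrow> 'u, _, _) fctr)"
proof -
  let ?C = "\<lambda>M \<tau>. coinv A L s t (M, \<tau>)"
  \<comment> \<open>The counit, after undoing the renaming of the induced module.\<close>
  define v where "v M \<tau> x = ev M (inv_into (carrier (AN A L t (?C M \<tau>))) (ren (?C M \<tau>)) x)"
    for M :: "('a, 'u) module" and \<tau> x
  define \<eta> where "\<eta> = (\<lambda>(M :: ('a, 'u) module, \<tau>). restrict (v M \<tau>) (carrier (FM (?C M \<tau>))))"
  note RC = right_module_coinv
  have vr: "v M \<tau> (ren (?C M \<tau>) z) = ev M z"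
    if "hopf_module M \<tau>" "z \<in> carrier (AN A L t (?C M \<tau>))" for M \<tau> z
    by (simp add: v_def ren_inv[OF RC[OF that(1)] that(2)])
  have hom: "hopf_hom (FM (?C M \<tau>)) (F\<tau> (?C M \<tau>)) M \<tau> (v M \<tau>)" if H: "hopf_module M \<tau>" for M \<tau>
    unfolding v_def
    by (rule hopf_hom_comp[OF hopf_hom_ren_inv[OF RC[OF H]] hopf_hom_ev[OF H] hopf_module_F[OF RC[OF H]]
          left_module_induced[OF RC[OF H]] hopf_moduleD(1)[OF H]])
  have vbij: "bij_betw (v M \<tau>) (carrier (FM (?C M \<tau>))) (carrier M)" if H: "hopf_module M \<tau>" for M \<tau>
  proof -
    have "bij_betw (inv_into (carrier (AN A L t (?C M \<tau>))) (ren (?C M \<tau>))) (carrier (FM (?C M \<tau>)))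
        (carrier (AN A L t (?C M \<tau>)))"
      using bij_betw_inv_into[OF bij_betw_transport[OF hopf_module_induced[OF RC[OF H]] inj_ren[OF RC[OF H]]]] by simp
    from bij_betw_trans[OF this bij[OF H]] show ?thesis by (simp add: v_def[abs_def] o_def)
  qed
  have iso: "is_iso_arr (hopf_module_cat A L s t \<gamma> \<pi>) (FM (?C M \<tau>), F\<tau> (?C M \<tau>)) (M, \<tau>) (\<eta> (M, \<tau>))"
    if H: "hopf_module M \<tau>" for M \<tau>
    unfolding is_iso_arr_def hopf_module_cat_simps \<eta>_def prod.case
  proof (intro conjI bexI)
    let ?w = "inv_into (carrier (FM (?C M \<tau>))) (v M \<tau>)"
    note HF = hopf_module_F[OF RC[OF H]]
    show "restrict (v M \<tau>) (carrier (FM (?C M \<tau>))) \<in> hopf_module_homs A L s t (FM (?C M \<tau>), F\<tau> (?C M \<tau>)) (M, \<tau>)"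
      by (rule hopf_hom_restrict[OF hom[OF H] HF H])
    show "restrict ?w (carrier M) \<in> hopf_module_homs A L s t (M, \<tau>) (FM (?C M \<tau>), F\<tau> (?C M \<tau>))"
      by (rule hopf_hom_restrict[OF hopf_hom_inv[OF hom[OF H] vbij[OF H] HF H] H HF])
    show "compose (carrier (FM (?C M \<tau>))) (restrict ?w (carrier M)) (restrict (v M \<tau>) (carrier (FM (?C M \<tau>)))) =
        restrict id (carrier (FM (?C M \<tau>)))"
      using bij_betw_inv_into_left[OF vbij[OF H]] bij_betwE[OF vbij[OF H]]
      by (intro ext) (auto simp: compose_def)
    show "compose (carrier M) (restrict (v M \<tau>) (carrier (FM (?C M \<tau>)))) (restrict ?w (carrier M)) =
        restrict id (carrier M)"
      using bij_betw_inv_into_right[OF vbij[OF H]] bij_betwE[OF bij_betw_inv_into[OF vbij[OF H]]]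
      by (intro ext) (auto simp: compose_def)
  qed
  have nat: "compose (carrier (FM (?C M \<tau>))) (\<eta> (M', \<tau>')) (Farr (?C M \<tau>) (?C M' \<tau>') (restrict f (carrier (?C M \<tau>)))) =
      compose (carrier (FM (?C M \<tau>))) f (\<eta> (M, \<tau>))"
    if H: "hopf_module M \<tau>" "hopf_module M' \<tau>'" and f: "f \<in> hopf_module_homs A L s t (M, \<tau>) (M', \<tau>')" for M \<tau> M' \<tau>' f
  proof -
    have fh: "hopf_hom M \<tau> M' \<tau>' f" using f by (simp add: hopf_arr_iff)
    note c = hopf_hom_coinv[OF fh H]
    have "\<eta> (M', \<tau>') (Farr (?C M \<tau>) (?C M' \<tau>') (restrict f (carrier (?C M \<tau>))) (ren (?C M \<tau>) z)) =
        f (\<eta> (M, \<tau>) (ren (?C M \<tau>) z))" if z: "z \<in> carrier (AN A L t (?C M \<tau>))" for z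
    proof -
      have 1: "imap (?C M' \<tau>') (restrict f (carrier (?C M \<tau>))) z = imap (?C M' \<tau>') f z"
        using equivariant_closed[OF c]
        by (intro tmap_cong[OF tensor_AN[OF RC[OF H(1)]] tensor_AN[OF RC[OF H(2)]] _ _ z]) simp_all
      have 2: "imap (?C M' \<tau>') f z \<in> carrier (AN A L t (?C M' \<tau>'))"
        by (rule additive_on_closed[OF imap_additive[OF RC[OF H(1)] RC[OF H(2)] c] z])
      show ?thesis
        unfolding Farr_ren[OF RC[OF H(1)] z] 1
        using z 2 by (simp add: \<eta>_def carrier_FM vr[OF H(1)] vr[OF H(2)] ev_natural[OF fh H])
    qed
    note eq = this
    show ?thesis
    proof (rule extensionalityI[of _ "carrier (FM (?C M \<tau>))"])
      fix x assume x: "x \<in> carrier (FM (?C M \<tau>))"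
      then obtain z where "z \<in> carrier (AN A L t (?C M \<tau>))" "x = ren (?C M \<tau>) z" by (auto simp: carrier_FM)
      with eq show "compose (carrier (FM (?C M \<tau>))) (\<eta> (M', \<tau>'))
            (Farr (?C M \<tau>) (?C M' \<tau>') (restrict f (carrier (?C M \<tau>)))) x =
          compose (carrier (FM (?C M \<tau>))) f (\<eta> (M, \<tau>)) x"
        unfolding compose_eq[OF x] by blast
    qed (simp_all add: compose_extensional)
  qed
  show ?thesis
    unfolding naturally_isomorphic_def comp_functor_def id_functor_def
    by (intro exI[of _ \<eta>])
      (auto simp: coinv_functor_simps induction_functor_simps hopf_module_cat_simps iso nat)
qed

end

end

theorem theorem4p2:
  fixes K :: "'k ring" and A :: "('k, 'a) module"
    and L :: "('k, 'b) module" and sL tL :: "'b \<Rightarrow> 'a"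
    and \<gamma>L :: "'a \<Rightarrow> ('a \<times> 'a \<Rightarrow>\<^sub>0 int) set" and \<pi>L :: "'a \<Rightarrow> 'b"
    and R :: "('k, 'r) module" and sR tR :: "'r \<Rightarrow> 'a"
    and \<gamma>R :: "'a \<Rightarrow> ('a \<times> 'a \<Rightarrow>\<^sub>0 int) set" and \<pi>R :: "'a \<Rightarrow> 'r"
    and S :: "'a \<Rightarrow> 'a"
  assumes hopf: "hopf_algebroid K A L sL tL \<gamma>L \<pi>L R sR tR \<gamma>R \<pi>R S"
    and universe: "infinite (UNIV :: 'u set)" "carrier A \<lesssim> (UNIV :: 'u set)"
  shows
    "((\<forall>M \<in> obj (hopf_module_cat A L sL tL \<gamma>L \<pi>L :: (('a, 'u) hopf_mod, 'u \<Rightarrow> 'u) cat).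
         coinv_kernel_preserved A L sL tL M)
       \<longrightarrow> inverse_equivalences
            (hopf_module_cat A L sL tL \<gamma>L \<pi>L :: (('a, 'u) hopf_mod, 'u \<Rightarrow> 'u) cat)
            (right_module_cat L :: (('b, 'u) module, 'u \<Rightarrow> 'u) cat)
            (coinv_functor A L sL tL) (induction_functor A L sL tL \<gamma>L))
     \<and> (flat TYPE('u) A L tL
       \<longrightarrow> (\<forall>M \<in> obj (hopf_module_cat A L sL tL \<gamma>L \<pi>L :: (('a, 'u) hopf_mod, 'u \<Rightarrow> 'u) cat).
              coinv_kernel_preserved A L sL tL M))"
proof -
  interpret H: hopf_algebroid K A L sL tL \<gamma>L \<pi>L R sR tR \<gamma>R \<pi>R S by (rule hopf)
  interpret l: left_bialgebroid K A L sL tL \<gamma>L \<pi>L by (rule H.left)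
  \<comment> \<open>Two kinds of tensor products must fit into \<open>'u\<close>:
    \<open>\<^sup>LA \<otimes> N\<^sub>L\<close> for the induction functor, and
    \<open>A\<^sub>L \<otimes> \<^sub>LM\<close> for testing flatness on the target of
    \<open>\<tau> - 1 \<otimes> -\<close>.\<close>
  have embN: "\<exists>e :: _ \<Rightarrow> 'u. inj_on e (carrier (AN A L tL N))" if "right_module L N" for N :: "('b, 'u) module"
    using universe(2) by (intro tensor_embedding[OF l.tensor_AN[OF that] universe(1)]) simp
  have embM: "\<exists>e :: _ \<Rightarrow> 'u. inj_on e (carrier (AM A L sL tL M))" if "left_module A M" for M :: "('a, 'u) module"
    using universe(2) by (intro tensor_embedding[OF l.tensor_AM[OF that] universe(1)]) simp
  note gal = H.bij_betw_galois and gali = bij_betw_imp_inj_on[OF H.bij_betw_galois]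
  show ?thesis
  proof (intro conjI impI)
    assume *: "\<forall>M \<in> obj (hopf_module_cat A L sL tL \<gamma>L \<pi>L :: (('a, 'u) hopf_mod, 'u \<Rightarrow> 'u) cat).
         coinv_kernel_preserved A L sL tL M"
    \<comment> \<open>The Galois map enters twice: bijective at \<open>M\<close> and injective at
      the diagonal module of \<open>M\<close>.\<close>
    have ev: "bij_betw (l.ev M) (carrier (AN A L tL (coinv A L sL tL (M, \<tau>)))) (carrier M)"
      if h: "l.hopf_module M \<tau>" for M :: "('a, 'u) module" and \<tau>
      using l.bij_betw_ev[OF h gal[OF l.hopf_moduleD(1)[OF h]] gali[OF l.left_module_diag[OF l.hopf_moduleD(1)[OF h]]]] * h
      by (simp add: l.hopf_module_cat_simps(1))
    show "inverse_equivalences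
            (hopf_module_cat A L sL tL \<gamma>L \<pi>L :: (('a, 'u) hopf_mod, 'u \<Rightarrow> 'u) cat)
            (right_module_cat L :: (('b, 'u) module, 'u \<Rightarrow> 'u) cat)
            (coinv_functor A L sL tL) (induction_functor A L sL tL \<gamma>L)"
      \<comment> \<open>\<open>H.\<pi>L_S\<close> fixes the map that splits the unit as
        \<open>\<pi>L \<circ> S\<close>; the kernel hypothesis arrives only through
        \<open>ev\<close>.\<close>
      by (intro inverse_equivalencesI l.is_category_hopf_modules is_category_right_modules l.is_functor_coinv
          l.is_functor_induction[OF embN] l.unit_natural_iso[OF embN H.\<pi>L_S gali[OF l.left_module_induced]]
          l.counit_natural_iso[OF embN ev])
  next
    assume fl: "flat TYPE('u) A L tL"
    show "\<forall>M \<in> obj (hopf_module_cat A L sL tL \<gamma>L \<pi>L :: (('a, 'u) hopf_mod, 'u \<Rightarrow> 'u) cat).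
              coinv_kernel_preserved A L sL tL M"
      using embM l.flat_kernel_preserved[OF fl] l.hopf_moduleD(1)
      by (fastforce simp: l.hopf_module_cat_simps(1))
  qed
qed

end
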